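(* Let $G$ be a finitely generated, virtually $2$-step nilpotent group. Let $H$ be a torsion-free, $2$-step nilpotent, finite-index, normal subgroup of $G$, and consider the induced action of $F=G/H$ on $\mathbb{Z}^d\simeq H/[[H,H]]$ by conjugation. The following assertions are equivalent: (i) There exists a finite generating set $S$ of $G$ such that $(G,S)$ has polynomial geodesic growth. (ii) There exists a finite set $A\subset\mathbb{Z}^d$ such that $P=\mathrm{Conv}(A^F)$ is a full-dimensional polytope in $\mathbb{R}^d$, and no two (distinct) elements of $A$ lie on the same facet of $P$.
   Context: Generating sets are finite and generate $G$ as a monoid (they need not be symmetric). For $w\in S^*$, $\ell(w)$ is its length and $\overline w\in G$ its evaluation; $\|g\|_S=\min\{\ell(w):w\in S^*,\overline w=g\}$; $w$ is a geodesic if $\ell(w)=\|\overline w\|_S$. The geodesic growth function is $\gamma_{\mathrm{geod}}^{(G,S)}(n)=\#\{w\in S^*: w\text{ geodesic},\ \ell(w)\le n\}$; it is polynomial if it is bounded above by a polynomial in $n$. $[[H,H]]=\{h\in H:\exists n>0,\ h^n\in[H,H]\}$ is the isolator of the commutator subgroup, so $H/[[H,H]]\simeq\mathbb{Z}^d$ for some $d$. $A^F$ denotes the union of the $F$-orbits of the elements of $A$. *)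

theory Defs
  imports
    "HOL-Algebra.Generated_Groups"
    "HOL-Algebra.Group_Action"
    "HOL-Analysis.Polytope"
    "HOL-Computational_Algebra.Polynomial"
begin

definition word_eval :: "('a, 'b) monoid_scheme \<Rightarrow> 'a list \<Rightarrow> 'a" where
  "word_eval G w = foldr (monoid.mult G) w \<one>\<^bsub>G\<^esub>"

definition generating_set :: "('a, 'b) monoid_scheme \<Rightarrow> 'a set \<Rightarrow> bool" where
  "generating_set G S \<longleftrightarrow>
     finite S \<and> S \<subseteq> carrier G \<and> carrier G = word_eval G ` lists S"

definition finitely_generated_group :: "('a, 'b) monoid_scheme \<Rightarrow> bool" where
  "finitely_generated_group G \<longleftrightarrow> (\<exists>S. generating_set G S)"

definition word_norm :: "('a, 'b) monoid_scheme \<Rightarrow> 'a set \<Rightarrow> 'a \<Rightarrow> nat" where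
  "word_norm G S g = (LEAST k. \<exists>w\<in>lists S. word_eval G w = g \<and> length w = k)"

definition geodesic :: "('a, 'b) monoid_scheme \<Rightarrow> 'a set \<Rightarrow> 'a list \<Rightarrow> bool" where
  "geodesic G S w \<longleftrightarrow> w \<in> lists S \<and> length w = word_norm G S (word_eval G w)"

definition geodesic_growth :: "('a, 'b) monoid_scheme \<Rightarrow> 'a set \<Rightarrow> nat \<Rightarrow> nat" where
  "geodesic_growth G S n = card {w. geodesic G S w \<and> length w \<le> n}"

definition polynomial_geodesic_growth :: "('a, 'b) monoid_scheme \<Rightarrow> 'a set \<Rightarrow> bool" where
  "polynomial_geodesic_growth G S \<longleftrightarrow>
     (\<exists>p :: real poly. \<forall>n. real (geodesic_growth G S n) \<le> poly p (real n))"

definition commutator_subgroup ::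
    "('a, 'b) monoid_scheme \<Rightarrow> 'a set \<Rightarrow> 'a set \<Rightarrow> 'a set" where
  "commutator_subgroup G A B =
     generate G (\<Union>a\<in>A. \<Union>b\<in>B. {a \<otimes>\<^bsub>G\<^esub> b \<otimes>\<^bsub>G\<^esub> inv\<^bsub>G\<^esub> a \<otimes>\<^bsub>G\<^esub> inv\<^bsub>G\<^esub> b})"

primrec lower_central :: "('a, 'b) monoid_scheme \<Rightarrow> 'a set \<Rightarrow> nat \<Rightarrow> 'a set" where
  "lower_central G K 0 = K"
| "lower_central G K (Suc n) = commutator_subgroup G (lower_central G K n) K"

(* As usual, "s-step" means nilpotency class at most s, so abelian groups are 2-step nilpotent. *)
definition step_nilpotent :: "nat \<Rightarrow> ('a, 'b) monoid_scheme \<Rightarrow> 'a set \<Rightarrow> bool" where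
  "step_nilpotent s G K \<longleftrightarrow> subgroup K G \<and> lower_central G K s = {\<one>\<^bsub>G\<^esub>}"

definition finite_index :: "('a, 'b) monoid_scheme \<Rightarrow> 'a set \<Rightarrow> bool" where
  "finite_index G K \<longleftrightarrow> subgroup K G \<and> finite (rcosets\<^bsub>G\<^esub> K)"

definition virtually_step_nilpotent :: "nat \<Rightarrow> ('a, 'b) monoid_scheme \<Rightarrow> bool" where
  "virtually_step_nilpotent s G \<longleftrightarrow> (\<exists>K. finite_index G K \<and> step_nilpotent s G K)"

definition torsion_free :: "('a, 'b) monoid_scheme \<Rightarrow> 'a set \<Rightarrow> bool" where
  "torsion_free G K \<longleftrightarrow>
     (\<forall>h\<in>K. \<forall>n>0. h [^]\<^bsub>G\<^esub> (n :: nat) = \<one>\<^bsub>G\<^esub> \<longrightarrow> h = \<one>\<^bsub>G\<^esub>)"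

definition isolator :: "('a, 'b) monoid_scheme \<Rightarrow> 'a set \<Rightarrow> 'a set" where
  "isolator G H = {h \<in> H. \<exists>n>0. h [^]\<^bsub>G\<^esub> (n :: nat) \<in> derived G H}"

abbreviation abelianization_mod_torsion ::
    "('a, 'b) monoid_scheme \<Rightarrow> 'a set \<Rightarrow> 'a set monoid" where
  "abelianization_mod_torsion G H \<equiv> (G\<lparr>carrier := H\<rparr>) Mod isolator G H"

(* The lattice Z^d inside R^d, where R^d is the span of the coordinates in D and d = card D.
   Index types are nonempty, so D = UNIV alone would exclude d = 0, that is, H trivial. *)
definition int_lattice :: "'n::finite set \<Rightarrow> (real ^ 'n) set" where
  "int_lattice D = {x. (\<forall>i\<in>D. x $ i \<in> \<int>) \<and> (\<forall>i. i \<notin> D \<longrightarrow> x $ i = 0)}"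

definition int_lattice_group :: "'n::finite set \<Rightarrow> (real ^ 'n) monoid" where
  "int_lattice_group D = \<lparr>carrier = int_lattice D, monoid.mult = (+), one = 0\<rparr>"

(* The action of a coset f in G/H on the lattice, transported along
   \<phi> : H/[[H,H]] \<rightarrow> Z^d. All g in f conjugate a given coset of [[H,H]] to the same coset,
   so the union is that coset; see conj_action_coset. *)
definition conj_action ::
    "('a, 'b) monoid_scheme \<Rightarrow> 'a set \<Rightarrow> ('a set \<Rightarrow> real ^ 'n) \<Rightarrow> 'a set \<Rightarrow> real ^ 'n \<Rightarrow> real ^ 'n"
  where
  "conj_action G H \<phi> f v =
     \<phi> (\<Union>g\<in>f. (\<lambda>x. g \<otimes>\<^bsub>G\<^esub> x \<otimes>\<^bsub>G\<^esub> inv\<^bsub>G\<^esub> g) `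
          inv_into (carrier (abelianization_mod_torsion G H)) \<phi> v)"

definition orbit_union ::
    "('a, 'b) monoid_scheme \<Rightarrow> 'a set \<Rightarrow> ('a set \<Rightarrow> real ^ 'n) \<Rightarrow> (real ^ 'n) set \<Rightarrow> (real ^ 'n) set"
  where
  "orbit_union G H \<phi> A = (\<Union>a\<in>A. orbit (G Mod H) (conj_action G H \<phi>) a)"

lemma (in group) conj_coset_of_isolator:
  assumes H: "H \<lhd> G" and I: "I \<lhd> G" and sub: "derived G H \<subseteq> I" "I \<subseteq> H"
    and g: "g \<in> carrier G" and x: "x \<in> H"
  shows "(\<Union>k\<in>H #> g. (\<lambda>y. k \<otimes> y \<otimes> inv k) ` (I #> x)) = I #> (g \<otimes> x \<otimes> inv g)"
proof -
  interpret H: normal H G by (rule H)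
  interpret I: normal I G by (rule I)
  have Hc: "h \<in> carrier G" if "h \<in> H" for h using that H.subset by blast
  have Ic: "i \<in> carrier G" if "i \<in> I" for i using that I.subset by blast
  define z where "z = g \<otimes> x \<otimes> inv g"
  have zH: "z \<in> H" unfolding z_def using H.inv_op_closed2[OF g x] .
  note c = g Hc[OF x] Hc[OF zH]
  show ?thesis
  proof (intro equalityI subsetI)
    fix u assume "u \<in> (\<Union>k\<in>H #> g. (\<lambda>y. k \<otimes> y \<otimes> inv k) ` (I #> x))"
    then obtain h i where h: "h \<in> H" and i: "i \<in> I"
      and u: "u = (h \<otimes> g) \<otimes> (i \<otimes> x) \<otimes> inv (h \<otimes> g)"
      unfolding r_coset_def by blast
    note hc = Hc[OF h] and ic = Ic[OF i]
    define j where "j = (h \<otimes> g) \<otimes> i \<otimes> inv (h \<otimes> g)"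
    have j: "j \<in> I" unfolding j_def using I.inv_op_closed2 i g hc by simp
    have k: "h \<otimes> z \<otimes> inv h \<otimes> inv z \<in> I"
    proof -
      have "h \<otimes> z \<otimes> inv h \<otimes> inv z \<in> derived G H"
        unfolding derived_def using h zH by (intro generate.incl) blast
      then show ?thesis using sub by blast
    qed
    have "u = (j \<otimes> (h \<otimes> z \<otimes> inv h \<otimes> inv z)) \<otimes> z"
      unfolding u j_def z_def using c(1,2) hc ic
      by (simp add: m_assoc inv_mult_group inv_solve_left' flip: m_assoc) (simp add: m_assoc)
    moreover have "j \<otimes> (h \<otimes> z \<otimes> inv h \<otimes> inv z) \<in> I" using j k by (rule I.m_closed)
    ultimately show "u \<in> I #> (g \<otimes> x \<otimes> inv g)" unfolding r_coset_def z_def by blast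
  next
    fix u assume "u \<in> I #> (g \<otimes> x \<otimes> inv g)"
    then obtain i where i: "i \<in> I" and u: "u = i \<otimes> (g \<otimes> x \<otimes> inv g)"
      unfolding r_coset_def by blast
    note ic = Ic[OF i]
    define j where "j = inv g \<otimes> i \<otimes> g"
    have j: "j \<in> I" unfolding j_def using I.inv_op_closed1[OF g i] .
    have "u = g \<otimes> (j \<otimes> x) \<otimes> inv g"
      unfolding u j_def using c ic by (simp add: m_assoc inv_solve_left) (simp add: m_assoc[symmetric])
    moreover have "g \<in> H #> g" using rcos_self[OF g H.is_subgroup] .
    moreover have "j \<otimes> x \<in> I #> x" unfolding r_coset_def using j by blast
    ultimately show "u \<in> (\<Union>k\<in>H #> g. (\<lambda>y. k \<otimes> y \<otimes> inv k) ` (I #> x))" by blast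
  qed
qed

lemma (in group) conj_action_coset:
  fixes \<phi> :: "'a set \<Rightarrow> real ^ 'n"
  assumes H: "H \<lhd> G" and I: "isolator G H \<lhd> G"
    and inj: "inj_on \<phi> (carrier (abelianization_mod_torsion G H))"
    and g: "g \<in> carrier G" and x: "x \<in> H"
  shows "conj_action G H \<phi> (H #> g) (\<phi> (isolator G H #> x))
           = \<phi> (isolator G H #> (g \<otimes> x \<otimes> inv g))"
proof -
  interpret H: normal H G by (rule H)
  have "isolator G H #> x \<in> carrier (abelianization_mod_torsion G H)"
    using x by (auto simp: FactGroup_def RCOSETS_def r_coset_def)
  then have inv: "inv_into (carrier (abelianization_mod_torsion G H)) \<phi> (\<phi> (isolator G H #> x))
      = isolator G H #> x"
    using inj by (rule inv_into_f_f[rotated])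
  have "derived G H \<subseteq> isolator G H"
  proof
    fix y assume y: "y \<in> derived G H"
    then have "y \<in> H" using derived_incl[OF subset_refl H.is_subgroup] by blast
    moreover from this have "y [^] (1::nat) = y" using H.subset by auto
    ultimately show "y \<in> isolator G H" unfolding isolator_def using y zero_less_one by force
  qed
  moreover have "isolator G H \<subseteq> H" unfolding isolator_def by blast
  ultimately show ?thesis
    unfolding conj_action_def inv using conj_coset_of_isolator[OF H I _ _ g x] by simp
qed

end

theory Submission
  imports Defs "HOL-Analysis.Brouwer_Fixpoint"
begin

text \<open>The displacement per letter of a word over \<open>S\<close> that evaluates into \<open>H\<close> lies in the polytope \<open>P\<close>
  spanned by the displacements of short loops. If two of these, for loops of equal length, lie on one facet,
  then a supporting functional shows that all words composed of the two loops are geodesic, so that the growth is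
  exponential.

  Conversely, add to a generating set lifts of large multiples of the elements of \<open>A\<close>. Short loops in
  the old letters, and products of two distinct new letters, then have displacements in the interior of
  the polytope, so that some power of them is not geodesic. It remains to see that a geodesic contains
  boundedly many disjoint copies of such a loop. As \<open>H\<close> is 2-step nilpotent, the value of a word depends only
  on the number of the copies and on the sum of their positions in \<open>\<int>\<^sup>d\<close>. By Caratheodory's theorem
  and Brouwer's fixed point theorem, applied to the path of positions, this sum is attained up to a bounded
  error when the copies are gathered in boundedly many places of the path. There they form long powers,
  and the length saved exceeds the bounded cost of the corrections. Finally, geodesics with
  boundedly many switches between letters are polynomially many.\<close>

section \<open>Concentrating multiplicities along a path\<close>

text \<open>The obstacle is uniformity. Caratheodory's theorem leaves at most \<open>d + 1\<close>
  fractional weights, but the positions carrying them may lie arbitrarily far out, so rounding would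
  shift the sum of positions by an unbounded amount. Since the steps of the path are bounded, a
  point sliding along it moves almost continuously; boundedly many integer weights can therefore
  imitate real ones, and Brouwer's theorem adjusts all of them at once. To keep the bounds
  independent of the path, the basis is selected among its own points. The sum of positions
  determines a value because commutators in \<open>H\<close> are central and bilinear. The central
  error of a shortened power is harmless for another reason: a kernel element has a power in
  \<open>[H, H]\<close>, which is quadratically distorted, so passing to high powers makes it
  negligible. Conjugation by \<open>G\<close> twists loops, so each pair of a loop and a coset is
  treated separately. The new letters must be gathered before loops in the old ones are counted: a
  geodesic could otherwise interleave the two kinds so that no short loop in old letters is a factor
  at all.\<close>

definition dual_basis_in :: "real \<Rightarrow> 'e::euclidean_space set \<Rightarrow> 'e set \<Rightarrow> ('e \<Rightarrow> 'e \<Rightarrow> real) \<Rightarrow> bool" where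
  "dual_basis_in K X B c \<longleftrightarrow> B \<subseteq> X \<and> (\<forall>b\<in>B. linear (c b)) \<and>
     (\<forall>b\<in>B. \<forall>b'\<in>B. c b b' = (if b = b' then 1 else 0)) \<and>
     (\<forall>x\<in>X. x = (\<Sum>b\<in>B. c b x *\<^sub>R b) \<and> (\<forall>b\<in>B. \<bar>c b x\<bar> \<le> K))"

text \<open>Greedy selection, as for an Auerbach basis: take a longest vector \<open>e\<close> of
  \<open>X\<close>, project along it and apply the induction hypothesis to the projections. The
  other coordinates are inherited, and that of \<open>e\<close> stays bounded because no vector of
  \<open>X\<close> is longer than \<open>e\<close>. The point is that \<open>K\<close> depends on
  \<open>k\<close> only, however large or degenerate \<open>X\<close> is.\<close>

lemma bounded_dual_basis:
  "\<exists>K::real. K \<ge> 1 \<and> (\<forall>X::'e::euclidean_space set. finite X \<longrightarrow> dim X \<le> k \<longrightarrow>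
     (\<exists>B c. dual_basis_in K X B c \<and> card B \<le> k))"
proof (induction k)
  case 0
  have "\<exists>B c. dual_basis_in 1 X B c \<and> card B \<le> 0" if "dim X \<le> 0" for X :: "'e set"
  proof (intro exI conjI)
    show "dual_basis_in 1 X {} (\<lambda>_ _. 0)"
      using that by (auto simp: dim_eq_0 dual_basis_in_def)
  qed simp
  then show ?case by (intro exI[of _ 1]) simp
next
  case (Suc k)
  then obtain K where K: "K \<ge> 1" and IH: "\<And>X::'e set. finite X \<Longrightarrow> dim X \<le> k \<Longrightarrow>
     (\<exists>B c. dual_basis_in K X B c \<and> card B \<le> k)"
    by metis
  define K' where "K' = 1 + real (k + 1) * K"
  have K': "K' \<ge> K" "K' \<ge> 1" using K by (auto simp: K'_def algebra_simps)
  have "\<exists>B c. dual_basis_in K' X B c \<and> card B \<le> Suc k"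
    if X: "finite X" "dim X \<le> Suc k" for X :: "'e set"
  proof (cases "X \<subseteq> {0}")
    case True
    then have "dual_basis_in K' X {} (\<lambda>_ _. 0)" by (auto simp: dual_basis_in_def)
    then show ?thesis by (intro exI[of _ "{}"]) auto
  next
    case False
    then have ne: "X \<noteq> {}" by auto
    have "Max (norm ` X) \<in> norm ` X" using X(1) ne by (intro Max_in) auto
    then obtain e where e: "e \<in> X" and "norm e = Max (norm ` X)" by auto
    then have emax: "\<And>x. x \<in> X \<Longrightarrow> norm x \<le> norm e" using X(1) by simp
    have e0: "e \<noteq> 0" using False emax by force
    then have ee: "e \<bullet> e > 0" by simp
    define P where "P x = x - ((x \<bullet> e) / (e \<bullet> e)) *\<^sub>R e" for x
    have linP: "linear P" unfolding P_def
      by (rule linearI) (auto simp: inner_left_distrib add_divide_distrib algebra_simps)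
    have Pe: "P e = 0" using ee by (simp add: P_def)
    have Porth: "P x \<bullet> e = 0" for x using ee by (simp add: P_def inner_diff_left)
    have "span (P ` X) \<subseteq> {y. y \<bullet> e = 0}"
    proof (rule span_minimal)
      show "P ` X \<subseteq> {y. y \<bullet> e = 0}" using Porth by auto
      show "subspace {y. y \<bullet> e = 0}" by (auto simp: subspace_def inner_left_distrib)
    qed
    then have "e \<notin> span (P ` X)" using ee by force
    then have "dim (insert e (P ` X)) = dim (P ` X) + 1" by (simp add: dim_insert)
    moreover have "insert e (P ` X) \<subseteq> span X"
      using e by (auto simp: P_def span_diff span_scale span_base)
    then have "dim (insert e (P ` X)) \<le> dim X" by (rule dim_mono)
    ultimately have "dim (P ` X) \<le> k" using X(2) by linarith
    from IH[OF _ this] X(1) obtain B' c' where D: "dual_basis_in K (P ` X) B' c'" and cB': "card B' \<le> k"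
      by (metis finite_imageI)
    have B': "B' \<subseteq> P ` X" "card B' \<le> k" using D cB' by (auto simp: dual_basis_in_def)
    have lin': "\<And>b. b \<in> B' \<Longrightarrow> linear (c' b)"
      and dual': "\<And>b b'. b \<in> B' \<Longrightarrow> b' \<in> B' \<Longrightarrow> c' b b' = (if b = b' then 1 else 0)"
      and exp': "\<And>x. x \<in> P ` X \<Longrightarrow> x = (\<Sum>b\<in>B'. c' b x *\<^sub>R b)"
      and bd': "\<And>x b. x \<in> P ` X \<Longrightarrow> b \<in> B' \<Longrightarrow> \<bar>c' b x\<bar> \<le> K"
      using D unfolding dual_basis_in_def by blast+
    have finB': "finite B'" using B' X(1) finite_subset by blast
    have "\<forall>b\<in>B'. \<exists>x\<in>X. P x = b" using B'(1) by blast
    then obtain s where s: "\<And>b. b \<in> B' \<Longrightarrow> s b \<in> X" "\<And>b. b \<in> B' \<Longrightarrow> P (s b) = b" by metis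
    have inj: "inj_on s B'" by (rule inj_on_inverseI[of _ P]) (rule s)
    have c0: "c' b 0 = 0" if "b \<in> B'" for b using lin'[OF that] by (rule linear_0)
    have B0: "b \<noteq> 0" if "b \<in> B'" for b using c0[OF that] dual'[OF that that] by auto
    have enotin: "e \<notin> s ` B'" using Pe s B0 by force
    \<comment> \<open>For \<open>x\<close> in \<open>X\<close> the projection of \<open>y x\<close>
      vanishes, so \<open>y x\<close> is a multiple of \<open>e\<close>; the factor is the missing
      coordinate.\<close>
    define y where "y x = x - (\<Sum>b\<in>B'. c' b (P x) *\<^sub>R s b)" for x
    have linc'P: "linear (\<lambda>x. c' b (P x))" if "b \<in> B'" for b
      using linear_compose[OF linP lin'[OF that]] by (simp add: o_def)
    have liny: "linear y"
      unfolding y_def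
    proof (intro linear_compose_sub linear_ident linear_compose_sum ballI)
      fix b assume "b \<in> B'"
      from linc'P[OF this] show "linear (\<lambda>x. c' b (P x) *\<^sub>R s b)"
        using linear_add[of "\<lambda>x. c' b (P x)"] linear_scale[of "\<lambda>x. c' b (P x)"]
        by (intro linearI) (simp_all add: scaleR_left_distrib)
    qed
    define c where "c b x = (if b = e then (y x \<bullet> e) / (e \<bullet> e) else c' (P b) (P x))" for b x
    define B where "B = insert e (s ` B')"
    have BX: "B \<subseteq> X" using e s by (auto simp: B_def)
    have cs: "c (s b) x = c' b (P x)" if "b \<in> B'" for b x
      using that enotin s by (auto simp: c_def)
    have ys: "y (s b) = 0" if "b \<in> B'" for b
    proof -
      have "(\<Sum>b'\<in>B'. c' b' (P (s b)) *\<^sub>R s b') = (\<Sum>b'\<in>B'. if b' = b then s b else 0)"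
        using that by (intro sum.cong) (auto simp: s dual')
      then show ?thesis using that finB' by (simp add: y_def)
    qed
    have ye: "y e = e" by (simp add: y_def Pe c0)
    show ?thesis
      unfolding dual_basis_in_def
    proof (intro exI[of _ B] exI[of _ c] conjI ballI)
      show "B \<subseteq> X" by (rule BX)
      have "card B \<le> Suc (card (s ` B'))" unfolding B_def by (rule card_insert_le_m1) auto
      then show "card B \<le> Suc k" using card_image_le[OF finB', of s] B' by linarith
    next
      fix b assume b: "b \<in> B"
      show "linear (c b)"
      proof (cases "b = e")
        case True
        have "linear (\<lambda>x. (y x \<bullet> e) / (e \<bullet> e))"
          using liny by (auto intro!: linearI simp: linear_add linear_scale inner_left_distrib add_divide_distrib)
        then show ?thesis using True by (simp add: c_def[abs_def])
      next
        case False
        then obtain b1 where "b1 \<in> B'" "b = s b1" using b by (auto simp: B_def)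
        then have "c b = (\<lambda>x. c' b1 (P x))" using cs by blast
        then show ?thesis using linc'P[OF \<open>b1 \<in> B'\<close>] by simp
      qed
      fix b' assume b': "b' \<in> B"
      show "c b b' = (if b = b' then 1 else 0)"
      proof (cases "b = e")
        case True
        then show ?thesis using b' ee enotin by (auto simp: c_def B_def ye ys)
      next
        case False
        then obtain b1 where b1: "b1 \<in> B'" "b = s b1" using b by (auto simp: B_def)
        then show ?thesis using b' inj enotin
          by (auto simp: cs B_def Pe c0 s dual' inj_on_eq_iff)
      qed
    next
      fix x assume x: "x \<in> X"
      have "P (y x) = P x - (\<Sum>b\<in>B'. c' b (P x) *\<^sub>R b)"
        unfolding y_def using linP s
        by (simp add: linear_diff linear_sum linear_scale)
      also have "\<dots> = 0" using exp'[of "P x"] x by simp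
      finally have "y x = c e x *\<^sub>R e" by (simp add: c_def P_def)
      moreover have "(\<Sum>b\<in>s ` B'. c b x *\<^sub>R b) = (\<Sum>b\<in>B'. c' b (P x) *\<^sub>R s b)"
        using inj by (simp add: sum.reindex cs)
      moreover have "(\<Sum>b\<in>B. c b x *\<^sub>R b) = c e x *\<^sub>R e + (\<Sum>b\<in>s ` B'. c b x *\<^sub>R b)"
        unfolding B_def using enotin finB' by simp
      ultimately show "x = (\<Sum>b\<in>B. c b x *\<^sub>R b)" unfolding y_def by (simp add: diff_eq_eq)
      fix b assume b: "b \<in> B"
      show "\<bar>c b x\<bar> \<le> K'"
      proof (cases "b = e")
        case True
        have "norm (\<Sum>b\<in>B'. c' b (P x) *\<^sub>R s b) \<le> (\<Sum>b\<in>B'. K * norm e)"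
          using K x s emax bd' by (intro sum_norm_le) (auto intro!: mult_mono)
        also have "\<dots> \<le> real k * (K * norm e)" using B' K by (simp add: mult_right_mono)
        finally have "norm (y x) \<le> norm e + real k * (K * norm e)"
          unfolding y_def using emax[OF x] norm_triangle_ineq4[of x] by (smt (verit))
        also have "\<dots> \<le> K' * norm e" using K by (simp add: K'_def algebra_simps)
        finally have ny: "norm (y x) \<le> K' * norm e" .
        have "\<bar>y x \<bullet> e\<bar> \<le> norm (y x) * norm e" by (rule Cauchy_Schwarz_ineq2)
        also have "\<dots> \<le> K' * (e \<bullet> e)"
          using mult_right_mono[OF ny, of "norm e"] by (simp add: dot_square_norm power2_eq_square mult.assoc)
        finally show ?thesis using True ee by (simp add: c_def abs_div field_simps)
      next
        case False
        then obtain b1 where b1: "b1 \<in> B'" "b = s b1" using b by (auto simp: B_def)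
        then show ?thesis using bd'[of "P x" b1] x K' by (auto simp: cs)
      qed
    qed
  qed
  then show ?case using K'(2) by blast
qed

lemma sum_count_scaleR:
  fixes p :: "nat \<Rightarrow> 'e::real_vector"
  assumes "finite J" "f ` J \<subseteq> {..n}"
  shows "(\<Sum>t\<le>n. of_int (int (card {j\<in>J. f j = t})) *\<^sub>R p t) = (\<Sum>j\<in>J. p (f j))"
proof -
  have "(\<Sum>t\<le>n. of_int (int (card {j\<in>J. f j = t})) *\<^sub>R p t) = (\<Sum>t\<le>n. \<Sum>j\<in>{j\<in>J. f j = t}. p (f j))"
    by (intro sum.cong) (auto simp: sum_constant_scaleR)
  also have "\<dots> = (\<Sum>j\<in>J. p (f j))" using assms by (intro sum.group) auto
  finally show ?thesis .
qed

lemma sum_count: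
  assumes "finite J" "f ` J \<subseteq> {..n::nat}"
  shows "(\<Sum>t\<le>n. card {j\<in>J. f j = t}) = card J"
proof -
  have "(\<Sum>t\<le>n. \<Sum>j\<in>{j\<in>J. f j = t}. 1::nat) = (\<Sum>j\<in>J. 1)" using assms by (intro sum.group) auto
  then show ?thesis by simp
qed

definition clamp01 :: "real \<Rightarrow> real" where "clamp01 z = max 0 (min 1 z)"

lemma clamp01: "0 \<le> clamp01 z" "clamp01 z \<le> 1" "z \<le> 0 \<Longrightarrow> clamp01 z = 0" "1 \<le> z \<Longrightarrow> clamp01 z = 1"
  "0 \<le> z \<Longrightarrow> z \<le> 1 \<Longrightarrow> clamp01 z = z"
  by (auto simp: clamp01_def)

lemma continuous_on_clamp01 [continuous_intros]:
  "continuous_on S f \<Longrightarrow> continuous_on S (\<lambda>x. clamp01 (f x))"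
  unfolding clamp01_def by (intro continuous_intros)

text \<open>The summands fill up one after another: those with \<open>i + 1 \<le> l\<close> equal
  \<open>v\<close>, at most one is partially filled, and the rest vanish. Only the partial one
  separates the sum from \<open>l * v\<close>. This will keep the map of the fixed point argument
  close to the identity.\<close>

lemma sum_clamp01_deviation:
  fixes f :: "real \<Rightarrow> real"
  assumes f: "f 0 = 0" "f 1 = v" "\<And>z. 0 \<le> z \<Longrightarrow> z \<le> 1 \<Longrightarrow> \<bar>f z\<bar> \<le> K" and v: "\<bar>v\<bar> \<le> 1"
    and l: "0 \<le> l" "l \<le> real N"
  shows "\<bar>(\<Sum>i<N. f (clamp01 (l - real i))) - l * v\<bar> \<le> K + 1"
proof (cases "l = real N")
  case True
  have "(\<Sum>i<N. f (clamp01 (l - real i))) = (\<Sum>i<N. v)"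
    using True f by (intro sum.cong) (auto simp: clamp01)
  moreover have "K \<ge> 0" using f(3)[of 0] f(1) by simp
  ultimately show ?thesis using True by simp
next
  case False
  define j where "j = nat \<lfloor>l\<rfloor>"
  have j: "real j \<le> l" "l < real j + 1" using l by (auto simp: j_def)
  have jN: "j < N" using False l j by linarith
  have "(\<Sum>i<N. f (clamp01 (l - real i))) = (\<Sum>i<N. (if i < j then v else 0) + (if i = j then f (l - real j) else 0))"
    using j f by (intro sum.cong refl) (auto simp: clamp01)
  also have "\<dots> = real j * v + f (l - real j)"
  proof -
    have "{..<N} \<inter> {i. i < j} = {..<j}" using jN by auto
    then show ?thesis using jN by (simp add: sum.distrib sum.If_cases)
  qed
  finally have "(\<Sum>i<N. f (clamp01 (l - real i))) - l * v = f (l - real j) - (l - real j) * v"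
    by (simp add: algebra_simps)
  moreover have "\<bar>f (l - real j)\<bar> \<le> K" using f(3) j by auto
  moreover have "\<bar>l - real j\<bar> * \<bar>v\<bar> \<le> 1 * 1" using j v by (intro mult_mono) auto
  then have "\<bar>(l - real j) * v\<bar> \<le> 1" by (simp add: abs_mult)
  ultimately show ?thesis by linarith
qed

text \<open>The polygonal path through the points \<open>p 0, p 1, \<dots>, p n\<close>, provided that \<open>p 0 = 0\<close>.\<close>

definition polygonal :: "nat \<Rightarrow> (nat \<Rightarrow> 'e::real_normed_vector) \<Rightarrow> real \<Rightarrow> 'e" where
  "polygonal n p s = (\<Sum>i<n. clamp01 (s - real i) *\<^sub>R (p (Suc i) - p i))"

lemma continuous_on_polygonal [continuous_intros]:
  "continuous_on S f \<Longrightarrow> continuous_on S (\<lambda>x. polygonal n p (f x))"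
  unfolding polygonal_def by (intro continuous_intros)

lemma polygonal_segment:
  assumes "p 0 = 0" "j < n" "real j \<le> s" "s \<le> real j + 1"
  shows "polygonal n p s = p j + (s - real j) *\<^sub>R (p (Suc j) - p j)"
proof -
  have "polygonal n p s = (\<Sum>i<n. (if i < j then p (Suc i) - p i else 0) + (if i = j then (s - real j) *\<^sub>R (p (Suc j) - p j) else 0))"
    unfolding polygonal_def using assms by (intro sum.cong refl) (auto simp: clamp01)
  also have "\<dots> = (\<Sum>i<j. p (Suc i) - p i) + (s - real j) *\<^sub>R (p (Suc j) - p j)"
  proof -
    have "{..<n} \<inter> {i. i < j} = {..<j}" using assms by auto
    then show ?thesis using assms by (simp add: sum.distrib sum.If_cases)
  qed
  also have "(\<Sum>i<j. p (Suc i) - p i) = p j" using assms(1) by (simp add: sum_lessThan_telescope)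
  finally show ?thesis .
qed

lemma polygonal_of_nat:
  assumes "p 0 = 0" "t \<le> n" shows "polygonal n p (real t) = p t"
proof (cases "t < n")
  case True
  then show ?thesis using polygonal_segment[of p t n "real t"] assms(1) by simp
next
  case False
  show ?thesis
  proof (cases "n = 0")
    case True then show ?thesis using assms by (simp add: polygonal_def)
  next
    case n: False
    then show ?thesis using polygonal_segment[of p "n - 1" n "real n"] False assms
      by (simp add: of_nat_diff)
  qed
qed

lemma polygonal_cases:
  assumes p0: "p 0 = 0" and s: "0 \<le> s" "s \<le> real n"
  obtains i j \<theta> where "i \<le> n" "j \<le> n" "j = i \<or> j = Suc i" "i = nat \<lfloor>s\<rfloor>" "0 \<le> \<theta>" "\<theta> \<le> 1"
    "polygonal n p s = (1 - \<theta>) *\<^sub>R p i + \<theta> *\<^sub>R p j"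
proof (cases "s = real n")
  case True
  show ?thesis by (rule that[of n n 0]) (use True p0 in \<open>auto simp: polygonal_of_nat\<close>)
next
  case False
  define j where "j = nat \<lfloor>s\<rfloor>"
  have j: "real j \<le> s" "s \<le> real j + 1" using s by (auto simp: j_def)
  have jn: "j < n" using False s j by linarith
  show ?thesis
    by (rule that[of j "Suc j" "s - real j"])
       (use j jn polygonal_segment[of p j n s] p0 in \<open>auto simp: j_def algebra_simps\<close>)
qed

text \<open>Points slide along the polygonal path from the origin to basis vectors
  \<open>p (\<tau> b) = b\<close>, so that each contributes a vector moving continuously from
  \<open>0\<close> to \<open>b\<close>. Brouwer's theorem yields parameters at which the
  contributions add up to the target exactly; moving each point back to a vertex of the path then
  costs at most \<open>C0\<close>.\<close>

lemma signed_path_sum: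
  fixes C0 Y :: real
  assumes C0: "C0 \<ge> 0" and Y: "Y \<ge> 0"
  shows "\<exists>C::nat. \<forall>n (p::nat \<Rightarrow> 'e::euclidean_space) \<mu>. p 0 = 0 \<longrightarrow> (\<forall>t<n. norm (p (Suc t) - p t) \<le> C0) \<longrightarrow>
     (\<Sum>t\<le>n. \<bar>\<mu> t\<bar>) \<le> Y \<longrightarrow>
     (\<exists>\<delta>::nat \<Rightarrow> int. (\<Sum>t\<le>n. \<bar>\<delta> t\<bar>) \<le> int C \<and>
        norm ((\<Sum>t\<le>n. of_int (\<delta> t) *\<^sub>R p t) - (\<Sum>t\<le>n. \<mu> t *\<^sub>R p t)) \<le> real C)"
proof -
  define d where "d = DIM('e)"
  obtain K where K: "K \<ge> 1" and basis: "\<And>X::'e set. finite X \<Longrightarrow> dim X \<le> d \<Longrightarrow>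
     (\<exists>B c. dual_basis_in K X B c \<and> card B \<le> d)"
    using bounded_dual_basis[of d] by metis
  \<comment> \<open>In basis coordinates, \<open>g\<close> maps the box with sides
    \<open>[0, 2 * h]\<close> into itself once \<open>h\<close> is at least the bound
    \<open>K * Y\<close> on the coordinates of the target plus the bound \<open>d * (K + 1)\<close>
    on the deviation of \<open>\<Phi>\<close> from the identity.\<close>
  define h where "h = nat \<lceil>K * Y + real d * (K + 1)\<rceil>"
  define N where "N = 2 * h"
  have h: "real h \<ge> K * Y + real d * (K + 1)" unfolding h_def by linarith
  define C where "C = nat \<lceil>real (d * N) * C0\<rceil> + d * N + d * h"
  have C: "real (d * N) * C0 \<le> real C"
    unfolding C_def using real_nat_ceiling_ge[of "real (d * N) * C0"] by linarith
  show ?thesis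
  proof (intro exI[of _ C] allI impI)
    fix n and p :: "nat \<Rightarrow> 'e" and \<mu> :: "nat \<Rightarrow> real"
    assume p0: "p 0 = 0" and step: "\<forall>t<n. norm (p (Suc t) - p t) \<le> C0"
      and \<mu>: "(\<Sum>t\<le>n. \<bar>\<mu> t\<bar>) \<le> Y"
    obtain B c where D: "dual_basis_in K (p ` {..n}) B c" and cB: "card B \<le> d"
      using basis[of "p ` {..n}"] dim_subset_UNIV[of "p ` {..n}"] unfolding d_def by blast
    have BX: "B \<subseteq> p ` {..n}" and lin: "\<And>b. b \<in> B \<Longrightarrow> linear (c b)"
      and dual: "\<And>b b'. b \<in> B \<Longrightarrow> b' \<in> B \<Longrightarrow> c b b' = (if b = b' then 1 else 0)"
      and expn: "\<And>t. t \<le> n \<Longrightarrow> p t = (\<Sum>b\<in>B. c b (p t) *\<^sub>R b)"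
      and bd: "\<And>t b. t \<le> n \<Longrightarrow> b \<in> B \<Longrightarrow> \<bar>c b (p t)\<bar> \<le> K"
      using D unfolding dual_basis_in_def by blast+
    have finB: "finite B" using BX finite_subset by blast
    have "\<forall>b\<in>B. \<exists>t\<le>n. p t = b" using BX by blast
    then obtain \<tau> where \<tau>: "\<And>b. b \<in> B \<Longrightarrow> \<tau> b \<le> n" "\<And>b. b \<in> B \<Longrightarrow> p (\<tau> b) = b" by metis
    let ?q = "polygonal n p"
    have span_p: "p t \<in> span B" if "t \<le> n" for t
      by (subst expn[OF that]) (intro span_sum span_scale span_base)
    have q_span: "?q s \<in> span B" and q_bd: "\<And>b. b \<in> B \<Longrightarrow> \<bar>c b (?q s)\<bar> \<le> K"
      and q_near: "nat \<lfloor>s\<rfloor> \<le> n \<and> norm (?q s - p (nat \<lfloor>s\<rfloor>)) \<le> C0"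
      if s: "0 \<le> s" "s \<le> real n" for s
    proof -
      obtain i j \<theta> where ij: "i \<le> n" "j \<le> n" "j = i \<or> j = Suc i" "i = nat \<lfloor>s\<rfloor>" "0 \<le> \<theta>" "\<theta> \<le> 1"
        and q: "?q s = (1 - \<theta>) *\<^sub>R p i + \<theta> *\<^sub>R p j"
        using polygonal_cases[of p, OF p0 s] by metis
      show "?q s \<in> span B" unfolding q using ij by (intro span_add span_scale span_p)
      show "\<bar>c b (?q s)\<bar> \<le> K" if b: "b \<in> B" for b
      proof -
        have "\<bar>c b (?q s)\<bar> = \<bar>(1 - \<theta>) * c b (p i) + \<theta> * c b (p j)\<bar>"
          unfolding q using lin[OF b] by (simp add: linear_add linear_scale)
        also have "\<dots> \<le> (1 - \<theta>) * \<bar>c b (p i)\<bar> + \<theta> * \<bar>c b (p j)\<bar>"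
          using ij abs_triangle_ineq[of "(1 - \<theta>) * c b (p i)" "\<theta> * c b (p j)"] by (simp add: abs_mult)
        also have "\<dots> \<le> (1 - \<theta>) * K + \<theta> * K"
          using ij bd[OF _ b] by (intro add_mono mult_left_mono) auto
        finally show ?thesis by (simp add: algebra_simps)
      qed
      have "?q s - p i = \<theta> *\<^sub>R (p j - p i)" unfolding q by (simp add: algebra_simps)
      moreover have "norm (p j - p i) \<le> C0" using ij step C0 by auto
      ultimately have "norm (?q s - p i) \<le> C0"
        using ij mult_mono[of \<theta> 1 "norm (p j - p i)" C0] by simp
      then show "nat \<lfloor>s\<rfloor> \<le> n \<and> norm (?q s - p (nat \<lfloor>s\<rfloor>)) \<le> C0" using ij by simp
    qed
    define y where "y = (\<Sum>t\<le>n. \<mu> t *\<^sub>R p t)"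
    have y_span: "y \<in> span B" unfolding y_def by (intro span_sum span_scale span_p) auto
    have y_bd: "\<bar>c b y\<bar> \<le> K * Y" if b: "b \<in> B" for b
    proof -
      have "\<bar>c b y\<bar> = \<bar>\<Sum>t\<le>n. \<mu> t * c b (p t)\<bar>"
        unfolding y_def using lin[OF b] by (simp add: linear_sum linear_scale)
      also have "\<dots> \<le> (\<Sum>t\<le>n. \<bar>\<mu> t\<bar> * K)"
        using bd[OF _ b] by (intro order_trans[OF sum_abs] sum_mono) (auto simp: abs_mult intro: mult_left_mono)
      also have "\<dots> = K * (\<Sum>t\<le>n. \<bar>\<mu> t\<bar>)" by (simp add: sum_distrib_left mult.commute)
      also have "\<dots> \<le> K * Y" using \<mu> K by (intro mult_left_mono) auto
      finally show ?thesis .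
    qed
    \<comment> \<open>As the \<open>b\<close>-coordinate of \<open>x\<close> runs from
      \<open>i\<close> to \<open>i + 1\<close>, the \<open>i\<close>-th point assigned to
      \<open>b\<close> slides from the start of the path to time \<open>\<tau> b\<close>.\<close>
    define tm where "tm x b i = clamp01 (c b x - real i) * real (\<tau> b)" for x b i
    have tm: "0 \<le> tm x b i" "tm x b i \<le> real n" if "b \<in> B" for x b i
      using \<tau>(1)[OF that] clamp01[of "c b x - real i"] mult_mono[of "clamp01 (c b x - real i)" 1 "real (\<tau> b)" "real n"]
      by (auto simp: tm_def)
    define \<Phi> where "\<Phi> x = (\<Sum>b\<in>B. \<Sum>i<N. ?q (tm x b i))" for x
    define S where "S = {x \<in> span B. \<forall>b\<in>B. 0 \<le> c b x \<and> c b x \<le> real N}"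
    \<comment> \<open>At a fixed point, \<open>\<Phi> x\<close> is the target plus \<open>h\<close>
      copies of every basis vector. Sliding points only count positively, and this shift, undone in
      \<open>\<delta>\<close>, makes room for negative coordinates of \<open>y\<close>.\<close>
    define g where "g x = x + (y + (\<Sum>b\<in>B. real h *\<^sub>R b)) - \<Phi> x" for x
    have cont_c: "continuous_on A (c b)" if "b \<in> B" for A b
      using lin[OF that] linear_continuous_on linear_conv_bounded_linear by blast
    have expS: "x = (\<Sum>b\<in>B. c b x *\<^sub>R b)" if "x \<in> span B" for x
      using that
    proof (induction rule: span_induct_alt)
      case base
      then show ?case using lin by (simp add: linear_0)
    next
      case (step r b' x)
      have "(\<Sum>b\<in>B. c b (r *\<^sub>R b' + x) *\<^sub>R b) = (\<Sum>b\<in>B. (if b = b' then r *\<^sub>R b' else 0) + c b x *\<^sub>R b)"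
        using step lin dual by (intro sum.cong) (auto simp: linear_add linear_scale scaleR_left_distrib)
      then show ?case using step finB by (simp add: sum.distrib)
    qed
    have dsum: "(\<Sum>b'\<in>B. w b' * c b b') = w b" if b: "b \<in> B" for w :: "'e \<Rightarrow> real" and b
    proof -
      have "(\<Sum>b'\<in>B. w b' * c b b') = (\<Sum>b'\<in>B. if b' = b then w b else 0)"
        using b dual by (intro sum.cong) auto
      then show ?thesis using b finB by simp
    qed
    have S1: "compact S"
    proof -
      have "S = span B \<inter> (\<Inter>b\<in>B. {x. 0 \<le> c b x} \<inter> {x. c b x \<le> real N})" unfolding S_def by auto
      moreover have "closed {x. 0 \<le> c b x}" "closed {x. c b x \<le> real N}" if "b \<in> B" for b
        using cont_c[OF that] by (auto intro!: closed_Collect_le continuous_intros)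
      ultimately have "closed S" by (auto intro!: closed_Int closed_INT closed_span)
      moreover have "bounded S"
      proof (rule boundedI)
        fix x assume x: "x \<in> S"
        then have "norm x = norm (\<Sum>b\<in>B. c b x *\<^sub>R b)" using expS[of x] by (auto simp: S_def)
        also have "\<dots> \<le> (\<Sum>b\<in>B. real N * norm b)"
          using x by (intro sum_norm_le) (auto simp: S_def intro: mult_right_mono)
        finally show "norm x \<le> (\<Sum>b\<in>B. real N * norm b)" .
      qed
      ultimately show ?thesis using compact_eq_bounded_closed by blast
    qed
    have S2: "convex S"
      unfolding convex_def
    proof (intro ballI allI impI)
      fix x x' and u v :: real assume xx: "x \<in> S" "x' \<in> S" and uv: "0 \<le> u" "0 \<le> v" "u + v = 1"
      have "0 \<le> c b (u *\<^sub>R x + v *\<^sub>R x') \<and> c b (u *\<^sub>R x + v *\<^sub>R x') \<le> real N" if b: "b \<in> B" for b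
      proof -
        have 1: "c b (u *\<^sub>R x + v *\<^sub>R x') = u * c b x + v * c b x'"
          using lin[OF b] by (simp add: linear_add linear_scale)
        have "u * c b x + v * c b x' \<le> u * real N + v * real N"
          using uv xx b by (intro add_mono mult_left_mono) (auto simp: S_def)
        also have "\<dots> = real N" using uv by (metis distrib_right mult_1)
        finally show ?thesis using 1 uv xx b by (auto simp: S_def)
      qed
      then show "u *\<^sub>R x + v *\<^sub>R x' \<in> S" using xx by (auto simp: S_def intro: span_add span_scale)
    qed
    have "0 \<in> S" using lin by (auto simp: S_def span_zero linear_0)
    then have S3: "S \<noteq> {}" by blast
    have S4: "continuous_on S g"
      unfolding g_def \<Phi>_def tm_def using cont_c by (intro continuous_intros) auto
    have S5: "g \<in> S \<rightarrow> S"
    proof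
      fix x assume x: "x \<in> S"
      have "g x \<in> span B"
        unfolding g_def \<Phi>_def using x y_span tm
        by (auto simp: S_def intro!: span_add span_diff span_sum q_span intro: span_scale span_base)
      moreover have "0 \<le> c b (g x) \<and> c b (g x) \<le> real N" if b: "b \<in> B" for b
      proof -
        have c\<Phi>: "c b (\<Phi> x) = (\<Sum>b'\<in>B. \<Sum>i<N. c b (?q (tm x b' i)))"
          unfolding \<Phi>_def using lin[OF b] by (simp add: linear_sum)
        have cx: "c b x = (\<Sum>b'\<in>B. c b' x * c b b')"
          using dsum[OF b, of "\<lambda>b'. c b' x"] by simp
        have "\<bar>(\<Sum>i<N. c b (?q (tm x b' i))) - c b' x * c b b'\<bar> \<le> K + 1" if b': "b' \<in> B" for b'
          unfolding tm_def
        proof (rule sum_clamp01_deviation[where f = "\<lambda>z. c b (?q (z * real (\<tau> b')))"])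
          show "c b (?q (0 * real (\<tau> b'))) = 0"
            using polygonal_of_nat[of p 0 n] p0 lin[OF b] by (simp add: linear_0)
          show "c b (?q (1 * real (\<tau> b'))) = c b b'"
            using polygonal_of_nat[of p "\<tau> b'" n] p0 \<tau> b' by simp
          show "\<bar>c b (?q (z * real (\<tau> b')))\<bar> \<le> K" if "0 \<le> z" "z \<le> 1" for z
            using that \<tau>(1)[OF b'] mult_mono[of z 1 "real (\<tau> b')" "real n"] by (intro q_bd b) auto
          show "\<bar>c b b'\<bar> \<le> 1" using dual[OF b b'] by simp
          show "0 \<le> c b' x" "c b' x \<le> real N" using x b' by (auto simp: S_def)
        qed
        then have "\<bar>\<Sum>b'\<in>B. (\<Sum>i<N. c b (?q (tm x b' i))) - c b' x * c b b'\<bar> \<le> (\<Sum>b'\<in>B. K + 1)"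
          by (intro order_trans[OF sum_abs] sum_mono)
        also have "\<dots> \<le> real d * (K + 1)" using cB K by (simp add: mult_right_mono)
        finally have "\<bar>c b (\<Phi> x) - c b x\<bar> \<le> real d * (K + 1)"
          unfolding c\<Phi> cx by (simp add: sum_subtractf)
        moreover have "c b (g x) = c b x + c b y + real h - c b (\<Phi> x)"
          unfolding g_def using lin[OF b] dsum[OF b, of "\<lambda>_. real h"]
          by (simp add: linear_add linear_diff linear_sum linear_scale)
        moreover have "real N = 2 * real h" by (simp add: N_def)
        ultimately show ?thesis using h y_bd[OF b] by linarith
      qed
      ultimately show "g x \<in> S" by (simp add: S_def)
    qed
    obtain x where x: "x \<in> S" "g x = x" by (rule brouwer[OF S1 S2 S3 S4 S5])
    then have \<Phi>x: "\<Phi> x = y + (\<Sum>b\<in>B. real h *\<^sub>R b)" by (simp add: g_def algebra_simps)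
    define J where "J = B \<times> {..<N}"
    define f where "f = (\<lambda>(b, i). nat \<lfloor>tm x b i\<rfloor>)"
    have finJ: "finite J" unfolding J_def using finB by blast
    have fJ: "f ` J \<subseteq> {..n}" using q_near tm by (auto simp: J_def f_def)
    have cJ: "card J \<le> d * N" using cB by (simp add: J_def card_cartesian_product)
    define \<delta> where "\<delta> t = int (card {j\<in>J. f j = t}) - int h * int (card {b\<in>B. \<tau> b = t})" for t
    have \<tau>B: "\<tau> ` B \<subseteq> {..n}" using \<tau> by auto
    have "(\<Sum>t\<le>n. \<bar>\<delta> t\<bar>) \<le> (\<Sum>t\<le>n. int (card {j\<in>J. f j = t}) + int h * int (card {b\<in>B. \<tau> b = t}))"
      unfolding \<delta>_def by (intro sum_mono order_trans[OF abs_triangle_ineq4]) (simp add: abs_mult)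
    also have "\<dots> = int (\<Sum>t\<le>n. card {j\<in>J. f j = t}) + int h * int (\<Sum>t\<le>n. card {b\<in>B. \<tau> b = t})"
      by (simp add: sum.distrib sum_distrib_left)
    also have "\<dots> = int (card J) + int h * int (card B)"
      unfolding sum_count[OF finJ fJ] sum_count[OF finB \<tau>B] ..
    also have "\<dots> = int (card J + h * card B)" by simp
    also have "card J + h * card B \<le> d * N + h * d"
      by (rule add_mono[OF cJ mult_le_mono2[OF cB]])
    also have "d * N + h * d \<le> C" by (simp add: C_def mult.commute)
    finally have \<delta>1: "(\<Sum>t\<le>n. \<bar>\<delta> t\<bar>) \<le> int C" by simp
    let ?D = "\<Sum>t\<le>n. of_int (\<delta> t) *\<^sub>R p t"
    have D1: "?D = (\<Sum>t\<le>n. of_int (int (card {j\<in>J. f j = t})) *\<^sub>R p t)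
        - real h *\<^sub>R (\<Sum>t\<le>n. of_int (int (card {b\<in>B. \<tau> b = t})) *\<^sub>R p t)"
      unfolding \<delta>_def by (simp add: scaleR_diff_left sum_subtractf scaleR_right.sum)
    have "(\<Sum>b\<in>B. p (\<tau> b)) = (\<Sum>b\<in>B. b)" using \<tau> by (intro sum.cong) auto
    then have D2: "?D = (\<Sum>j\<in>J. p (f j)) - (\<Sum>b\<in>B. real h *\<^sub>R b)"
      unfolding D1 sum_count_scaleR[OF finJ fJ] sum_count_scaleR[OF finB \<tau>B] by (simp add: scaleR_right.sum)
    have \<Phi>J: "\<Phi> x = (\<Sum>j\<in>J. case j of (b, i) \<Rightarrow> ?q (tm x b i))"
      unfolding \<Phi>_def J_def by (rule sum.cartesian_product)
    have "?D - y = (\<Sum>j\<in>J. p (f j)) - (y + (\<Sum>b\<in>B. real h *\<^sub>R b))" using D2 by simp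
    then have "?D - y = (\<Sum>j\<in>J. p (f j)) - (\<Sum>j\<in>J. case j of (b, i) \<Rightarrow> ?q (tm x b i))"
      by (simp only: \<Phi>x[symmetric] \<Phi>J)
    then have D3: "?D - y = (\<Sum>j\<in>J. p (f j) - (case j of (b, i) \<Rightarrow> ?q (tm x b i)))"
      by (simp only: sum_subtractf)
    have near: "norm (p (f j) - (case j of (b, i) \<Rightarrow> ?q (tm x b i))) \<le> C0" if "j \<in> J" for j
    proof (cases j)
      case (Pair b i)
      then have b: "b \<in> B" using that by (simp add: J_def)
      have "norm (?q (tm x b i) - p (nat \<lfloor>tm x b i\<rfloor>)) \<le> C0"
        by (rule conjunct2[OF q_near[OF tm(1)[OF b, of x i] tm(2)[OF b, of x i]]])
      moreover have "f (b, i) = nat \<lfloor>tm x b i\<rfloor>" by (simp add: f_def)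
      ultimately have "norm (?q (tm x b i) - p (f (b, i))) \<le> C0" by (rule back_subst[where P = "\<lambda>k. norm (?q (tm x b i) - p k) \<le> C0", OF _ sym])
      then have "norm (p (f (b, i)) - ?q (tm x b i)) \<le> C0" by (rule ord_eq_le_trans[OF norm_minus_commute])
      then show ?thesis by (simp only: Pair prod.case)
    qed
    have "norm (?D - y) = norm (\<Sum>j\<in>J. p (f j) - (case j of (b, i) \<Rightarrow> ?q (tm x b i)))"
      using D3 by (rule arg_cong)
    also have "\<dots> \<le> (\<Sum>j\<in>J. C0)" using near by (rule sum_norm_le)
    also have "\<dots> = real (card J) * C0" by simp
    also have "\<dots> \<le> real (d * N) * C0" using cJ C0 by (intro mult_right_mono) (auto simp del: of_nat_mult)
    finally have "norm (?D - y) \<le> real C" using C by (rule order_trans)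
    with \<delta>1 show "\<exists>\<delta>::nat \<Rightarrow> int. (\<Sum>t\<le>n. \<bar>\<delta> t\<bar>) \<le> int C \<and>
        norm ((\<Sum>t\<le>n. of_int (\<delta> t) *\<^sub>R p t) - (\<Sum>t\<le>n. \<mu> t *\<^sub>R p t)) \<le> real C"
      unfolding y_def by blast
  qed
qed

text \<open>Caratheodory's theorem, applied to the barycentre of the points weighted by
  \<open>m\<close>, gives real weights on at most \<open>d + 1\<close> of these points with the same
  total and the same moment. Their integer parts are \<open>x\<close>; the fractional parts have
  total at most \<open>d + 1\<close>, so \<open>signed_path_sum\<close> replaces them by integers of
  bounded total size.\<close>

lemma concentrate_multiplicities:
  fixes C0 :: real
  assumes C0: "C0 \<ge> 0"
  shows "\<exists>C::nat. \<forall>n (p::nat \<Rightarrow> 'e::euclidean_space) (m::nat \<Rightarrow> nat).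
     (\<forall>t<n. norm (p (Suc t) - p t) \<le> C0) \<longrightarrow>
     (\<exists>(x::nat \<Rightarrow> nat) (\<delta>::nat \<Rightarrow> int).
        (\<forall>t. x t > 0 \<longrightarrow> t \<le> n \<and> m t > 0) \<and> card {t. x t > 0} \<le> C \<and> (\<Sum>t\<le>n. \<bar>\<delta> t\<bar>) \<le> int C \<and>
        (\<Sum>t\<le>n. int (x t) + \<delta> t) = (\<Sum>t\<le>n. int (m t)) \<and>
        norm ((\<Sum>t\<le>n. of_int (int (x t) + \<delta> t) *\<^sub>R p t) - (\<Sum>t\<le>n. real (m t) *\<^sub>R p t)) \<le> real C)"
proof -
  define d where "d = DIM('e)"
  obtain C1 :: nat where C1: "\<forall>n (p::nat \<Rightarrow> 'e) \<mu>. p 0 = 0 \<longrightarrow> (\<forall>t<n. norm (p (Suc t) - p t) \<le> C0) \<longrightarrow>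
     (\<Sum>t\<le>n. \<bar>\<mu> t\<bar>) \<le> real (d + 1) \<longrightarrow>
     (\<exists>\<delta>::nat \<Rightarrow> int. (\<Sum>t\<le>n. \<bar>\<delta> t\<bar>) \<le> int C1 \<and>
        norm ((\<Sum>t\<le>n. of_int (\<delta> t) *\<^sub>R p t) - (\<Sum>t\<le>n. \<mu> t *\<^sub>R p t)) \<le> real C1)"
    by (rule exE[OF signed_path_sum[OF C0 of_nat_0_le_iff, of "d + 1", where 'e = 'e]])
  define C where "C = 2 * C1 + (d + 1)"
  have "\<exists>(x::nat \<Rightarrow> nat) (\<delta>::nat \<Rightarrow> int).
        (\<forall>t. x t > 0 \<longrightarrow> t \<le> n \<and> m t > 0) \<and> card {t. x t > 0} \<le> C \<and> (\<Sum>t\<le>n. \<bar>\<delta> t\<bar>) \<le> int C \<and>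
        (\<Sum>t\<le>n. int (x t) + \<delta> t) = (\<Sum>t\<le>n. int (m t)) \<and>
        norm ((\<Sum>t\<le>n. of_int (int (x t) + \<delta> t) *\<^sub>R p t) - (\<Sum>t\<le>n. real (m t) *\<^sub>R p t)) \<le> real C"
    if step: "\<forall>t<n. norm (p (Suc t) - p t) \<le> C0" for n and p :: "nat \<Rightarrow> 'e" and m :: "nat \<Rightarrow> nat"
  proof (cases "(\<Sum>t\<le>n. m t) = 0")
    case True
    then show ?thesis by (intro exI[of _ "\<lambda>_. 0"]) auto
  next
    case False
    define M where "M = (\<Sum>t\<le>n. m t)"
    have M: "real M > 0" "real M = (\<Sum>t\<le>n. real (m t))"
      using False unfolding M_def by (simp_all only: of_nat_sum[symmetric] of_nat_0_less_iff)
    define Q where "Q = p ` {t. t \<le> n \<and> m t > 0}"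
    define T0 where "T0 = {t. t \<le> n \<and> m t > 0}"
    have "(\<Sum>t\<in>T0. (real (m t) / real M) *\<^sub>R p t) \<in> convex hull Q"
    proof (rule convex_sum)
      show "finite T0" by (auto simp: T0_def)
      have "(\<Sum>t\<in>T0. real (m t)) = (\<Sum>t\<le>n. real (m t))"
        by (rule sum.mono_neutral_left) (auto simp: T0_def)
      then show "(\<Sum>t\<in>T0. real (m t) / real M) = 1"
        using M by (simp add: sum_divide_distrib[symmetric])
      show "p t \<in> convex hull Q" if "t \<in> T0" for t
        using that by (intro hull_inc) (auto simp: Q_def T0_def)
    qed auto
    moreover have "(\<Sum>t\<in>T0. (real (m t) / real M) *\<^sub>R p t) = (1 / real M) *\<^sub>R (\<Sum>t\<le>n. real (m t) *\<^sub>R p t)"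
      unfolding scaleR_right.sum
      by (rule sum.mono_neutral_cong_left) (auto simp: T0_def)
    ultimately have "(1 / real M) *\<^sub>R (\<Sum>t\<le>n. real (m t) *\<^sub>R p t) \<in> convex hull Q" by simp
    then obtain S where S: "finite S" "S \<subseteq> Q" "card S \<le> d + 1"
      and z: "(1 / real M) *\<^sub>R (\<Sum>t\<le>n. real (m t) *\<^sub>R p t) \<in> convex hull S"
      unfolding d_def by (subst (asm) caratheodory) auto
    obtain u where u: "\<And>v. v \<in> S \<Longrightarrow> 0 \<le> u v" "sum u S = 1"
      and zu: "(\<Sum>v\<in>S. u v *\<^sub>R v) = (1 / real M) *\<^sub>R (\<Sum>t\<le>n. real (m t) *\<^sub>R p t)"
      using z unfolding convex_hull_finite[OF S(1)] by auto
    have "\<forall>v\<in>S. \<exists>t\<in>T0. p t = v" using S by (auto simp: Q_def T0_def)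
    then obtain \<tau> where \<tau>: "\<And>v. v \<in> S \<Longrightarrow> \<tau> v \<in> T0" "\<And>v. v \<in> S \<Longrightarrow> p (\<tau> v) = v" by metis
    have inj: "inj_on \<tau> S" by (rule inj_on_inverseI[of _ p]) (rule \<tau>)
    define T where "T = \<tau> ` S"
    have T: "T \<subseteq> T0" "T \<subseteq> {..n}" "finite T" "card T \<le> d + 1"
      using \<tau> S card_image_le[OF S(1), of \<tau>] by (auto simp: T_def T0_def)
    define l where "l t = (if t \<in> T then real M * u (p t) else 0)" for t
    have l0: "l t \<ge> 0" for t using u \<tau> M by (auto simp: l_def T_def)
    define x where "x t = nat \<lfloor>l t\<rfloor>" for t
    define \<mu> where "\<mu> t = l t - real (x t)" for t
    have x: "x t > 0 \<Longrightarrow> t \<in> T" for t by (auto simp: x_def l_def split: if_splits)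
    have \<mu>: "0 \<le> \<mu> t" "\<mu> t \<le> 1" "t \<notin> T \<Longrightarrow> \<mu> t = 0" for t
      using l0[of t] by (auto simp: \<mu>_def x_def l_def, linarith+)
    have lsum: "(\<Sum>t\<le>n. l t *\<^sub>R f t) = real M *\<^sub>R (\<Sum>v\<in>S. u v *\<^sub>R f (\<tau> v))" for f :: "nat \<Rightarrow> 'w::real_vector"
    proof -
      have "(\<Sum>t\<le>n. l t *\<^sub>R f t) = (\<Sum>t\<in>T. (real M * u (p t)) *\<^sub>R f t)"
        using T by (intro sum.mono_neutral_cong_right) (auto simp: l_def)
      also have "\<dots> = (\<Sum>v\<in>S. (real M * u v) *\<^sub>R f (\<tau> v))"
        unfolding T_def using inj \<tau> by (simp add: sum.reindex)
      finally show ?thesis by (simp add: scaleR_right.sum)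
    qed
    have lM: "(\<Sum>t\<le>n. l t) = real M" using lsum[of "\<lambda>_. 1::real"] u by simp
    have "(\<Sum>v\<in>S. u v *\<^sub>R p (\<tau> v)) = (\<Sum>v\<in>S. u v *\<^sub>R v)" using \<tau> by (intro sum.cong) auto
    then have lp: "(\<Sum>t\<le>n. l t *\<^sub>R p t) = (\<Sum>t\<le>n. real (m t) *\<^sub>R p t)"
      using lsum[of p] zu M by simp
    have "(\<Sum>t\<le>n. \<bar>\<mu> t\<bar>) = (\<Sum>t\<in>T. \<mu> t)"
      using T \<mu> by (intro sum.mono_neutral_cong_right) auto
    also have "\<dots> \<le> (\<Sum>t\<in>T. 1)" using \<mu> by (intro sum_mono)
    finally have \<mu>sum: "(\<Sum>t\<le>n. \<bar>\<mu> t\<bar>) \<le> real (d + 1)" using T by simp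
    \<comment> \<open>The path has to start at the origin. The translation cancels in the end
      because both weightings have total \<open>M\<close>.\<close>
    define p' where "p' t = p t - p 0" for t
    obtain \<delta>0 :: "nat \<Rightarrow> int" where \<delta>0: "(\<Sum>t\<le>n. \<bar>\<delta>0 t\<bar>) \<le> int C1"
      "norm ((\<Sum>t\<le>n. of_int (\<delta>0 t) *\<^sub>R p' t) - (\<Sum>t\<le>n. \<mu> t *\<^sub>R p' t)) \<le> real C1"
    proof -
      have "p' 0 = 0" "\<forall>t<n. norm (p' (Suc t) - p' t) \<le> C0" using step by (simp_all add: p'_def)
      with C1 \<mu>sum show ?thesis using that by blast
    qed
    \<comment> \<open>The defect of the total count. It is added at time \<open>0\<close>, where
      \<open>p'\<close> vanishes, and so leaves the moment unchanged.\<close>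
    define r where "r = int M - (\<Sum>t\<le>n. int (x t)) - (\<Sum>t\<le>n. \<delta>0 t)"
    define \<delta> where "\<delta> t = \<delta>0 t + (if t = 0 then r else 0)" for t
    have sum\<delta>: "(\<Sum>t\<le>n. \<delta> t) = (\<Sum>t\<le>n. \<delta>0 t) + r" by (simp add: \<delta>_def sum.distrib)
    have total: "(\<Sum>t\<le>n. int (x t) + \<delta> t) = int M" using sum\<delta> by (simp add: sum.distrib r_def)
    have "real_of_int (int M - (\<Sum>t\<le>n. int (x t))) = (\<Sum>t\<le>n. \<mu> t)"
      using lM by (simp add: \<mu>_def sum_subtractf)
    also have "\<dots> = (\<Sum>t\<le>n. \<bar>\<mu> t\<bar>)" using \<mu> by simp
    finally have r1: "0 \<le> int M - (\<Sum>t\<le>n. int (x t))" "int M - (\<Sum>t\<le>n. int (x t)) \<le> int (d + 1)"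
      using \<mu>sum sum_nonneg[of "{..n}" "\<lambda>t. \<bar>\<mu> t\<bar>"] by (simp_all del: of_int_diff, linarith+)
    have "\<bar>\<Sum>t\<le>n. \<delta>0 t\<bar> \<le> int C1" using \<delta>0(1) sum_abs[of \<delta>0 "{..n}"] by linarith
    then have r2: "\<bar>r\<bar> \<le> int (d + 1) + int C1" using r1 by (simp add: r_def)
    have "(\<Sum>t\<le>n. \<bar>\<delta> t\<bar>) \<le> (\<Sum>t\<le>n. \<bar>\<delta>0 t\<bar> + (if t = 0 then \<bar>r\<bar> else 0))"
      by (intro sum_mono) (auto simp: \<delta>_def)
    also have "\<dots> = (\<Sum>t\<le>n. \<bar>\<delta>0 t\<bar>) + \<bar>r\<bar>" by (simp add: sum.distrib)
    also have "\<dots> \<le> int C" using \<delta>0(1) r2 by (simp add: C_def)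
    finally have \<delta>1: "(\<Sum>t\<le>n. \<bar>\<delta> t\<bar>) \<le> int C" .
    have "(\<Sum>t\<le>n. of_int (int (x t) + \<delta> t) *\<^sub>R p t) - (\<Sum>t\<le>n. real (m t) *\<^sub>R p t)
        = (\<Sum>t\<le>n. of_int (int (x t) + \<delta> t) *\<^sub>R p' t) - (\<Sum>t\<le>n. l t *\<^sub>R p' t)"
    proof -
      have "(\<Sum>t\<le>n. of_int (int (x t) + \<delta> t) *\<^sub>R p' t)
          = (\<Sum>t\<le>n. of_int (int (x t) + \<delta> t) *\<^sub>R p t) - real_of_int (\<Sum>t\<le>n. int (x t) + \<delta> t) *\<^sub>R p 0"
        by (simp only: p'_def scaleR_diff_right sum_subtractf scaleR_left.sum of_int_sum)
      moreover have "(\<Sum>t\<le>n. l t *\<^sub>R p' t) = (\<Sum>t\<le>n. l t *\<^sub>R p t) - (\<Sum>t\<le>n. l t) *\<^sub>R p 0"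
        by (simp only: p'_def scaleR_diff_right sum_subtractf scaleR_left.sum)
      ultimately show ?thesis using lM lp total by simp
    qed
    also have "\<dots> = (\<Sum>t\<le>n. of_int (\<delta>0 t) *\<^sub>R p' t) - (\<Sum>t\<le>n. \<mu> t *\<^sub>R p' t)"
    proof -
      have "(\<Sum>t\<le>n. of_int (int (x t) + \<delta> t) *\<^sub>R p' t) = (\<Sum>t\<le>n. (real (x t) + of_int (\<delta>0 t)) *\<^sub>R p' t)"
        by (intro sum.cong) (auto simp: \<delta>_def p'_def)
      moreover have "(\<Sum>t\<le>n. l t *\<^sub>R p' t) = (\<Sum>t\<le>n. (real (x t) + \<mu> t) *\<^sub>R p' t)"
        by (simp add: \<mu>_def)
      ultimately show ?thesis by (simp add: scaleR_add_left sum.distrib)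
    qed
    finally have "norm ((\<Sum>t\<le>n. of_int (int (x t) + \<delta> t) *\<^sub>R p t) - (\<Sum>t\<le>n. real (m t) *\<^sub>R p t)) \<le> real C1"
      using \<delta>0(2) by simp
    then have nrm: "norm ((\<Sum>t\<le>n. of_int (int (x t) + \<delta> t) *\<^sub>R p t) - (\<Sum>t\<le>n. real (m t) *\<^sub>R p t)) \<le> real C"
      by (simp add: C_def)
    have xT: "\<forall>t. x t > 0 \<longrightarrow> t \<le> n \<and> m t > 0" using x T(1) by (auto simp: T0_def)
    have "{t. x t > 0} \<subseteq> T" using x by auto
    then have "card {t. x t > 0} \<le> card T" by (rule card_mono[OF T(3)])
    then have cx: "card {t. x t > 0} \<le> C" using T(4) by (simp add: C_def)
    have "(\<Sum>t\<le>n. int (x t) + \<delta> t) = (\<Sum>t\<le>n. int (m t))" using total by (simp add: M_def)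
    with xT cx \<delta>1 nrm show ?thesis by (intro exI[of _ x] exI[of _ \<delta>] conjI)
  qed
  then show ?thesis by (intro exI[of _ C]) blast
qed

section \<open>Words with inserted loops\<close>

primrec insert_words :: "'a list \<Rightarrow> (nat \<Rightarrow> 'a list) \<Rightarrow> 'a list" where
  "insert_words [] c = c 0"
| "insert_words (s # y) c = c 0 @ s # insert_words y (c \<circ> Suc)"

lemma length_insert_words:
  "length (insert_words y c) = length y + (\<Sum>t\<le>length y. length (c t))"
  by (induction y arbitrary: c) (simp_all only: insert_words.simps list.size sum.atMost_Suc_shift add_Suc_right
      length_append o_def, simp_all)

lemma insert_words_in_lists:
  "y \<in> lists S \<Longrightarrow> (\<And>t. t \<le> length y \<Longrightarrow> c t \<in> lists S) \<Longrightarrow> insert_words y c \<in> lists S"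
proof (induction y arbitrary: c)
  case (Cons s y)
  have "(c \<circ> Suc) t \<in> lists S" if "t \<le> length y" for t using Cons.prems(2)[of "Suc t"] that by simp
  with Cons.IH[of "c \<circ> Suc"] Cons.prems(1) Cons.prems(2)[of 0] show ?case by (simp add: o_def)
qed simp

lemma word_eval_Nil [simp]: "word_eval G [] = \<one>\<^bsub>G\<^esub>"
  and word_eval_Cons [simp]: "word_eval G (s # w) = s \<otimes>\<^bsub>G\<^esub> word_eval G w"
  by (simp_all add: word_eval_def)

context group
begin

lemma inv_cancel_left:
  assumes "x \<in> carrier G" "y \<in> carrier G"
  shows "inv x \<otimes> (x \<otimes> y) = y" "x \<otimes> (inv x \<otimes> y) = y"
  using m_assoc[of "inv x" x y] m_assoc[of x "inv x" y] assms by simp_all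

lemma word_eval_closed [simp]: "set w \<subseteq> carrier G \<Longrightarrow> word_eval G w \<in> carrier G"
  by (induction w) auto

lemma word_eval_append [simp]:
  "set w \<subseteq> carrier G \<Longrightarrow> set w' \<subseteq> carrier G \<Longrightarrow> word_eval G (w @ w') = word_eval G w \<otimes> word_eval G w'"
  by (induction w) (auto simp: m_assoc)

lemma word_eval_replicate:
  "set u \<subseteq> carrier G \<Longrightarrow> word_eval G (concat (replicate m u)) = word_eval G u [^] m"
proof (induction m)
  case (Suc m)
  then have "set (concat (replicate m u)) \<subseteq> carrier G" by auto
  with Suc show ?case by (simp add: nat_pow_mult[of "word_eval G u" 1 m, simplified])
qed simp

lemma word_norm_le: "w \<in> lists S \<Longrightarrow> word_norm G S (word_eval G w) \<le> length w"
  unfolding word_norm_def by (rule Least_le) auto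

lemma word_norm_word:
  assumes "generating_set G S" "g \<in> carrier G"
  obtains w where "w \<in> lists S" "word_eval G w = g" "length w = word_norm G S g"
proof -
  have "g \<in> word_eval G ` lists S"
    using assms unfolding generating_set_def by metis
  then have "\<exists>w\<in>lists S. word_eval G w = g" by blast
  then have "\<exists>k. \<exists>w\<in>lists S. word_eval G w = g \<and> length w = k" by blast
  from LeastI_ex[OF this] show ?thesis using that unfolding word_norm_def by blast
qed

lemma generating_set_subset: "generating_set G S \<Longrightarrow> S \<subseteq> carrier G"
  unfolding generating_set_def by (elim conjE)

lemma word_norm_one [simp]: "word_norm G S \<one> = 0"
  using word_norm_le[of "[]" S] by simp

lemma word_norm_mult:
  assumes S: "generating_set G S" and "g \<in> carrier G" "h \<in> carrier G"
  shows "word_norm G S (g \<otimes> h) \<le> word_norm G S g + word_norm G S h"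
proof -
  obtain v where v: "v \<in> lists S" "word_eval G v = g" "length v = word_norm G S g"
    using word_norm_word[OF S assms(2)] .
  obtain w where w: "w \<in> lists S" "word_eval G w = h" "length w = word_norm G S h"
    using word_norm_word[OF S assms(3)] .
  have "set v \<subseteq> carrier G" "set w \<subseteq> carrier G" using v w generating_set_subset[OF S] by auto
  then show ?thesis using word_norm_le[of "v @ w" S] v w by simp
qed

lemma word_norm_pow:
  assumes S: "generating_set G S" and g: "g \<in> carrier G"
  shows "word_norm G S (g [^] (k::nat)) \<le> k * word_norm G S g"
proof (induction k)
  case (Suc k)
  then show ?case using word_norm_mult[OF S nat_pow_closed[OF g] g, of k] by simp
qed simp

lemma word_norm_bounded:
  assumes "finite K"
  shows "\<exists>C. \<forall>g\<in>K. word_norm G S g \<le> C"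
proof (intro exI ballI)
  show "word_norm G S g \<le> Max (word_norm G S ` K)" if "g \<in> K" for g
    using that assms by (intro Max_ge) auto
qed

text \<open>Moving every inserted word to the front turns it into its conjugate by the prefix before it.\<close>

lemma word_eval_insert_words:
  assumes "g \<in> carrier G" "set y \<subseteq> carrier G" "\<And>t. t \<le> length y \<Longrightarrow> set (c t) \<subseteq> carrier G"
    and "\<And>t. t \<le> length y \<Longrightarrow> \<kappa> t = (g \<otimes> word_eval G (take t y)) \<otimes> word_eval G (c t) \<otimes> inv (g \<otimes> word_eval G (take t y))"
  shows "g \<otimes> word_eval G (insert_words y c) = word_eval G (map \<kappa> [0..<Suc (length y)]) \<otimes> (g \<otimes> word_eval G y)"
  using assms
proof (induction y arbitrary: g c \<kappa>)
  case Nil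
  have "set (c 0) \<subseteq> carrier G" using Nil by simp
  then show ?case using Nil(1) Nil(4)[of 0] by (simp add: m_assoc)
next
  case (Cons s y)
  have s: "s \<in> carrier G" and y: "set y \<subseteq> carrier G" using Cons by auto
  have c0: "set (c 0) \<subseteq> carrier G" using Cons.prems(3)[of 0] by simp
  have cS: "set ((c \<circ> Suc) t) \<subseteq> carrier G" if "t \<le> length y" for t
    using Cons.prems(3)[of "Suc t"] that by simp
  have ins: "set (insert_words y (c \<circ> Suc)) \<subseteq> carrier G"
    using insert_words_in_lists[of y "carrier G" "c \<circ> Suc"] y cS by (simp add: lists_eq_set)
  have tk: "set (take t y) \<subseteq> carrier G" for t using y set_take_subset by fast
  have IH: "(g \<otimes> s) \<otimes> word_eval G (insert_words y (c \<circ> Suc))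
      = word_eval G (map (\<kappa> \<circ> Suc) [0..<Suc (length y)]) \<otimes> (g \<otimes> s \<otimes> word_eval G y)"
  proof (rule Cons.IH)
    fix t assume t: "t \<le> length y"
    show "set ((c \<circ> Suc) t) \<subseteq> carrier G" by (rule cS[OF t])
    show "(\<kappa> \<circ> Suc) t = (g \<otimes> s \<otimes> word_eval G (take t y)) \<otimes> word_eval G ((c \<circ> Suc) t) \<otimes> inv (g \<otimes> s \<otimes> word_eval G (take t y))"
      using Cons.prems(4)[of "Suc t"] t s Cons.prems(1) tk by (simp add: m_assoc)
  qed (use Cons.prems(1) s y in auto)
  have \<kappa>: "\<kappa> t \<in> carrier G" if "t \<le> Suc (length y)" for t
  proof -
    have "set (take t (s # y)) \<subseteq> carrier G" using Cons.prems(2) set_take_subset by fast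
    then show ?thesis using Cons.prems(4)[of t] Cons.prems(1) Cons.prems(3)[of t] that by simp
  qed
  have \<kappa>S: "set (map (\<kappa> \<circ> Suc) [0..<Suc (length y)]) \<subseteq> carrier G" using \<kappa> by auto
  have m: "map \<kappa> [0..<Suc (length (s # y))] = \<kappa> 0 # map (\<kappa> \<circ> Suc) [0..<Suc (length y)]"
    by (simp add: upt_conv_Cons map_Suc_upt[symmetric] del: upt_Suc)
  have "g \<otimes> word_eval G (insert_words (s # y) c)
      = (g \<otimes> word_eval G (c 0) \<otimes> inv g) \<otimes> (g \<otimes> s \<otimes> word_eval G (insert_words y (c \<circ> Suc)))"
    using Cons.prems(1) s c0 ins by (simp add: m_assoc inv_solve_left)
  also have "g \<otimes> word_eval G (c 0) \<otimes> inv g = \<kappa> 0" using Cons.prems(1) Cons.prems(4)[of 0] by simp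
  finally show ?case
    unfolding IH m using \<kappa>[of 0] \<kappa>S Cons.prems(1) s y by (simp add: m_assoc del: upt_Suc)
qed

end

text \<open>What the argument uses of \<open>H\<close>, with \<open>\<pi>\<close> for the projection
  to the lattice. Class two is hidden in \<open>kernel_central\<close>: commutators lie in the
  kernel, as the target is abelian. By \<open>kernel_isolated\<close> the kernel is no larger than
  the isolator of \<open>[H, H]\<close>.\<close>

locale central_lattice_extension = group G for G (structure) +
  fixes H :: "'a set" and \<pi> :: "'a \<Rightarrow> real ^ 'n" and D :: "'n::finite set"
  assumes H_normal: "H \<lhd> G"
    and finite_cosets: "finite (rcosets H)"
    and \<pi>_mult: "\<And>x y. x \<in> H \<Longrightarrow> y \<in> H \<Longrightarrow> \<pi> (x \<otimes> y) = \<pi> x + \<pi> y"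
    and kernel_central: "\<And>x y. x \<in> H \<Longrightarrow> \<pi> x = 0 \<Longrightarrow> y \<in> H \<Longrightarrow> x \<otimes> y = y \<otimes> x"
    and kernel_isolated: "\<And>x. x \<in> H \<Longrightarrow> \<pi> x = 0 \<Longrightarrow> \<exists>j>0. x [^] (j::nat) \<in> derived G H"
    and \<pi>_image: "\<pi> ` H = int_lattice D"
begin

lemma H_subgroup: "subgroup H G" using H_normal by (rule normal_imp_subgroup)

lemma H_carrier [simp]: "x \<in> H \<Longrightarrow> x \<in> carrier G" by (rule subgroup.mem_carrier[OF H_subgroup])

lemma H_closed [simp]: "x \<in> H \<Longrightarrow> y \<in> H \<Longrightarrow> x \<otimes> y \<in> H" by (rule subgroup.m_closed[OF H_subgroup])

lemma H_one [simp]: "\<one> \<in> H" by (rule subgroup.one_closed[OF H_subgroup])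

lemma H_inv [simp]: "x \<in> H \<Longrightarrow> inv x \<in> H" by (rule subgroup.m_inv_closed[OF H_subgroup])

lemma H_pow [simp]: "x \<in> H \<Longrightarrow> x [^] (k::nat) \<in> H" by (induction k) auto

lemma H_int_pow [simp]: "x \<in> H \<Longrightarrow> x [^] (k::int) \<in> H"
  by (cases k rule: int_cases2) (auto simp: int_pow_int int_pow_neg)

lemma H_conj: "g \<in> carrier G \<Longrightarrow> x \<in> H \<Longrightarrow> g \<otimes> x \<otimes> inv g \<in> H"
  by (rule normal.inv_op_closed2[OF H_normal])

lemma H_conj': "g \<in> carrier G \<Longrightarrow> x \<in> H \<Longrightarrow> inv g \<otimes> x \<otimes> g \<in> H"
  by (rule normal.inv_op_closed1[OF H_normal])

lemma \<pi>_one [simp]: "\<pi> \<one> = 0" using \<pi>_mult[of \<one> \<one>] by simp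

lemma \<pi>_inv: "x \<in> H \<Longrightarrow> \<pi> (inv x) = - \<pi> x"
  using \<pi>_mult[of x "inv x"] by (simp add: eq_neg_iff_add_eq_0 add.commute)

lemma \<pi>_pow: "x \<in> H \<Longrightarrow> \<pi> (x [^] (k::nat)) = real k *\<^sub>R \<pi> x"
  by (induction k) (auto simp: \<pi>_mult algebra_simps)

lemma \<pi>_lattice: "x \<in> H \<Longrightarrow> \<pi> x \<in> int_lattice D" using \<pi>_image by blast

definition lift :: "real ^ 'n \<Rightarrow> 'a" where "lift v = (SOME h. h \<in> H \<and> \<pi> h = v)"

lemma lift: "v \<in> int_lattice D \<Longrightarrow> lift v \<in> H \<and> \<pi> (lift v) = v"
proof -
  assume "v \<in> int_lattice D"
  then have "v \<in> \<pi> ` H" by (simp only: \<pi>_image)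
  then have "\<exists>h. h \<in> H \<and> \<pi> h = v" by blast
  then show ?thesis unfolding lift_def by (rule someI_ex)
qed

lemma int_lattice_add: "v \<in> int_lattice D \<Longrightarrow> w \<in> int_lattice D \<Longrightarrow> v + w \<in> int_lattice D"
  by (auto simp: int_lattice_def)

lemma int_lattice_0: "0 \<in> int_lattice D" by (auto simp: int_lattice_def)

lemma int_lattice_scale: "v \<in> int_lattice D \<Longrightarrow> of_int k *\<^sub>R v \<in> int_lattice D"
  by (auto simp: int_lattice_def)

lemma int_lattice_diff: "v \<in> int_lattice D \<Longrightarrow> w \<in> int_lattice D \<Longrightarrow> v - w \<in> int_lattice D"
  by (auto simp: int_lattice_def)

lemma int_lattice_sum: "(\<And>i. i \<in> I \<Longrightarrow> f i \<in> int_lattice D) \<Longrightarrow> sum f I \<in> int_lattice D"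
  by (induction I rule: infinite_finite_induct) (auto simp: int_lattice_0 int_lattice_add)

section \<open>Commutators in \<open>H\<close> and moments of inserted powers\<close>

definition comm :: "'a \<Rightarrow> 'a \<Rightarrow> 'a" where "comm h k = h \<otimes> k \<otimes> inv h \<otimes> inv k"

lemma comm_H [simp]: "h \<in> H \<Longrightarrow> k \<in> H \<Longrightarrow> comm h k \<in> H" by (simp add: comm_def)

lemma \<pi>_comm: "h \<in> H \<Longrightarrow> k \<in> H \<Longrightarrow> \<pi> (comm h k) = 0" by (simp add: comm_def \<pi>_mult \<pi>_inv)

lemma comm_central: "h \<in> H \<Longrightarrow> k \<in> H \<Longrightarrow> x \<in> H \<Longrightarrow> comm h k \<otimes> x = x \<otimes> comm h k"
  by (rule kernel_central) (simp_all add: \<pi>_comm)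

lemma comm_conj: "h \<in> H \<Longrightarrow> k \<in> H \<Longrightarrow> h \<otimes> k \<otimes> inv h = comm h k \<otimes> k"
  by (simp add: comm_def m_assoc)

lemma comm_mult:
  assumes "h \<in> H" "h' \<in> H" "k \<in> H"
  shows "comm (h \<otimes> h') k = comm h k \<otimes> comm h' k"
proof -
  define c where "c = comm h' k"
  have c: "c \<in> H" and hc: "h \<otimes> c = c \<otimes> h" and conj: "h' \<otimes> k \<otimes> inv h' = c \<otimes> k"
    unfolding c_def using assms by (simp_all add: comm_central comm_conj)
  have "comm (h \<otimes> h') k = h \<otimes> (h' \<otimes> k \<otimes> inv h') \<otimes> inv h \<otimes> inv k"
    using assms by (simp add: comm_def inv_mult_group m_assoc)
  also have "\<dots> = (h \<otimes> c) \<otimes> (k \<otimes> inv h \<otimes> inv k)"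
    unfolding conj using assms c by (simp add: m_assoc)
  also have "\<dots> = c \<otimes> comm h k"
    unfolding hc using assms c by (simp add: comm_def m_assoc)
  finally show ?thesis unfolding c_def using comm_central[of h' k "comm h k"] assms by simp
qed

lemma comm_kernel: "z \<in> H \<Longrightarrow> \<pi> z = 0 \<Longrightarrow> k \<in> H \<Longrightarrow> comm z k = \<one>"
  unfolding comm_def using kernel_central[of z k] by (simp add: m_assoc)

text \<open>Changing \<open>h\<close> within its fibre multiplies it by a kernel element, which
  commutes with \<open>k\<close>. Hence \<open>comm\<close> descends to the lattice in its first
  argument.\<close>

lemma comm_cong:
  assumes "h \<in> H" "h' \<in> H" "\<pi> h = \<pi> h'" "k \<in> H"
  shows "comm h k = comm h' k"
proof -
  have "comm h k = comm (h \<otimes> inv h' \<otimes> h') k" using assms by (simp add: m_assoc)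
  also have "\<dots> = comm (h \<otimes> inv h') k \<otimes> comm h' k" using assms by (intro comm_mult) auto
  also have "comm (h \<otimes> inv h') k = \<one>" using assms by (intro comm_kernel) (auto simp: \<pi>_mult \<pi>_inv)
  finally show ?thesis using assms by simp
qed

text \<open>The values of words that insert conjugates of powers of \<open>k\<close>: \<open>i\<close> is the total exponent
  and \<open>v\<close> is the sum of the positions, weighted by the exponents.\<close>

definition moment :: "'a \<Rightarrow> int \<Rightarrow> real ^ 'n \<Rightarrow> 'a" where
  "moment k i v = comm (lift v) k \<otimes> k [^] i"

lemma moment_H [simp]: "k \<in> H \<Longrightarrow> v \<in> int_lattice D \<Longrightarrow> moment k i v \<in> H"
  using lift[of v] by (simp add: moment_def)

lemma moment_mult:
  assumes "k \<in> H" "v \<in> int_lattice D" "w \<in> int_lattice D"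
  shows "moment k i v \<otimes> moment k j w = moment k (i + j) (v + w)"
proof -
  note l = lift[OF assms(2)] lift[OF assms(3)] lift[OF int_lattice_add[OF assms(2,3)]]
  have 1: "comm (lift (v + w)) k = comm (lift v) k \<otimes> comm (lift w) k"
  proof -
    have "comm (lift (v + w)) k = comm (lift v \<otimes> lift w) k"
      using l assms by (intro comm_cong) (auto simp: \<pi>_mult)
    then show ?thesis using l assms by (simp add: comm_mult)
  qed
  have "moment k i v \<otimes> moment k j w = comm (lift v) k \<otimes> (k [^] i \<otimes> comm (lift w) k) \<otimes> k [^] j"
    using assms l by (simp add: moment_def m_assoc)
  also have "k [^] i \<otimes> comm (lift w) k = comm (lift w) k \<otimes> k [^] i"
    using l assms by (intro comm_central[symmetric]) auto
  also have "comm (lift v) k \<otimes> (comm (lift w) k \<otimes> k [^] i) \<otimes> k [^] j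
      = comm (lift v) k \<otimes> comm (lift w) k \<otimes> (k [^] i \<otimes> k [^] j)"
    using l assms by (simp add: m_assoc)
  finally show ?thesis unfolding moment_def 1 using assms by (simp add: int_pow_mult)
qed

lemma moment_0: "k \<in> H \<Longrightarrow> moment k 0 0 = \<one>"
  using lift[OF int_lattice_0] by (simp add: moment_def comm_kernel)

lemma moment_inv:
  assumes "k \<in> H" "v \<in> int_lattice D"
  shows "inv (moment k i v) = moment k (- i) (- v)"
proof -
  have v': "- v \<in> int_lattice D" using int_lattice_scale[OF assms(2), of "-1"] by simp
  have "moment k (- i) (- v) \<otimes> moment k i v = \<one>"
    using moment_mult[OF assms(1) v' assms(2), of "- i" i] assms by (simp add: moment_0)
  then show ?thesis using assms v' by (intro inv_equality) auto
qed

text \<open>Moving \<open>k [^] m\<close> past \<open>h\<close> produces \<open>m\<close> factors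
  equal to the central element \<open>comm h k\<close>, and these add up to the weight
  \<open>m\<close> at position \<open>\<pi> h\<close>.\<close>

lemma moment_conj:
  assumes h: "h \<in> H" and k: "k \<in> H"
  shows "h \<otimes> k [^] (m::int) \<otimes> inv h = moment k m (of_int m *\<^sub>R \<pi> h)"
proof -
  note l = lift[OF \<pi>_lattice[OF h]]
  have base: "h \<otimes> k \<otimes> inv h = moment k 1 (\<pi> h)"
    using h k l comm_cong[of "lift (\<pi> h)" h k] by (simp add: moment_def comm_conj)
  have sc: "real n *\<^sub>R \<pi> h \<in> int_lattice D" for n
    using int_lattice_scale[OF \<pi>_lattice[OF h], of "int n"] by simp
  have nat: "h \<otimes> k [^] n \<otimes> inv h = moment k (int n) (real n *\<^sub>R \<pi> h)" for n :: nat
  proof (induction n)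
    case 0
    then show ?case using h k by (simp add: moment_0)
  next
    case (Suc n)
    have "h \<otimes> k [^] Suc n \<otimes> inv h = (h \<otimes> k [^] n \<otimes> inv h) \<otimes> (h \<otimes> k \<otimes> inv h)"
      using h k by (simp add: m_assoc inv_cancel_left)
    also have "\<dots> = moment k (int n + 1) (real n *\<^sub>R \<pi> h + \<pi> h)"
      unfolding Suc base using moment_mult[OF k sc \<pi>_lattice[OF h]] .
    finally show ?case by (simp add: algebra_simps)
  qed
  show ?thesis
  proof (cases m rule: int_cases2)
    case (nonneg n)
    then show ?thesis using nat[of n] by (simp add: int_pow_int)
  next
    case (nonpos n)
    have km: "k [^] m = inv (k [^] n)" using nonpos k by (simp add: int_pow_neg int_pow_int)
    have "h \<otimes> k [^] m \<otimes> inv h = inv (h \<otimes> k [^] n \<otimes> inv h)"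
      unfolding km using h k by (simp add: inv_mult_group m_assoc)
    also have "\<dots> = inv (moment k (int n) (real n *\<^sub>R \<pi> h))" by (simp only: nat)
    also have "\<dots> = moment k (- int n) (- (real n *\<^sub>R \<pi> h))" by (rule moment_inv[OF k sc])
    finally show ?thesis using nonpos by simp
  qed
qed

section \<open>Positions of elements of \<open>G\<close> in the lattice\<close>

definition coset_rep :: "'a \<Rightarrow> 'a" where "coset_rep g = (SOME x. x \<in> H #> g)"

text \<open>An extension of \<open>\<pi>\<close> from \<open>H\<close> to \<open>G\<close>, made in
  each coset separately; another representative would translate the positions over that
  coset.\<close>

definition position :: "'a \<Rightarrow> real ^ 'n" where "position g = \<pi> (g \<otimes> inv (coset_rep g))"

lemma coset_rep_mem: "g \<in> carrier G \<Longrightarrow> coset_rep g \<in> H #> g"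
  unfolding coset_rep_def using rcos_self[OF _ H_subgroup] by (rule someI)

lemma coset_rep_carrier [simp]: "g \<in> carrier G \<Longrightarrow> coset_rep g \<in> carrier G"
  using coset_rep_mem[of g] r_coset_subset_G[OF subgroup.subset[OF H_subgroup]] by blast

lemma coset_rep_cong: "H #> g = H #> g' \<Longrightarrow> coset_rep g = coset_rep g'"
  by (simp add: coset_rep_def)

lemma coset_rep_quotient: "g \<in> carrier G \<Longrightarrow> g \<otimes> inv (coset_rep g) \<in> H"
proof -
  assume g: "g \<in> carrier G"
  obtain h where h: "h \<in> H" "coset_rep g = h \<otimes> g" using coset_rep_mem[OF g] by (auto simp: r_coset_def)
  then have "g \<otimes> inv (coset_rep g) = inv h" using g by (simp add: inv_mult_group m_assoc inv_cancel_left)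
  then show ?thesis using h by simp
qed

lemma position_lattice: "g \<in> carrier G \<Longrightarrow> position g \<in> int_lattice D"
  unfolding position_def by (intro \<pi>_lattice coset_rep_quotient)

lemma finite_coset_reps: "finite (coset_rep ` carrier G)"
proof -
  have "coset_rep ` carrier G \<subseteq> (\<lambda>C. SOME x. x \<in> C) ` (rcosets H)"
    by (auto simp: coset_rep_def RCOSETS_def)
  then show ?thesis using finite_cosets finite_surj by blast
qed

lemma position_step:
  assumes "g \<in> carrier G" "s \<in> carrier G"
  shows "position (g \<otimes> s) = position g + \<pi> (coset_rep g \<otimes> s \<otimes> inv (coset_rep (g \<otimes> s)))"
proof -
  let ?a = "g \<otimes> inv (coset_rep g)" and ?b = "coset_rep g \<otimes> s \<otimes> inv (coset_rep (g \<otimes> s))"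
  have ab: "g \<otimes> s \<otimes> inv (coset_rep (g \<otimes> s)) = ?a \<otimes> ?b"
    using assms by (simp add: m_assoc inv_cancel_left)
  have a: "?a \<in> H" and c: "g \<otimes> s \<otimes> inv (coset_rep (g \<otimes> s)) \<in> H" using assms by (simp_all add: coset_rep_quotient)
  have "?b = inv ?a \<otimes> (g \<otimes> s \<otimes> inv (coset_rep (g \<otimes> s)))"
    unfolding ab using assms by (simp add: m_assoc inv_mult_group inv_cancel_left)
  then have "?b \<in> H" using a c by simp
  then show ?thesis unfolding position_def ab by (rule \<pi>_mult[OF a])
qed

text \<open>By \<open>position_step\<close> the increment depends only on the letter and on two
  coset representatives, which leaves finitely many values.\<close>

lemma position_steps_bounded:
  assumes "finite S" "S \<subseteq> carrier G"
  obtains C where "C \<ge> 0" "\<And>g s. g \<in> carrier G \<Longrightarrow> s \<in> S \<Longrightarrow> norm (position (g \<otimes> s) - position g) \<le> C"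
proof -
  define R where "R = coset_rep ` carrier G"
  define K where "K = (\<lambda>(a, s, b). norm (\<pi> (a \<otimes> s \<otimes> inv b))) ` (R \<times> S \<times> R)"
  have "finite R" unfolding R_def by (rule finite_coset_reps)
  then have fin: "finite (insert 0 K)"
    unfolding K_def using assms(1) by (intro finite.insertI finite_imageI finite_cartesian_product)
  show ?thesis
  proof (rule that)
    show "0 \<le> Max (insert 0 K)" by (rule Max_ge[OF fin]) simp
    fix g s assume g: "g \<in> carrier G" and s: "s \<in> S"
    have "s \<in> carrier G" using s assms(2) by blast
    then have "norm (position (g \<otimes> s) - position g) = norm (\<pi> (coset_rep g \<otimes> s \<otimes> inv (coset_rep (g \<otimes> s))))"
      using g by (simp add: position_step)
    also have "\<dots> = (\<lambda>(a, s, b). norm (\<pi> (a \<otimes> s \<otimes> inv b))) (coset_rep g, s, coset_rep (g \<otimes> s))" by simp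
    also have "\<dots> \<in> K"
      unfolding K_def R_def using g s \<open>s \<in> carrier G\<close> by (intro imageI SigmaI m_closed)
    finally show "norm (position (g \<otimes> s) - position g) \<le> Max (insert 0 K)"
      by (intro Max_ge[OF fin] insertI2)
  qed
qed

end

lemma finite_int_lattice_bounded: "finite {v \<in> int_lattice (D :: 'n::finite set). norm v \<le> R}"
proof -
  define b where "b = \<lceil>R\<rceil>"
  let ?F = "PiE (UNIV :: 'n set) (\<lambda>_. {- b..b})"
  have "{v \<in> int_lattice D. norm v \<le> R} \<subseteq> (\<lambda>f. \<chi> i. real_of_int (f i)) ` ?F"
  proof
    fix v assume v: "v \<in> {v \<in> int_lattice D. norm v \<le> R}"
    have int: "v $ i = real_of_int \<lfloor>v $ i\<rfloor>" for i
    proof -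
      have "v $ i \<in> \<int>" using v by (cases "i \<in> D") (simp_all add: int_lattice_def)
      then show ?thesis by (metis Ints_cases floor_of_int)
    qed
    have "\<lfloor>v $ i\<rfloor> \<in> {- b..b}" for i
    proof -
      have "\<bar>v $ i\<bar> \<le> R" using component_le_norm_cart[of v i] v by simp
      then show ?thesis unfolding b_def by (simp; linarith)
    qed
    then have A: "(\<lambda>i. \<lfloor>v $ i\<rfloor>) \<in> ?F" by (simp add: PiE_iff)
    have B: "v = (\<chi> i. real_of_int \<lfloor>v $ i\<rfloor>)" using int by (simp add: vec_eq_iff)
    show "v \<in> (\<lambda>f. \<chi> i. real_of_int (f i)) ` ?F"
      using imageI[OF A, of "\<lambda>f. \<chi> i. real_of_int (f i)"] by (subst B)
  qed
  moreover have "finite ?F" by (intro finite_PiE) auto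
  ultimately show ?thesis using finite_surj by blast
qed

context group
begin

lemma conj_nat_pow:
  assumes "g \<in> carrier G" "k \<in> carrier G"
  shows "(inv g \<otimes> k \<otimes> g) [^] (n::nat) = inv g \<otimes> k [^] n \<otimes> g"
proof (induction n)
  case (Suc n)
  then show ?case using assms by (simp add: m_assoc inv_cancel_left)
qed (use assms in simp)

definition geodesic_word :: "'a set \<Rightarrow> 'a \<Rightarrow> 'a list" where
  "geodesic_word S g = (SOME w. w \<in> lists S \<and> word_eval G w = g \<and> length w = word_norm G S g)"

lemma geodesic_word:
  assumes "generating_set G S" "g \<in> carrier G"
  shows "geodesic_word S g \<in> lists S" "word_eval G (geodesic_word S g) = g"
    "length (geodesic_word S g) = word_norm G S g"
proof -
  have "\<exists>w. w \<in> lists S \<and> word_eval G w = g \<and> length w = word_norm G S g"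
    using word_norm_word[OF assms] by metis
  from someI_ex[OF this] show "geodesic_word S g \<in> lists S" "word_eval G (geodesic_word S g) = g"
    "length (geodesic_word S g) = word_norm G S g"
    unfolding geodesic_word_def by blast+
qed

end

context central_lattice_extension
begin

text \<open>Conjugation by the representative turns the inserted element into a power of one and the
  same \<open>k\<close>, whatever the coset of \<open>g\<close>. Insertions over different cosets
  can thus be added up in the single homomorphism \<open>moment k\<close>.\<close>

lemma coset_rep_conj_insert:
  assumes g: "g \<in> carrier G" and k: "k \<in> H"
  shows "g \<otimes> (inv (coset_rep g) \<otimes> k [^] (i::int) \<otimes> coset_rep g) \<otimes> inv g = moment k i (of_int i *\<^sub>R position g)"
proof -
  define h where "h = g \<otimes> inv (coset_rep g)"
  have h: "h \<in> H" unfolding h_def by (rule coset_rep_quotient[OF g])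
  have "inv h = coset_rep g \<otimes> inv g" unfolding h_def using g by (simp add: inv_mult_group)
  then have "g \<otimes> (inv (coset_rep g) \<otimes> k [^] i \<otimes> coset_rep g) \<otimes> inv g = h \<otimes> k [^] i \<otimes> inv h"
    using g k by (simp add: h_def m_assoc)
  also have "\<dots> = moment k i (of_int i *\<^sub>R \<pi> h)" by (rule moment_conj[OF h k])
  finally show ?thesis by (simp add: h_def position_def)
qed

lemma word_eval_moments:
  assumes k: "k \<in> H" and v: "\<And>t. t < N \<Longrightarrow> v t \<in> int_lattice D"
  shows "word_eval G (map (\<lambda>t. moment k (i t) (v t)) [0..<N]) = moment k (\<Sum>t<N. i t) (\<Sum>t<N. v t)"
  using v
proof (induction N)
  case 0
  then show ?case using k by (simp add: moment_0)
next
  case (Suc N)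
  have "set (map (\<lambda>t. moment k (i t) (v t)) [0..<N]) \<subseteq> carrier G" "moment k (i N) (v N) \<in> carrier G"
    using k Suc.prems by auto
  moreover have "(\<Sum>t<N. v t) \<in> int_lattice D" using Suc.prems by (intro int_lattice_sum) auto
  ultimately show ?case using Suc k by (simp add: moment_mult)
qed

lemma word_eval_insert_moments:
  assumes k: "k \<in> H" and y: "set y \<subseteq> carrier G"
    and c: "\<And>t. t \<le> length y \<Longrightarrow> set (c t) \<subseteq> carrier G"
    and v: "\<And>t. t \<le> length y \<Longrightarrow> v t \<in> int_lattice D"
    and e: "\<And>t. t \<le> length y \<Longrightarrow>
      word_eval G (take t y) \<otimes> word_eval G (c t) \<otimes> inv (word_eval G (take t y)) = moment k (i t) (v t)"
  shows "word_eval G (insert_words y c) = moment k (\<Sum>t\<le>length y. i t) (\<Sum>t\<le>length y. v t) \<otimes> word_eval G y"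
proof -
  have tk: "set (take t y) \<subseteq> carrier G" for t using y set_take_subset by fast
  have "\<one> \<otimes> word_eval G (insert_words y c)
      = word_eval G (map (\<lambda>t. moment k (i t) (v t)) [0..<Suc (length y)]) \<otimes> (\<one> \<otimes> word_eval G y)"
    by (rule word_eval_insert_words) (use y c e tk in auto)
  moreover have "insert_words y c \<in> lists (carrier G)"
    by (rule insert_words_in_lists) (use y c in \<open>auto simp: lists_eq_set\<close>)
  then have "set (insert_words y c) \<subseteq> carrier G" by (simp add: lists_eq_set)
  moreover have "word_eval G (map (\<lambda>t. moment k (i t) (v t)) [0..<Suc (length y)])
      = moment k (\<Sum>t<Suc (length y). i t) (\<Sum>t<Suc (length y). v t)"
    using v by (intro word_eval_moments[OF k]) auto
  ultimately show ?thesis using y by (simp add: lessThan_Suc_atMost del: upt_Suc)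
qed

text \<open>The spelling \<open>v t\<close> of the powers is left open: geodesic words are
  substituted to save length, plain repetitions to gather letters.\<close>

definition gathers ::
    "'a set \<Rightarrow> 'a list \<Rightarrow> nat \<Rightarrow> 'a list \<Rightarrow> (nat \<Rightarrow> nat) \<Rightarrow> (nat \<Rightarrow> nat) \<Rightarrow> (nat \<Rightarrow> 'a list) \<Rightarrow> bool" where
  "gathers S u C y m x c \<longleftrightarrow> (\<forall>t. 0 < x t \<longrightarrow> t \<le> length y \<and> 0 < m t) \<and> card {t. 0 < x t} \<le> C \<and>
       (\<Sum>t\<le>length y. x t) \<le> (\<Sum>t\<le>length y. m t) + C \<and> (\<Sum>t\<le>length y. m t) \<le> (\<Sum>t\<le>length y. x t) + C \<and>
       (\<forall>t. c t \<in> lists S \<and> word_eval G (c t) \<in> H) \<and> (\<Sum>t\<le>length y. length (c t)) \<le> C \<and>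
       (\<forall>v. (\<forall>t\<le>length y. v t \<in> lists S \<and> word_eval G (v t) = word_eval G u [^] x t) \<longrightarrow>
          word_eval G (insert_words y (\<lambda>t. v t @ c t)) = word_eval G (insert_words y (\<lambda>t. concat (replicate (m t) u))))"

text \<open>The constant depends neither on the length of the word nor on the number of copies of \<open>u\<close>,
  which \<open>x\<close> places in at most \<open>C\<close> positions; the words \<open>c t\<close> are the corrections.\<close>

lemma gather_loops:
  assumes S: "generating_set G S" and u: "u \<in> lists S" "word_eval G u \<in> H" and f: "f \<in> rcosets H"
  shows "\<exists>C::nat. \<forall>y m. y \<in> lists S \<longrightarrow> (\<forall>t\<le>length y. 0 < m t \<longrightarrow> H #> word_eval G (take t y) = f) \<longrightarrow>
    (\<exists>x c. gathers S u C y m x c)"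
proof -
  have SG: "S \<subseteq> carrier G" and finS: "finite S" using S by (auto simp: generating_set_def)
  obtain g0 where g0: "g0 \<in> carrier G" "f = H #> g0" using f by (auto simp: RCOSETS_def)
  define r0 where "r0 = coset_rep g0"
  have r0: "r0 \<in> carrier G" using g0 by (simp add: r0_def)
  \<comment> \<open>All copies of \<open>u\<close> sit over the one coset \<open>f\<close>, so
    conjugation to its representative makes them copies of this single element of
    \<open>H\<close>.\<close>
  define k where "k = r0 \<otimes> word_eval G u \<otimes> inv r0"
  have k: "k \<in> H" unfolding k_def by (rule H_conj[OF r0 u(2)])
  have uk: "word_eval G u = inv r0 \<otimes> k \<otimes> r0"
    unfolding k_def using r0 u(2) by (simp add: m_assoc inv_cancel_left)
  obtain C0 where C0: "C0 \<ge> 0" "\<And>g s. g \<in> carrier G \<Longrightarrow> s \<in> S \<Longrightarrow> norm (position (g \<otimes> s) - position g) \<le> C0"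
    using position_steps_bounded[OF finS SG] by blast
  obtain C1 :: nat where C1: "\<forall>n (p::nat \<Rightarrow> real ^ 'n) (m::nat \<Rightarrow> nat).
     (\<forall>t<n. norm (p (Suc t) - p t) \<le> C0) \<longrightarrow>
     (\<exists>(x::nat \<Rightarrow> nat) (\<delta>::nat \<Rightarrow> int).
        (\<forall>t. x t > 0 \<longrightarrow> t \<le> n \<and> m t > 0) \<and> card {t. x t > 0} \<le> C1 \<and> (\<Sum>t\<le>n. \<bar>\<delta> t\<bar>) \<le> int C1 \<and>
        (\<Sum>t\<le>n. int (x t) + \<delta> t) = (\<Sum>t\<le>n. int (m t)) \<and>
        norm ((\<Sum>t\<le>n. of_int (int (x t) + \<delta> t) *\<^sub>R p t) - (\<Sum>t\<le>n. real (m t) *\<^sub>R p t)) \<le> real C1)"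
    by (rule exE[OF concentrate_multiplicities[OF C0(1), where 'e = "real ^ 'n"]])
  \<comment> \<open>The corrections are conjugates of bounded powers of \<open>k\<close> by finitely
    many representatives, and one commutator with a bounded lattice vector (\<open>?K3\<close>).
    Both sets are finite and independent of the word, hence so are the bounds \<open>C2\<close> and
    \<open>C3\<close>.\<close>
  let ?K2 = "(\<lambda>(r, i). inv r \<otimes> k [^] (i::int) \<otimes> r) ` (coset_rep ` carrier G \<times> {- int C1..int C1})"
  have "finite ?K2" by (intro finite_imageI finite_cartesian_product finite_coset_reps finite_atLeastAtMost_int)
  then obtain C2 where C2: "\<forall>g\<in>?K2. word_norm G S g \<le> C2" by (rule exE[OF word_norm_bounded])
  let ?K3 = "moment k 0 ` {v \<in> int_lattice D. norm v \<le> real C1}"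
  have "finite ?K3" by (intro finite_imageI finite_int_lattice_bounded)
  then obtain C3 where C3: "\<forall>g\<in>?K3. word_norm G S g \<le> C3" by (rule exE[OF word_norm_bounded])
  define C where "C = C1 + C3 + C2 * C1"
  show ?thesis
  proof (intro exI[of _ C] allI impI)
    fix y :: "'a list" and m :: "nat \<Rightarrow> nat"
    assume yS: "y \<in> lists S" and mf: "\<forall>t\<le>length y. 0 < m t \<longrightarrow> H #> word_eval G (take t y) = f"
    define n where "n = length y"
    define Y where "Y t = word_eval G (take t y)" for t
    define p where "p t = position (Y t)" for t
    have y: "set y \<subseteq> carrier G" using yS SG by auto
    have tk: "set (take t y) \<subseteq> carrier G" for t using y set_take_subset by fast
    have Y: "Y t \<in> carrier G" for t using tk by (simp add: Y_def)
    have pl: "p t \<in> int_lattice D" for t unfolding p_def by (rule position_lattice[OF Y])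
    have "norm (p (Suc t) - p t) \<le> C0" if "t < n" for t
    proof -
      have "y ! t \<in> S" using yS that by (auto simp: n_def)
      moreover have "Y (Suc t) = Y t \<otimes> y ! t"
        using that tk \<open>y ! t \<in> S\<close> SG by (auto simp: Y_def n_def take_Suc_conv_app_nth)
      ultimately show ?thesis using C0(2)[OF Y] by (simp add: p_def)
    qed
    then obtain x :: "nat \<Rightarrow> nat" and \<delta> :: "nat \<Rightarrow> int" where
        x: "\<And>t. x t > 0 \<Longrightarrow> t \<le> n \<and> m t > 0" "card {t. x t > 0} \<le> C1" and \<delta>: "(\<Sum>t\<le>n. \<bar>\<delta> t\<bar>) \<le> int C1"
        and total: "(\<Sum>t\<le>n. int (x t) + \<delta> t) = (\<Sum>t\<le>n. int (m t))"
        and near: "norm ((\<Sum>t\<le>n. of_int (int (x t) + \<delta> t) *\<^sub>R p t) - (\<Sum>t\<le>n. real (m t) *\<^sub>R p t)) \<le> real C1"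
      using C1 by blast
    \<comment> \<open>The exponents already agree in total; this bounded error of the moment is what
      remains. It is repaired at time \<open>0\<close>, where the prefix is empty.\<close>
    define e where "e = (\<Sum>t\<le>n. real (m t) *\<^sub>R p t) - (\<Sum>t\<le>n. of_int (int (x t) + \<delta> t) *\<^sub>R p t)"
    have el: "e \<in> int_lattice D" unfolding e_def
      using pl int_lattice_scale[OF pl, of "int (m t)" t for t]
      by (intro int_lattice_diff int_lattice_sum int_lattice_scale) auto
    have eC: "norm e \<le> real C1" unfolding e_def using near by (simp only: norm_minus_commute)
    define a where "a t = inv (coset_rep (Y t)) \<otimes> k [^] (\<delta> t) \<otimes> coset_rep (Y t)" for t
    have aH: "a t \<in> H" for t unfolding a_def using k Y by (intro H_conj') auto
    define b where "b t = (if t = 0 then moment k 0 e else \<one>)" for t :: nat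
    have bH: "b t \<in> H" for t using k el by (simp add: b_def)
    define c where "c t = geodesic_word S (b t) @ geodesic_word S (a t)" for t
    have cS: "c t \<in> lists S" and ce: "word_eval G (c t) = b t \<otimes> a t" for t
    proof -
      have 1: "geodesic_word S (b t) \<in> lists S" "geodesic_word S (a t) \<in> lists S"
        using geodesic_word(1)[OF S] aH bH by auto
      then show "c t \<in> lists S" by (simp add: c_def)
      have "set (geodesic_word S (b t)) \<subseteq> carrier G" "set (geodesic_word S (a t)) \<subseteq> carrier G" using 1 SG by auto
      then show "word_eval G (c t) = b t \<otimes> a t"
        using geodesic_word(2)[OF S] aH bH by (simp add: c_def)
    qed
    \<comment> \<open>Apart from the single repair at time \<open>0\<close>, only times with
      \<open>\<delta> t \<noteq> 0\<close> cost anything; the factor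
      \<open>\<bar>\<delta> t\<bar>\<close> lets these costs sum up to at most
      \<open>C2 * C1\<close>, however long the path is.\<close>
    have lenc: "length (c t) \<le> (if t = 0 then C3 else 0) + C2 * nat \<bar>\<delta> t\<bar>" if t: "t \<le> n" for t
    proof -
      have "\<bar>\<delta> t\<bar> \<le> (\<Sum>t\<le>n. \<bar>\<delta> t\<bar>)" using t by (intro member_le_sum) auto
      then have \<delta>t: "\<delta> t \<in> {- int C1..int C1}" using \<delta> by auto
      have "word_norm G S (a t) \<le> C2 * nat \<bar>\<delta> t\<bar>"
      proof (cases "\<delta> t = 0")
        case True
        then show ?thesis using Y by (simp add: a_def)
      next
        case False
        have "a t = (\<lambda>(r, i). inv r \<otimes> k [^] (i::int) \<otimes> r) (coset_rep (Y t), \<delta> t)" by (simp add: a_def)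
        also have "\<dots> \<in> ?K2" using Y \<delta>t by (intro imageI SigmaI)
        finally have "word_norm G S (a t) \<le> C2" by (rule bspec[OF C2])
        moreover have "1 \<le> nat \<bar>\<delta> t\<bar>" using False by simp
        ultimately show ?thesis using mult_le_mono2[of 1 "nat \<bar>\<delta> t\<bar>" C2] by linarith
      qed
      moreover have "word_norm G S (b t) \<le> (if t = 0 then C3 else 0)"
        using bspec[OF C3, of "moment k 0 e"] el eC by (auto simp: b_def)
      ultimately show ?thesis
        using geodesic_word(3)[OF S, of "a t"] geodesic_word(3)[OF S, of "b t"] aH bH by (simp add: c_def)
    qed
    have "(\<Sum>t\<le>n. length (c t)) \<le> (\<Sum>t\<le>n. (if t = 0 then C3 else 0) + C2 * nat \<bar>\<delta> t\<bar>)"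
      by (intro sum_mono lenc) simp
    also have "\<dots> = C3 + C2 * (\<Sum>t\<le>n. nat \<bar>\<delta> t\<bar>)" by (simp add: sum.distrib sum_distrib_left)
    also have "int (\<Sum>t\<le>n. nat \<bar>\<delta> t\<bar>) = (\<Sum>t\<le>n. \<bar>\<delta> t\<bar>)" by (simp only: of_nat_sum) simp
    then have "(\<Sum>t\<le>n. nat \<bar>\<delta> t\<bar>) \<le> C1" using \<delta> by linarith
    then have "C3 + C2 * (\<Sum>t\<le>n. nat \<bar>\<delta> t\<bar>) \<le> C3 + C2 * C1" by (intro add_mono mult_le_mono2) simp_all
    finally have lenC: "(\<Sum>t\<le>n. length (c t)) \<le> C" by (simp add: C_def)
    have "\<bar>\<Sum>t\<le>n. \<delta> t\<bar> \<le> int C1" using \<delta> sum_abs[of \<delta> "{..n}"] by linarith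
    moreover have "int (\<Sum>t\<le>n. x t) + (\<Sum>t\<le>n. \<delta> t) = int (\<Sum>t\<le>n. m t)" using total by (simp add: sum.distrib)
    ultimately have xm: "(\<Sum>t\<le>n. x t) \<le> (\<Sum>t\<le>n. m t) + C1" "(\<Sum>t\<le>n. m t) \<le> (\<Sum>t\<le>n. x t) + C1" by linarith+
    have upow: "Y t \<otimes> word_eval G u [^] q \<otimes> inv (Y t) = moment k (int q) (real q *\<^sub>R p t)"
      if "H #> Y t = f" for t and q :: nat
    proof -
      have "coset_rep (Y t) = r0" unfolding r0_def using that g0 by (intro coset_rep_cong) simp
      then have "word_eval G u [^] q = inv (coset_rep (Y t)) \<otimes> k [^] (int q) \<otimes> coset_rep (Y t)"
        unfolding uk using conj_nat_pow[OF r0, of k q] k by (simp add: int_pow_int)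
      then show ?thesis using coset_rep_conj_insert[OF Y k, of t "int q"] by (simp add: p_def)
    qed
    have uset: "set u \<subseteq> carrier G" using u SG by auto
    have old: "word_eval G (insert_words y (\<lambda>t. concat (replicate (m t) u)))
        = moment k (\<Sum>t\<le>length y. int (m t)) (\<Sum>t\<le>length y. real (m t) *\<^sub>R p t) \<otimes> word_eval G y"
    proof (rule word_eval_insert_moments[OF k y])
      fix t assume t: "t \<le> length y"
      show "set (concat (replicate (m t) u)) \<subseteq> carrier G" using uset by auto
      show "real (m t) *\<^sub>R p t \<in> int_lattice D" using int_lattice_scale[OF pl, of "int (m t)"] by simp
      show "word_eval G (take t y) \<otimes> word_eval G (concat (replicate (m t) u)) \<otimes> inv word_eval G (take t y)
          = moment k (int (m t)) (real (m t) *\<^sub>R p t)"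
      proof (cases "m t = 0")
        case True
        then show ?thesis using Y[of t] k by (simp add: moment_0 Y_def)
      next
        case False
        then show ?thesis using upow[of t "m t"] mf t uset by (simp add: word_eval_replicate Y_def)
      qed
    qed
    have new: "word_eval G (insert_words y (\<lambda>t. v t @ c t)) = word_eval G (insert_words y (\<lambda>t. concat (replicate (m t) u)))"
      if v: "\<forall>t\<le>length y. v t \<in> lists S \<and> word_eval G (v t) = word_eval G u [^] (x t :: nat)" for v
    proof -
      let ?w = "\<lambda>t. (of_int (int (x t) + \<delta> t) *\<^sub>R p t) + (if t = 0 then e else 0)"
      have vS: "set (v t) \<subseteq> carrier G" if "t \<le> length y" for t using v that SG by auto
      have cS': "set (c t) \<subseteq> carrier G" for t using cS[of t] SG by auto
      have "word_eval G (insert_words y (\<lambda>t. v t @ c t))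
        = moment k (\<Sum>t\<le>length y. int (x t) + \<delta> t) (\<Sum>t\<le>length y. ?w t) \<otimes> word_eval G y"
      proof (rule word_eval_insert_moments[OF k y])
        fix t assume t: "t \<le> length y"
        show "set (v t @ c t) \<subseteq> carrier G" using vS[OF t] cS'[of t] by simp
        show "?w t \<in> int_lattice D"
          using el pl by (intro int_lattice_add int_lattice_scale) (auto simp: int_lattice_0)
        have xl: "real (x t) *\<^sub>R p t \<in> int_lattice D" using int_lattice_scale[OF pl, of "int (x t)"] by simp
        have \<delta>l: "of_int (\<delta> t) *\<^sub>R p t \<in> int_lattice D" by (rule int_lattice_scale[OF pl])
        have A: "Y t \<otimes> a t \<otimes> inv (Y t) = moment k (\<delta> t) (of_int (\<delta> t) *\<^sub>R p t)"
          unfolding a_def p_def by (rule coset_rep_conj_insert[OF Y k])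
        have B: "Y t \<otimes> b t \<otimes> inv (Y t) = moment k 0 (if t = 0 then e else 0)"
          using Y[of t] k el by (simp add: b_def moment_0) (simp add: Y_def)
        have V: "Y t \<otimes> word_eval G (v t) \<otimes> inv (Y t) = moment k (int (x t)) (real (x t) *\<^sub>R p t)"
        proof (cases "x t = 0")
          case True
          then show ?thesis using v t Y[of t] k by (simp add: moment_0)
        next
          case False
          then show ?thesis using upow[of t "x t"] x(1)[of t] mf v t by (simp add: n_def Y_def)
        qed
        have "Y t \<otimes> word_eval G (v t @ c t) \<otimes> inv (Y t)
          = (Y t \<otimes> word_eval G (v t) \<otimes> inv (Y t)) \<otimes> (Y t \<otimes> b t \<otimes> inv (Y t)) \<otimes> (Y t \<otimes> a t \<otimes> inv (Y t))"
          using vS[OF t] cS'[of t] ce[of t] aH[of t] bH[of t] Y[of t] by (simp add: m_assoc inv_cancel_left)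
        also have "\<dots> = moment k (int (x t) + 0 + \<delta> t) (real (x t) *\<^sub>R p t + (if t = 0 then e else 0) + of_int (\<delta> t) *\<^sub>R p t)"
          unfolding V A B using k xl \<delta>l el
          by (simp add: moment_mult int_lattice_0 int_lattice_add)
        also have "\<dots> = moment k (int (x t) + \<delta> t) (?w t)" by (simp add: algebra_simps)
        finally show "word_eval G (take t y) \<otimes> word_eval G (v t @ c t) \<otimes> inv word_eval G (take t y)
          = moment k (int (x t) + \<delta> t) (?w t)" by (simp only: Y_def)
      qed
      moreover have "(\<Sum>t\<le>length y. ?w t) = (\<Sum>t\<le>length y. real (m t) *\<^sub>R p t)"
        by (simp add: sum.distrib e_def n_def)
      ultimately show ?thesis unfolding old using total by (simp only: n_def)
    qed
    show "\<exists>x c. gathers S u C y m x c"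
      unfolding gathers_def
    proof (intro exI[of _ x] exI[of _ c] conjI allI impI)
      show "card {t. 0 < x t} \<le> C" using x(2) by (simp add: C_def)
      show "(\<Sum>t\<le>length y. x t) \<le> (\<Sum>t\<le>length y. m t) + C" "(\<Sum>t\<le>length y. m t) \<le> (\<Sum>t\<le>length y. x t) + C"
        using xm by (simp_all add: C_def n_def)
      show "(\<Sum>t\<le>length y. length (c t)) \<le> C" using lenC by (simp add: n_def)
      show "t \<le> length y" "0 < m t" if "0 < x t" for t using x(1)[OF that] by (simp_all add: n_def)
      show "c t \<in> lists S" for t by (rule cS)
      show "word_eval G (c t) \<in> H" for t using ce aH bH by simp
    qed (rule new)
  qed
qed

end

section \<open>Powers of inefficient loops\<close>

context central_lattice_extension
begin

lemma comm_inv: "x \<in> H \<Longrightarrow> y \<in> H \<Longrightarrow> inv (comm x y) = comm y x"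
  by (simp add: comm_def inv_mult_group m_assoc)

lemma comm_pow_left: "x \<in> H \<Longrightarrow> y \<in> H \<Longrightarrow> comm (x [^] (k::nat)) y = comm x y [^] k"
  by (induction k) (simp_all add: comm_mult comm_kernel)

lemma comm_pow_right:
  assumes "x \<in> H" "y \<in> H"
  shows "comm x (y [^] (k::nat)) = comm x y [^] k"
proof -
  have "comm x (y [^] k) = inv (comm (y [^] k) x)" using assms by (simp add: comm_inv)
  also have "\<dots> = inv (comm y x) [^] k" using assms by (simp add: comm_pow_left nat_pow_inv)
  finally show ?thesis using assms by (simp add: comm_inv)
qed

text \<open>The subgroup \<open>[H, H]\<close> is quadratically distorted, since \<open>[x, y]\<^sup>k\<^sup>*\<^sup>k = [x\<^sup>k, y\<^sup>k]\<close>.\<close>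

lemma commutator_norm_square:
  assumes S: "generating_set G S" and "x \<in> H" "y \<in> H"
  shows "\<exists>C. \<forall>k::nat. word_norm G S (comm x y [^] (k * k)) \<le> C * k"
proof (intro exI allI)
  fix k :: nat
  let ?n = "word_norm G S"
  define a b where "a = x [^] k" and "b = y [^] k"
  have ab: "a \<in> H" "b \<in> H" using assms by (simp_all add: a_def b_def)
  have "comm x y [^] (k * k) = (comm x y [^] k) [^] k" using assms by (simp add: nat_pow_pow)
  then have *: "comm x y [^] (k * k) = a \<otimes> b \<otimes> inv a \<otimes> inv b"
    using assms unfolding a_def b_def comm_def[of "x [^] k" "y [^] k", symmetric]
    by (simp add: comm_pow_left comm_pow_right)
  have "?n (a \<otimes> b \<otimes> inv a \<otimes> inv b) \<le> ?n (a \<otimes> b \<otimes> inv a) + ?n (inv b)"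
    "?n (a \<otimes> b \<otimes> inv a) \<le> ?n (a \<otimes> b) + ?n (inv a)" "?n (a \<otimes> b) \<le> ?n a + ?n b"
    by (intro word_norm_mult[OF S] m_closed inv_closed H_carrier ab)+
  moreover have "?n a \<le> k * ?n x" "?n b \<le> k * ?n y"
    unfolding a_def b_def using assms by (simp_all add: word_norm_pow[OF S])
  moreover have "?n (inv a) \<le> k * ?n (inv x)" "?n (inv b) \<le> k * ?n (inv y)"
    unfolding a_def b_def using assms word_norm_pow[OF S, of "inv x" k] word_norm_pow[OF S, of "inv y" k]
    by (simp_all add: nat_pow_inv)
  ultimately have "?n (a \<otimes> b \<otimes> inv a \<otimes> inv b) \<le> k * ?n x + k * ?n y + k * ?n (inv x) + k * ?n (inv y)"
    by linarith
  then show "?n (comm x y [^] (k * k)) \<le> (?n x + ?n y + ?n (inv x) + ?n (inv y)) * k"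
    unfolding * by (simp add: algebra_simps)
qed

text \<open>Kernel elements commute, so powers of a product split and the constants of the factors
  add. This carries the bound from commutators to the subgroup they generate.\<close>

lemma derived_norm_square:
  assumes S: "generating_set G S" and c: "c \<in> derived G H"
  shows "c \<in> H \<and> \<pi> c = 0 \<and> (\<exists>C. \<forall>k::nat. word_norm G S (c [^] (k * k)) \<le> C * k)"
  using c unfolding derived_def
proof (induction rule: generate.induct)
  case one
  then show ?case by (intro conjI exI[of _ 0]) auto
next
  case (incl h)
  then obtain x y where "x \<in> H" "y \<in> H" "h = comm x y" by (auto simp: comm_def)
  then show ?case using commutator_norm_square[OF S, of x y] by (simp add: \<pi>_comm)
next
  case (inv h)
  then obtain x y where "x \<in> H" "y \<in> H" "h = comm x y" by (auto simp: comm_def)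
  then show ?case using commutator_norm_square[OF S, of y x] by (simp add: \<pi>_comm comm_inv)
next
  case (eng h1 h2)
  then obtain C1 C2 where C: "\<And>k::nat. word_norm G S (h1 [^] (k * k)) \<le> C1 * k"
    "\<And>k::nat. word_norm G S (h2 [^] (k * k)) \<le> C2 * k" by blast
  have h: "h1 \<in> H" "h2 \<in> H" "\<pi> h1 = 0" "\<pi> h2 = 0" using eng by auto
  have "word_norm G S ((h1 \<otimes> h2) [^] (k * k)) \<le> (C1 + C2) * k" for k :: nat
  proof -
    have "(h1 \<otimes> h2) [^] (k * k) = h1 [^] (k * k) \<otimes> h2 [^] (k * k)"
      using h kernel_central[of h1 h2] by (intro pow_mult_distrib) auto
    then have "word_norm G S ((h1 \<otimes> h2) [^] (k * k)) \<le> word_norm G S (h1 [^] (k * k)) + word_norm G S (h2 [^] (k * k))"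
      using word_norm_mult[OF S, of "h1 [^] (k * k)" "h2 [^] (k * k)"] h by simp
    then show ?thesis using C(1)[of k] C(2)[of k] by (simp add: algebra_simps)
  qed
  then show ?case using h by (intro conjI exI[of _ "C1 + C2"] allI) (simp_all add: \<pi>_mult)
qed

text \<open>Some \<open>z [^] j\<close> lies in \<open>[H, H]\<close>, and its
  \<open>q * q\<close>-th power has length at most \<open>C * q\<close>, which is less than
  \<open>q * q\<close> for \<open>q = C + 1\<close>.\<close>

lemma kernel_norm_sublinear:
  assumes S: "generating_set G S" and z: "z \<in> H" "\<pi> z = 0"
  shows "\<exists>k::nat. word_norm G S (z [^] k) < k"
proof -
  obtain j :: nat where j: "j > 0" "z [^] j \<in> derived G H" using kernel_isolated[OF z] by blast
  then obtain C where C: "\<And>k::nat. word_norm G S ((z [^] j) [^] (k * k)) \<le> C * k"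
    using derived_norm_square[OF S j(2)] by blast
  define q where "q = C + 1"
  have "word_norm G S (z [^] (j * (q * q))) \<le> C * q" using C[of q] z by (simp add: nat_pow_pow)
  also have "\<dots> < q * q" by (simp add: q_def)
  also have "\<dots> \<le> j * (q * q)" using j by simp
  finally show ?thesis by blast
qed

text \<open>A stable length of at most 1, in the strong form with a bounded error. The constant may
  depend on \<open>x\<close>, but not on the multiple.\<close>

definition cheap :: "'a set \<Rightarrow> real ^ 'n \<Rightarrow> bool" where
  "cheap S x \<longleftrightarrow> (\<exists>K. \<forall>c::nat. \<exists>g\<in>H. \<pi> g = real c *\<^sub>R x \<and> word_norm G S g \<le> c + K)"

lemma cheap_sum:
  assumes S: "generating_set G S" and "finite X" "\<forall>x\<in>X. cheap S x"
  shows "\<exists>K. \<forall>c :: real ^ 'n \<Rightarrow> nat. \<exists>g\<in>H. \<pi> g = (\<Sum>x\<in>X. real (c x) *\<^sub>R x) \<and> word_norm G S g \<le> (\<Sum>x\<in>X. c x) + K"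
  using assms(2,3)
proof (induction X)
  case empty
  then show ?case by (intro exI[of _ 0] allI bexI[of _ \<one>]) simp_all
next
  case (insert x X)
  have "\<exists>K. \<forall>c :: real ^ 'n \<Rightarrow> nat. \<exists>g\<in>H. \<pi> g = (\<Sum>x\<in>X. real (c x) *\<^sub>R x) \<and> word_norm G S g \<le> (\<Sum>x\<in>X. c x) + K"
    using insert.prems by (intro insert.IH) simp
  then obtain K where K: "\<And>c :: real ^ 'n \<Rightarrow> nat. \<exists>g\<in>H. \<pi> g = (\<Sum>x\<in>X. real (c x) *\<^sub>R x) \<and> word_norm G S g \<le> (\<Sum>x\<in>X. c x) + K"
    by meson
  have "cheap S x" using insert.prems by simp
  then obtain K' where K': "\<And>c::nat. \<exists>g\<in>H. \<pi> g = real c *\<^sub>R x \<and> word_norm G S g \<le> c + K'"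
    unfolding cheap_def by meson
  show ?case
  proof (intro exI[of _ "K + K'"] allI)
    fix c :: "real ^ 'n \<Rightarrow> nat"
    obtain g where g: "g \<in> H" "\<pi> g = (\<Sum>x\<in>X. real (c x) *\<^sub>R x)" "word_norm G S g \<le> (\<Sum>x\<in>X. c x) + K" using K[of c] by blast
    obtain g' where g': "g' \<in> H" "\<pi> g' = real (c x) *\<^sub>R x" "word_norm G S g' \<le> c x + K'" using K'[of "c x"] by blast
    have "word_norm G S (g' \<otimes> g) \<le> word_norm G S g' + word_norm G S g"
      using g g' by (intro word_norm_mult[OF S]) auto
    then show "\<exists>g\<in>H. \<pi> g = (\<Sum>x\<in>insert x X. real (c x) *\<^sub>R x) \<and> word_norm G S g \<le> (\<Sum>x\<in>insert x X. c x) + (K + K')"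
      using g g' insert.hyps by (intro bexI[of _ "g' \<otimes> g"]) (auto simp: \<pi>_mult)
  qed
qed

text \<open>A displacement in the interior of \<open>l P\<close>, where \<open>P\<close> is the convex hull of \<open>X\<close>, is not realised
  efficiently by words of length \<open>l\<close>: a multiple of it has a shorter representative, and the
  central error disappears after passing to a further power.\<close>

lemma shorten_power:
  assumes S: "generating_set G S" and X: "finite X" "\<forall>x\<in>X. cheap S x"
    and g: "g \<in> H" "\<pi> g = (\<Sum>x\<in>X. c x *\<^sub>R x)" "\<And>x. x \<in> X \<Longrightarrow> 0 \<le> c x" "(\<Sum>x\<in>X. c x) < real l"
  shows "\<exists>m>0. word_norm G S (g [^] (m::nat)) < m * l"
proof -
  have Xl: "x \<in> int_lattice D" if "x \<in> X" for x
  proof -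
    have "cheap S x" using X(2) that by blast
    then obtain K where "\<forall>c::nat. \<exists>g\<in>H. \<pi> g = real c *\<^sub>R x \<and> word_norm G S g \<le> c + K"
      unfolding cheap_def by (elim exE)
    then obtain h where "h \<in> H" "\<pi> h = real 1 *\<^sub>R x" by blast
    then show ?thesis using \<pi>_lattice[of h] by simp
  qed
  obtain K where K: "\<And>c :: real ^ 'n \<Rightarrow> nat. \<exists>g\<in>H. \<pi> g = (\<Sum>x\<in>X. real (c x) *\<^sub>R x) \<and> word_norm G S g \<le> (\<Sum>x\<in>X. c x) + K"
    using cheap_sum[OF S X] by meson
  define R where "R = (\<Sum>x\<in>X. norm x)"
  have "finite (lift ` {v \<in> int_lattice D. norm v \<le> R})" by (intro finite_imageI finite_int_lattice_bounded)
  then obtain C where C: "\<forall>h \<in> lift ` {v \<in> int_lattice D. norm v \<le> R}. word_norm G S h \<le> C"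
    by (rule exE[OF word_norm_bounded])
  \<comment> \<open>Each copy of \<open>g\<close> gains \<open>\<epsilon>\<close> letters. The
    number \<open>m\<close> of copies is such that the gain pays for the constant \<open>K\<close>
    of the cheap words, for the rest \<open>r\<close> left by rounding (at most \<open>C\<close>),
    and for one further letter reserved for the central error.\<close>
  define \<epsilon> where "\<epsilon> = real l - (\<Sum>x\<in>X. c x)"
  have \<epsilon>: "\<epsilon> > 0" using g by (simp add: \<epsilon>_def)
  define m where "m = nat \<lceil>(real (K + C) + 1) / \<epsilon>\<rceil>"
  have m\<epsilon>: "real (K + C) + 1 \<le> real m * \<epsilon>"
  proof -
    have "(real (K + C) + 1) / \<epsilon> \<le> real m" unfolding m_def by (rule real_nat_ceiling_ge)
    then show ?thesis using \<epsilon> by (simp only: pos_divide_le_eq)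
  qed
  have m: "m > 0"
  proof (rule ccontr)
    assume "\<not> m > 0" then show False using m\<epsilon> by simp
  qed
  define n where "n x = nat \<lfloor>real m * c x\<rfloor>" for x
  have n: "real (n x) \<le> real m * c x" "real m * c x < real (n x) + 1" if "x \<in> X" for x
  proof -
    have "0 \<le> real m * c x" using g(3)[OF that] by simp
    then show "real (n x) \<le> real m * c x" "real m * c x < real (n x) + 1" unfolding n_def by linarith+
  qed
  obtain h where h: "h \<in> H" "\<pi> h = (\<Sum>x\<in>X. real (n x) *\<^sub>R x)" "word_norm G S h \<le> (\<Sum>x\<in>X. n x) + K"
    using K[of n] by meson
  define r where "r = real m *\<^sub>R \<pi> g - \<pi> h"
  have rl: "r \<in> int_lattice D"
    unfolding r_def using int_lattice_scale[OF \<pi>_lattice[OF g(1)], of "int m"] \<pi>_lattice[OF h(1)]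
    by (intro int_lattice_diff) simp_all
  have "r = (\<Sum>x\<in>X. (real m * c x - real (n x)) *\<^sub>R x)"
    by (simp add: r_def g(2) h(2) scaleR_diff_left sum_subtractf scaleR_right.sum)
  also have "norm \<dots> \<le> R"
    unfolding R_def
  proof (rule sum_norm_le)
    fix x assume "x \<in> X"
    then have "\<bar>real m * c x - real (n x)\<bar> \<le> 1" using n[of x] by auto
    then show "norm ((real m * c x - real (n x)) *\<^sub>R x) \<le> norm x"
      using mult_right_mono[of "\<bar>real m * c x - real (n x)\<bar>" 1 "norm x"] by simp
  qed
  finally have rC: "word_norm G S (lift r) \<le> C" using rl by (intro bspec[OF C]) auto
  define w where "w = h \<otimes> lift r"
  have lr: "lift r \<in> H" "\<pi> (lift r) = r" using lift[OF rl] by auto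
  have w: "w \<in> H" "\<pi> w = real m *\<^sub>R \<pi> g" using h lr by (simp_all add: w_def \<pi>_mult r_def)
  have "(\<Sum>x\<in>X. real (n x)) \<le> (\<Sum>x\<in>X. real m * c x)" using n(1) by (rule sum_mono)
  then have "real (\<Sum>x\<in>X. n x) \<le> real m * (\<Sum>x\<in>X. c x)" by (simp add: sum_distrib_left)
  also have "\<dots> = real m * real l - real m * \<epsilon>" by (simp add: \<epsilon>_def algebra_simps)
  finally have "real ((\<Sum>x\<in>X. n x) + K + C + 1) \<le> real (m * l)" using m\<epsilon> by simp
  then have nm: "(\<Sum>x\<in>X. n x) + K + C + 1 \<le> m * l" by (simp only: of_nat_le_iff)
  have "word_norm G S w \<le> word_norm G S h + word_norm G S (lift r)"
    unfolding w_def using h lr by (intro word_norm_mult[OF S]) auto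
  then have wn: "word_norm G S w + 1 \<le> m * l" using h(3) rC nm by linarith
  \<comment> \<open>The words for \<open>w\<close> and \<open>g [^] m\<close> differ by the kernel
    element \<open>z\<close>. For a suitable \<open>k\<close> the norm of \<open>z [^] k\<close> is
    below \<open>k\<close>, which the \<open>k\<close> reserved letters cover.\<close>
  define z where "z = inv w \<otimes> g [^] m"
  have z: "z \<in> H" "\<pi> z = 0" unfolding z_def using w g(1) by (simp_all add: \<pi>_mult \<pi>_inv \<pi>_pow)
  obtain k :: nat where k: "word_norm G S (z [^] k) < k" using kernel_norm_sublinear[OF S z] by blast
  have "g [^] m = w \<otimes> z" unfolding z_def using w g(1) by (simp add: inv_cancel_left)
  then have "g [^] (m * k) = (w \<otimes> z) [^] k" using g(1) by (simp add: nat_pow_pow[symmetric])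
  also have "\<dots> = w [^] k \<otimes> z [^] k"
    using w z kernel_central[OF z, of w] by (intro pow_mult_distrib) auto
  finally have "word_norm G S (g [^] (m * k)) \<le> word_norm G S (w [^] k) + word_norm G S (z [^] k)"
    using w z word_norm_mult[OF S, of "w [^] k" "z [^] k"] by simp
  also have "\<dots> < k * word_norm G S w + k"
    using k word_norm_pow[OF S, of w k] w by simp
  also have "\<dots> = k * (word_norm G S w + 1)" by simp
  also have "\<dots> \<le> k * (m * l)" using wn by (rule mult_le_mono2)
  finally have "word_norm G S (g [^] (m * k)) < m * k * l" by (simp add: mult.commute mult.left_commute)
  moreover have "m * k > 0" using m k by simp
  ultimately show ?thesis by blast
qed

end

section \<open>Inefficient loops in geodesics\<close>

lemma sum_if_card:
  fixes x :: "nat \<Rightarrow> nat"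
  assumes "\<And>t. 0 < x t \<Longrightarrow> t \<le> n"
  shows "(\<Sum>t\<le>n. if 0 < x t then 1 else 0) = card {t. 0 < x t}"
proof -
  have "{..n} \<inter> {t. 0 < x t} = {t. 0 < x t}" using assms by auto
  then show ?thesis by (simp add: sum.If_cases)
qed

lemma length_filter_insert_words:
  "length (filter P (insert_words y c)) = length (filter P y) + (\<Sum>t\<le>length y. length (filter P (c t)))"
  by (induction y arbitrary: c) (simp_all add: sum.atMost_Suc_shift del: sum.atMost_Suc)

lemma insert_words_Nil [simp]: "insert_words y (\<lambda>_. []) = y"
  by (induction y) (simp_all add: o_def)

text \<open>Since \<open>zero\<close> accepts every word, \<open>r\<close> counts disjoint factors
  that can be found; it need not be maximal.\<close>

inductive disjoint_factors :: "'a list set \<Rightarrow> nat \<Rightarrow> 'a list \<Rightarrow> bool" for U where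
  zero: "disjoint_factors U 0 w"
| skip: "disjoint_factors U r w \<Longrightarrow> disjoint_factors U r (s # w)"
| factor: "u \<in> U \<Longrightarrow> disjoint_factors U r w \<Longrightarrow> disjoint_factors U (Suc r) (u @ w)"

lemma disjoint_factors_append: "disjoint_factors U r w \<Longrightarrow> disjoint_factors U r (x @ w)"
  by (induction x) (auto intro: disjoint_factors.intros)

text \<open>\<open>p\<close> is the entry before the list.\<close>

primrec runs :: "bool \<Rightarrow> bool list \<Rightarrow> nat" where
  "runs p [] = 0"
| "runs p (b # bs) = (if b \<and> \<not> p then 1 else 0) + runs b bs"

lemma runs_flag: "runs True bs \<le> runs p bs" "runs p bs \<le> Suc (runs p' bs)"
  by (induction bs; cases p; cases p'; simp)+

text \<open>A prefix can swallow the first run of \<open>zs\<close> only by ending inside a run.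
  That run is either counted itself, or it continues the one indicated by \<open>p\<close>, and then
  the left side does not count the first run of \<open>zs\<close> either.\<close>

lemma runs_append_ge: "runs p zs \<le> runs p (ys @ zs)"
proof (induction ys arbitrary: p)
  case (Cons b ys)
  show ?case
    using Cons[of b] Cons[of p] runs_flag(1)[of "ys @ zs" False] runs_flag(2)[of False "zs" True] runs_flag(1)[of zs p]
    by (cases b; cases p) (auto intro: order_trans)
qed simp

lemma runs_Cons_le: "runs p (b # zs) \<le> Suc (runs p zs)"
  using runs_flag(1)[of zs p] runs_flag(2)[of False zs p] by (cases b) auto

lemma runs_append_le: "runs p (ys @ zs) \<le> length ys + runs p zs"
proof (induction ys arbitrary: p)
  case (Cons b ys)
  have "runs p ((b # ys) @ zs) \<le> Suc (runs p (ys @ zs))" using runs_Cons_le by simp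
  with Cons[of p] show ?case by simp
qed simp

lemma runs_replicate_le: "runs p (replicate x b @ zs) \<le> (if x > 0 then 1 else 0) + runs p zs"
proof (cases x)
  case (Suc n)
  have "runs b (replicate n b @ zs) = runs b zs" by (induction n) auto
  then show ?thesis using Suc runs_Cons_le[of p b zs] by simp
qed simp

context central_lattice_extension
begin

lemma coset_mult: "g \<in> carrier G \<Longrightarrow> a \<in> carrier G \<Longrightarrow> H #> (g \<otimes> a) = (H #> g) #> a"
  using coset_mult_assoc[OF subgroup.subset[OF H_subgroup]] by simp

lemma coset_loop: "g \<in> carrier G \<Longrightarrow> a \<in> H \<Longrightarrow> H #> (g \<otimes> a) = H #> g"
proof -
  assume g: "g \<in> carrier G" and a: "a \<in> H"
  have "g \<otimes> a = (g \<otimes> a \<otimes> inv g) \<otimes> g" using g a by (simp add: m_assoc)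
  then have "g \<otimes> a \<in> H #> g" using H_conj[OF g a] by (auto simp: r_coset_def)
  then show ?thesis using repr_independence[OF _ g H_subgroup] by simp
qed

text \<open>The base point \<open>g\<close> serves inductions along the word, in which a suffix is a
  path starting where the prefix ended.\<close>

definition inserted :: "'a set \<Rightarrow> 'a list \<Rightarrow> 'a \<Rightarrow> 'a list \<Rightarrow> 'a list \<Rightarrow> (nat \<Rightarrow> nat) \<Rightarrow> bool" where
  "inserted f u g w y m \<longleftrightarrow> w = insert_words y (\<lambda>t. concat (replicate (m t) u)) \<and>
     (\<forall>t\<le>length y. 0 < m t \<longrightarrow> H #> (g \<otimes> word_eval G (take t y)) = f)"

lemma inserted_none: "inserted f u g w w (\<lambda>_. 0)"
  by (simp add: inserted_def)

lemma inserted_cong: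
  assumes "H #> g = H #> g'" "g \<in> carrier G" "g' \<in> carrier G" "set y \<subseteq> carrier G"
  shows "inserted f u g w y m \<longleftrightarrow> inserted f u g' w y m"
proof -
  have "H #> (g \<otimes> word_eval G (take t y)) = H #> (g' \<otimes> word_eval G (take t y))" for t
  proof -
    have "set (take t y) \<subseteq> carrier G" using assms(4) set_take_subset by fast
    then show ?thesis using assms by (simp add: coset_mult)
  qed
  then show ?thesis by (simp add: inserted_def)
qed

lemma inserted_Cons:
  assumes "inserted f u (g \<otimes> s) w y m" "g \<in> carrier G" "s \<in> carrier G" "set y \<subseteq> carrier G"
  shows "inserted f u g (s # w) (s # y) (case_nat 0 m)"
  unfolding inserted_def
proof (intro conjI allI impI)
  show "s # w = insert_words (s # y) (\<lambda>t. concat (replicate (case_nat 0 m t) u))"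
    using assms(1) by (simp add: inserted_def o_def)
  fix t assume t: "t \<le> length (s # y)" "0 < case_nat 0 m t"
  then obtain t' where t': "t = Suc t'" by (cases t) auto
  have "set (take t' y) \<subseteq> carrier G" using assms(4) set_take_subset by fast
  moreover have "H #> (g \<otimes> s \<otimes> word_eval G (take t' y)) = f"
    using assms(1) t t' by (simp add: inserted_def)
  ultimately show "H #> (g \<otimes> word_eval G (take t (s # y))) = f"
    using assms(2,3) t' by (simp add: m_assoc)
qed

lemma inserted_loop:
  assumes "inserted f u g w y m" "H #> g = f" "g \<in> carrier G"
  shows "inserted f u g (u @ w) y (m(0 := Suc (m 0)))"
proof -
  have "u @ insert_words y c = insert_words y (c(0 := u @ c 0))" for c
    by (cases y) (simp_all add: o_def)
  moreover have "(\<lambda>t. concat (replicate ((m(0 := Suc (m 0))) t) u))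
    = (\<lambda>t. concat (replicate (m t) u))(0 := u @ concat (replicate (m 0) u))" by auto
  ultimately show ?thesis using assms by (auto simp: inserted_def)
qed

lemma inserted_append:
  assumes "inserted f u (g \<otimes> word_eval G x) w y m" "g \<in> carrier G" "set x \<subseteq> carrier G" "set y \<subseteq> carrier G"
  shows "\<exists>m'. inserted f u g (x @ w) (x @ y) m' \<and> (\<Sum>t\<le>length (x @ y). m' t) = (\<Sum>t\<le>length y. m t)"
  using assms
proof (induction x arbitrary: g)
  case Nil
  then show ?case by (intro exI[of _ m]) simp
next
  case (Cons s x)
  have "inserted f u (g \<otimes> s \<otimes> word_eval G x) w y m" using Cons.prems by (simp add: m_assoc)
  then obtain m' where m': "inserted f u (g \<otimes> s) (x @ w) (x @ y) m'"
    "(\<Sum>t\<le>length (x @ y). m' t) = (\<Sum>t\<le>length y. m t)"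
    using Cons.IH[of "g \<otimes> s"] Cons.prems by auto
  have "inserted f u g ((s # x) @ w) ((s # x) @ y) (case_nat 0 m')"
    using inserted_Cons[OF m'(1)] Cons.prems by simp
  moreover have "(\<Sum>t\<le>length ((s # x) @ y). case_nat 0 m' t) = (\<Sum>t\<le>length (x @ y). m' t)"
    by (simp add: sum.atMost_Suc_shift del: sum.atMost_Suc)
  ultimately show ?case using m'(2) by (intro exI[of _ "case_nat 0 m'"]) simp
qed

definition loop_set :: "'a set \<Rightarrow> 'a list set \<Rightarrow> bool" where
  "loop_set S U \<longleftrightarrow> finite U \<and> (\<forall>u\<in>U. u \<in> lists S \<and> word_eval G u \<in> H)"

text \<open>Every factor has a type: the loop and the coset where it starts. For each type
  separately, the factors of that type are cut out and the others stay. A loop returns to its coset,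
  so cutting it out does not move the rest of the path to other cosets. The numbers \<open>N\<close>
  by type add up to \<open>r\<close>.\<close>

lemma disjoint_factors_inserted:
  assumes S: "S \<subseteq> carrier G" and U: "loop_set S U"
    and "disjoint_factors U r w" "w \<in> lists S" "g \<in> carrier G"
  shows "\<exists>N. sum N (U \<times> rcosets H) = r \<and>
     (\<forall>u\<in>U. \<forall>f\<in>rcosets H. \<exists>y m. y \<in> lists S \<and> inserted f u g w y m \<and> (\<Sum>t\<le>length y. m t) = N (u, f))"
  using assms(3-5)
proof (induction arbitrary: g rule: disjoint_factors.induct)
  case (zero w)
  then show ?case
    by (intro exI[of _ "\<lambda>_. 0"] conjI ballI exI[of _ w] exI[of _ "\<lambda>_. 0"]) (simp_all add: inserted_none)
next
  case (skip r w s)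
  have s: "s \<in> carrier G" "s \<in> S" "w \<in> lists S" using skip.prems S by auto
  from skip.IH[OF s(3) m_closed[OF skip.prems(2) s(1)]] obtain N where N: "sum N (U \<times> rcosets H) = r"
    "\<forall>u\<in>U. \<forall>f\<in>rcosets H. \<exists>y m. y \<in> lists S \<and> inserted f u (g \<otimes> s) w y m \<and> (\<Sum>t\<le>length y. m t) = N (u, f)"
    by (elim exE conjE)
  have "\<exists>y m. y \<in> lists S \<and> inserted f u g (s # w) y m \<and> (\<Sum>t\<le>length y. m t) = N (u, f)"
    if "u \<in> U" "f \<in> rcosets H" for u f
  proof -
    obtain y m where ym: "y \<in> lists S" "inserted f u (g \<otimes> s) w y m" "(\<Sum>t\<le>length y. m t) = N (u, f)"
      using N(2) \<open>u \<in> U\<close> \<open>f \<in> rcosets H\<close> by meson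
    have "set y \<subseteq> carrier G" using ym(1) S by auto
    then have "inserted f u g (s # w) (s # y) (case_nat 0 m)"
      using ym(2) skip.prems s by (intro inserted_Cons)
    moreover have "(\<Sum>t\<le>length (s # y). case_nat 0 m t) = N (u, f)"
      using ym(3) by (simp add: sum.atMost_Suc_shift del: sum.atMost_Suc)
    moreover have "s # y \<in> lists S" using ym(1) s by simp
    ultimately show ?thesis by meson
  qed
  with N(1) show ?case by (intro exI[of _ N]) simp
next
  case (factor u0 r w)
  have u0: "u0 \<in> lists S" "word_eval G u0 \<in> H" "finite U" using factor.hyps U by (auto simp: loop_set_def)
  have u0c: "set u0 \<subseteq> carrier G" using u0 S by auto
  have w: "w \<in> lists S" using factor.prems by simp
  define f0 where "f0 = H #> g"
  have f0: "f0 \<in> rcosets H" unfolding f0_def using factor.prems subgroup.subset[OF H_subgroup] by (intro rcosetsI)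
  from factor.IH[OF w factor.prems(2)] obtain N where N: "sum N (U \<times> rcosets H) = r"
    "\<forall>u\<in>U. \<forall>f\<in>rcosets H. \<exists>y m. y \<in> lists S \<and> inserted f u g w y m \<and> (\<Sum>t\<le>length y. m t) = N (u, f)"
    by (elim exE conjE)
  define N' where "N' z = N z + (if z = (u0, f0) then 1 else 0)" for z
  have fin: "finite (U \<times> rcosets H)" using u0(3) finite_cosets by simp
  have "sum N' (U \<times> rcosets H) = Suc r" unfolding N'_def sum.distrib sum.delta[OF fin]
    using N(1) f0 factor.hyps by simp
  note sumN' = this
  have "\<exists>y m. y \<in> lists S \<and> inserted f u g (u0 @ w) y m \<and> (\<Sum>t\<le>length y. m t) = N' (u, f)"
    if uf: "u \<in> U" "f \<in> rcosets H" for u f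
  proof -
    obtain y m where ym: "y \<in> lists S" "inserted f u g w y m" "(\<Sum>t\<le>length y. m t) = N (u, f)"
      using N(2) uf by meson
    have y: "set y \<subseteq> carrier G" using ym(1) S by auto
    show ?thesis
    proof (cases "(u, f) = (u0, f0)")
      case True
      then have "inserted f u g (u0 @ w) y (m(0 := Suc (m 0)))"
        using inserted_loop[OF ym(2)] factor.prems by (simp add: f0_def)
      moreover have "(\<Sum>t\<le>length y. (m(0 := Suc (m 0))) t) = (\<Sum>t\<le>length y. m t + (if t = 0 then 1 else 0))"
        by (intro sum.cong) auto
      then have "(\<Sum>t\<le>length y. (m(0 := Suc (m 0))) t) = N' (u, f)"
        using ym(3) True by (simp add: sum.distrib N'_def)
      ultimately show ?thesis using ym(1) by meson
    next
      case False
      have "inserted f u (g \<otimes> word_eval G u0) w y m"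
        using inserted_cong[of g "g \<otimes> word_eval G u0" y f u w m] coset_loop[OF factor.prems(2) u0(2)] factor.prems(2) u0(2) y ym(2)
        by simp
      then obtain m' where m': "inserted f u g (u0 @ w) (u0 @ y) m'" "(\<Sum>t\<le>length (u0 @ y). m' t) = (\<Sum>t\<le>length y. m t)"
        using inserted_append[OF _ factor.prems(2) u0c y] by meson
      moreover have "u0 @ y \<in> lists S" using u0 ym(1) by simp
      moreover have "N' (u, f) = N (u, f)" using False by (simp add: N'_def)
      ultimately show ?thesis using ym(3) by (intro exI[of _ "u0 @ y"] exI[of _ m'] conjI) simp_all
    qed
  qed
  with sumN' show ?case by (intro exI[of _ N']) simp
qed

definition shortens :: "'a set \<Rightarrow> 'a list \<Rightarrow> bool" where
  "shortens S u \<longleftrightarrow> (\<exists>m>0. word_norm G S (word_eval G u [^] (m::nat)) < m * length u)"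

text \<open>Once the copies are gathered at no more than \<open>C\<close> places, geodesic words for
  the powers save a letter for every \<open>k\<close> copies, while the corrections cost a constant.
  Too many copies would contradict the near minimality of \<open>w\<close>. The slack
  \<open>C0\<close> allows an application to words that were lengthened by gathering
  letters.\<close>

lemma inserted_loops_bounded:
  assumes S: "generating_set G S" and u: "u \<in> lists S" "word_eval G u \<in> H" "shortens S u" and f: "f \<in> rcosets H"
  shows "\<exists>R. \<forall>w y m. y \<in> lists S \<longrightarrow> inserted f u \<one> w y m \<longrightarrow> length w \<le> word_norm G S (word_eval G w) + C0
    \<longrightarrow> (\<Sum>t\<le>length y. m t) \<le> R"
proof -
  have SG: "S \<subseteq> carrier G" using S by (rule generating_set_subset)
  obtain k :: nat where k: "k > 0" "word_norm G S (word_eval G u [^] k) < k * length u"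
    using u(3) unfolding shortens_def by (elim exE conjE)
  let ?l = "length u"
  have pw: "word_norm G S (word_eval G u [^] (x::nat)) + x div k \<le> x * ?l" for x
  proof -
    let ?g = "word_eval G u"
    have "?g [^] x = (?g [^] k) [^] (x div k) \<otimes> ?g [^] (x mod k)"
      using u(2) by (simp add: nat_pow_pow nat_pow_mult)
    then have "word_norm G S (?g [^] x) \<le> word_norm G S ((?g [^] k) [^] (x div k)) + word_norm G S (?g [^] (x mod k))"
      using word_norm_mult[OF S, of "(?g [^] k) [^] (x div k)" "?g [^] (x mod k)"] u(2) by simp
    also have "\<dots> \<le> x div k * word_norm G S (?g [^] k) + x mod k * word_norm G S ?g"
      using u(2) by (intro add_mono word_norm_pow[OF S]) auto
    also have "\<dots> \<le> x div k * word_norm G S (?g [^] k) + x mod k * ?l"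
      using word_norm_le[OF u(1)] by (intro add_mono mult_le_mono2) auto
    finally have "word_norm G S (?g [^] x) + x div k \<le> x div k * (word_norm G S (?g [^] k) + 1) + x mod k * ?l" by simp
    also have "\<dots> \<le> x div k * (k * ?l) + x mod k * ?l" using k(2) by (intro add_mono mult_le_mono2) auto
    also have "\<dots> = (x div k * k + x mod k) * ?l" by (simp only: distrib_right mult.assoc)
    finally show ?thesis by simp
  qed
  obtain C where C: "\<forall>y m. y \<in> lists S \<longrightarrow> (\<forall>t\<le>length y. 0 < m t \<longrightarrow> H #> word_eval G (take t y) = f) \<longrightarrow>
    (\<exists>x c. gathers S u C y m x c)"
    by (rule exE[OF gather_loops[OF S u(1,2) f]])
  \<comment> \<open>The number \<open>q\<close> of complete blocks of \<open>k\<close> copies is at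
    most \<open>C * length u + C + C0\<close>; incomplete blocks contribute fewer than
    \<open>k\<close> copies at each of at most \<open>C\<close> places; gathering may lose
    \<open>C\<close> copies.\<close>
  define R where "R = k * (C * ?l + C + C0) + k * C + C"
  have main: "(\<Sum>t\<le>length y. m t) \<le> R"
    if yS: "y \<in> lists S" and ins: "inserted f u \<one> w y m"
      and near: "length w \<le> word_norm G S (word_eval G w) + C0" for w y m
  proof -
    have "set y \<subseteq> carrier G" using yS SG by auto
    then have tk: "set (take t y) \<subseteq> carrier G" for t using set_take_subset by fast
    have over_f: "\<forall>t\<le>length y. 0 < m t \<longrightarrow> H #> word_eval G (take t y) = f"
      using ins tk by (simp add: inserted_def)
    obtain x c where x0: "\<forall>t. 0 < x t \<longrightarrow> t \<le> length y \<and> 0 < m t" and x1: "card {t. 0 < x t} \<le> C"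
      "(\<Sum>t\<le>length y. x t) \<le> (\<Sum>t\<le>length y. m t) + C" "(\<Sum>t\<le>length y. m t) \<le> (\<Sum>t\<le>length y. x t) + C"
      and c0: "\<forall>t. c t \<in> lists S \<and> word_eval G (c t) \<in> H" "(\<Sum>t\<le>length y. length (c t)) \<le> C"
      and ev: "\<forall>v. (\<forall>t\<le>length y. v t \<in> lists S \<and> word_eval G (v t) = word_eval G u [^] (x t :: nat)) \<longrightarrow>
          word_eval G (insert_words y (\<lambda>t. v t @ c t)) = word_eval G (insert_words y (\<lambda>t. concat (replicate (m t) u)))"
      using C[THEN spec, of y, THEN spec, of m, THEN mp, OF yS, THEN mp, OF over_f]
      unfolding gathers_def by (elim exE conjE)
    have x: "\<And>t. 0 < x t \<Longrightarrow> t \<le> length y" using x0 by blast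
    note x = x x1
    have c: "\<And>t. c t \<in> lists S" using c0(1) by blast
    note c = c c0(2)
    define v where "v t = geodesic_word S (word_eval G u [^] x t)" for t
    have v: "v t \<in> lists S" "word_eval G (v t) = word_eval G u [^] x t" "length (v t) = word_norm G S (word_eval G u [^] x t)" for t
      unfolding v_def using u(2) by (intro geodesic_word[OF S]; simp)+
    let ?w = "insert_words y (\<lambda>t. v t @ c t)"
    have "word_eval G ?w = word_eval G w"
      using ev[THEN spec, of v] v ins unfolding inserted_def by simp
    moreover have "?w \<in> lists S" using yS v c by (intro insert_words_in_lists) auto
    ultimately have "word_norm G S (word_eval G w) \<le> length ?w" using word_norm_le[of ?w S] by simp
    also have "\<dots> = length y + (\<Sum>t\<le>length y. length (v t)) + (\<Sum>t\<le>length y. length (c t))"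
      by (simp add: length_insert_words sum.distrib)
    finally have 1: "word_norm G S (word_eval G w) \<le> length y + (\<Sum>t\<le>length y. length (v t)) + C" using c(2) by linarith
    define q where "q = (\<Sum>t\<le>length y. x t div k)"
    have "(\<Sum>t\<le>length y. length (v t) + x t div k) \<le> (\<Sum>t\<le>length y. x t * ?l)"
      using pw by (intro sum_mono) (simp add: v)
    then have 2: "(\<Sum>t\<le>length y. length (v t)) + q \<le> (\<Sum>t\<le>length y. x t) * ?l"
      by (simp add: sum.distrib q_def sum_distrib_right)
    have "length w = length y + (\<Sum>t\<le>length y. m t * ?l)"
      using ins by (simp add: inserted_def length_insert_words length_concat sum_list_replicate)
    then have 3: "length w = length y + (\<Sum>t\<le>length y. m t) * ?l" by (simp add: sum_distrib_right)
    have 4: "(\<Sum>t\<le>length y. x t) * ?l \<le> (\<Sum>t\<le>length y. m t) * ?l + C * ?l"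
      using mult_le_mono1[OF x(3), of ?l] by (simp add: distrib_right)
    have 5: "q \<le> C * ?l + C + C0" using 1 2 3 4 near by linarith
    have "x t \<le> k * (x t div k) + k * (if 0 < x t then 1 else 0)" for t
    proof (cases "x t = 0")
      case False
      have "x t = k * (x t div k) + x t mod k" by simp
      moreover have "x t mod k \<le> k" using k(1) by (simp add: less_imp_le)
      ultimately have "x t \<le> k * (x t div k) + k" by linarith
      then show ?thesis using False by simp
    qed simp
    then have "(\<Sum>t\<le>length y. x t) \<le> (\<Sum>t\<le>length y. k * (x t div k) + k * (if 0 < x t then 1 else 0))"
      by (intro sum_mono)
    also have "\<dots> = k * q + k * (\<Sum>t\<le>length y. if 0 < x t then 1 else 0)"
      by (simp only: sum.distrib sum_distrib_left q_def)
    also have "(\<Sum>t\<le>length y. if 0 < x t then 1 else 0) = card {t. 0 < x t}"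
      by (rule sum_if_card) (rule x(1))
    finally have "(\<Sum>t\<le>length y. x t) \<le> k * q + k * card {t. 0 < x t}" .
    also have "\<dots> \<le> k * (C * ?l + C + C0) + k * C" using 5 x(2) by (intro add_mono mult_le_mono2)
    finally show ?thesis using x(4) by (simp add: R_def)
  qed
  then show "\<exists>R. \<forall>w y m. y \<in> lists S \<longrightarrow> inserted f u \<one> w y m \<longrightarrow> length w \<le> word_norm G S (word_eval G w) + C0
    \<longrightarrow> (\<Sum>t\<le>length y. m t) \<le> R" by (intro exI[of _ R] allI impI)
qed

text \<open>There are finitely many pairs of a loop and a coset, each with its own bound, and the
  bounds are added.\<close>

lemma disjoint_factors_bounded:
  assumes S: "generating_set G S" and U: "loop_set S U" and sh: "\<forall>u\<in>U. shortens S u"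
  shows "\<exists>R. \<forall>w r. w \<in> lists S \<longrightarrow> disjoint_factors U r w \<longrightarrow> length w \<le> word_norm G S (word_eval G w) + C0 \<longrightarrow> r \<le> R"
proof -
  have "\<forall>z\<in>U \<times> rcosets H. \<exists>R. \<forall>w y m. y \<in> lists S \<longrightarrow> inserted (snd z) (fst z) \<one> w y m \<longrightarrow>
     length w \<le> word_norm G S (word_eval G w) + C0 \<longrightarrow> (\<Sum>t\<le>length y. m t) \<le> R"
  proof
    fix z assume "z \<in> U \<times> rcosets H"
    then have z: "fst z \<in> U" "snd z \<in> rcosets H" by (simp_all add: mem_Times_iff)
    have "fst z \<in> lists S \<and> word_eval G (fst z) \<in> H"
      using U z(1) unfolding loop_set_def by (elim conjE) (rule bspec)
    moreover have "shortens S (fst z)" using sh z(1) by (rule bspec)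
    ultimately have "fst z \<in> lists S" "word_eval G (fst z) \<in> H" "shortens S (fst z)" "snd z \<in> rcosets H"
      using z(2) by simp_all
    then show "\<exists>R. \<forall>w y m. y \<in> lists S \<longrightarrow> inserted (snd z) (fst z) \<one> w y m \<longrightarrow>
     length w \<le> word_norm G S (word_eval G w) + C0 \<longrightarrow> (\<Sum>t\<le>length y. m t) \<le> R"
      by (rule inserted_loops_bounded[OF S])
  qed
  then obtain R where R: "\<forall>z\<in>U \<times> rcosets H. \<forall>w y m. y \<in> lists S \<longrightarrow> inserted (snd z) (fst z) \<one> w y m \<longrightarrow>
     length w \<le> word_norm G S (word_eval G w) + C0 \<longrightarrow> (\<Sum>t\<le>length y. m t) \<le> R z"
    by (rule exE[OF bchoice])
  show ?thesis
  proof (intro exI allI impI)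
    fix w r assume w: "w \<in> lists S" "disjoint_factors U r w" "length w \<le> word_norm G S (word_eval G w) + C0"
    obtain N where N: "sum N (U \<times> rcosets H) = r"
      "\<forall>u\<in>U. \<forall>f\<in>rcosets H. \<exists>y m. y \<in> lists S \<and> inserted f u \<one> w y m \<and> (\<Sum>t\<le>length y. m t) = N (u, f)"
      using disjoint_factors_inserted[OF generating_set_subset[OF S] U w(2,1) one_closed] by (elim exE conjE)
    have "N z \<le> R z" if z: "z \<in> U \<times> rcosets H" for z
    proof -
      have z': "fst z \<in> U" "snd z \<in> rcosets H" using z by (simp_all add: mem_Times_iff)
      obtain y m where ym: "y \<in> lists S" "inserted (snd z) (fst z) \<one> w y m" "(\<Sum>t\<le>length y. m t) = N (fst z, snd z)"
        using bspec[OF bspec[OF N(2) z'(1)] z'(2)] by (elim exE conjE)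
      have "(\<Sum>t\<le>length y. m t) \<le> R z"
        using R[THEN bspec, OF z, THEN spec, of w, THEN spec, of y, THEN spec, of m] ym(1,2) w(3) by simp
      then show ?thesis using ym(3) by simp
    qed
    then have "sum N (U \<times> rcosets H) \<le> sum R (U \<times> rcosets H)" by (rule sum_mono)
    then show "r \<le> sum R (U \<times> rcosets H)" using N(1) by simp
  qed
qed

end

section \<open>Gathering letters\<close>

lemma length_remdups_adj_Cons_Cons:
  "length (remdups_adj (s # s' # w)) \<le> length (remdups_adj w) + 2"
  by (cases w) auto

context central_lattice_extension
begin

text \<open>The edge path of a word in the Schreier graph of \<open>H\<close>. A letter over
  different cosets counts as different, because gathering works over one coset at a time.\<close>

primrec edges :: "'a \<Rightarrow> 'a list \<Rightarrow> ('a set \<times> 'a) list" where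
  "edges g [] = []"
| "edges g (s # w) = (H #> g, s) # edges (g \<otimes> s) w"

definition marks :: "('a set \<times> 'a) set \<Rightarrow> 'a \<Rightarrow> 'a list \<Rightarrow> bool list" where
  "marks Q g w = map (\<lambda>e. e \<in> Q) (edges g w)"

lemma marks_simps [simp]: "marks Q g [] = []" "marks Q g (s # w) = ((H #> g, s) \<in> Q) # marks Q (g \<otimes> s) w"
  by (simp_all add: marks_def)

lemma length_marks [simp]: "length (marks Q g w) = length w"
  by (induction w arbitrary: g) simp_all

lemma marks_append:
  "g \<in> carrier G \<Longrightarrow> set v \<subseteq> carrier G \<Longrightarrow> set w \<subseteq> carrier G \<Longrightarrow>
    marks Q g (v @ w) = marks Q g v @ marks Q (g \<otimes> word_eval G v) w"
proof (induction v arbitrary: g)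
  case (Cons s v)
  then show ?case using Cons.IH[of "g \<otimes> s"] by (simp add: m_assoc)
qed simp

lemma marks_cong:
  "H #> g = H #> g' \<Longrightarrow> g \<in> carrier G \<Longrightarrow> g' \<in> carrier G \<Longrightarrow> set w \<subseteq> carrier G \<Longrightarrow> marks Q g w = marks Q g' w"
proof (induction w arbitrary: g g')
  case (Cons s w)
  have "H #> (g \<otimes> s) = H #> (g' \<otimes> s)" using Cons.prems by (simp add: coset_mult)
  then show ?case using Cons.IH[of "g \<otimes> s" "g' \<otimes> s"] Cons.prems by simp
qed simp

lemma marks_loop_append:
  assumes "g \<in> carrier G" "set v \<subseteq> carrier G" "set w \<subseteq> carrier G" "word_eval G v \<in> H"
  shows "marks Q g (v @ w) = marks Q g v @ marks Q g w"
  using assms coset_loop[OF assms(1,4)] marks_cong[of "g \<otimes> word_eval G v" g w Q] by (simp add: marks_append)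

lemma marks_replicate:
  assumes "g \<in> carrier G" "a \<in> H"
  shows "marks Q g (replicate x a) = replicate x ((H #> g, a) \<in> Q)"
proof (induction x)
  case (Suc x)
  have "marks Q (g \<otimes> a) (replicate x a) = marks Q g (replicate x a)"
    using assms coset_loop by (intro marks_cong) auto
  with Suc show ?case by simp
qed simp

text \<open>Deleting loops leaves the cosets of the other letters, and hence their marks, as they
  are; blocks can only merge or disappear.\<close>

lemma runs_marks_insert_ge:
  assumes "g \<in> carrier G" "set y \<subseteq> carrier G" "\<And>t. set (c t) \<subseteq> carrier G" "\<And>t. word_eval G (c t) \<in> H"
  shows "runs p (marks Q g y) \<le> runs p (marks Q g (insert_words y c))"
  using assms
proof (induction y arbitrary: g p c)
  case (Cons s y)
  have c: "\<And>t. set ((c \<circ> Suc) t) \<subseteq> carrier G" "\<And>t. word_eval G ((c \<circ> Suc) t) \<in> H" using Cons.prems by auto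
  have ins: "set (insert_words y (c \<circ> Suc)) \<subseteq> carrier G"
    using insert_words_in_lists[of y "carrier G" "c \<circ> Suc"] Cons.prems by (simp add: lists_eq_set)
  have "runs p (marks Q g (s # y)) \<le> runs p (marks Q g (s # insert_words y (c \<circ> Suc)))"
    using Cons.IH[of "g \<otimes> s" "c \<circ> Suc"] c Cons.prems by (simp add: o_def)
  also have "\<dots> \<le> runs p (marks Q g (c 0) @ marks Q g (s # insert_words y (c \<circ> Suc)))" by (rule runs_append_ge)
  also have "\<dots> = runs p (marks Q g (insert_words (s # y) c))"
    using marks_loop_append[of g "c 0" "s # insert_words y (c \<circ> Suc)" Q] Cons.prems ins by simp
  finally show ?case .
qed simp

text \<open>All letters of an inserted power of \<open>a\<close> lie over the same coset and have
  the same mark, so the power adds at most one run. A correction adds at most one run per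
  letter.\<close>

lemma runs_marks_insert_le:
  assumes "g \<in> carrier G" "set y \<subseteq> carrier G" "a \<in> H" "\<And>t. set (c t) \<subseteq> carrier G" "\<And>t. word_eval G (c t) \<in> H"
  shows "runs p (marks Q g (insert_words y (\<lambda>t. replicate (x t) a @ c t)))
    \<le> runs p (marks Q g y) + (\<Sum>t\<le>length y. (if 0 < x t then 1 else 0) + length (c t))"
  using assms
proof (induction y arbitrary: g p c x)
  case Nil
  have "word_eval G (replicate n a) \<in> H" "set (replicate n a) \<subseteq> carrier G" for n
    using Nil by (induction n) auto
  then have "runs p (marks Q g (replicate (x 0) a @ c 0)) = runs p (replicate (x 0) ((H #> g, a) \<in> Q) @ marks Q g (c 0) @ [])"
    using Nil marks_loop_append[of g "replicate (x 0) a" "c 0" Q] by (simp add: marks_replicate)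
  also have "\<dots> \<le> (if 0 < x 0 then 1 else 0) + runs p (marks Q g (c 0) @ [])" by (rule runs_replicate_le)
  also have "runs p (marks Q g (c 0) @ []) \<le> length (marks Q g (c 0)) + runs p []" by (rule runs_append_le)
  finally show ?case by simp
next
  case (Cons s y)
  let ?d = "\<lambda>t. replicate (x t) a @ c t"
  let ?r = "insert_words y (\<lambda>t. replicate (x (Suc t)) a @ c (Suc t))"
  have ra: "word_eval G (replicate n a) \<in> H" "set (replicate n a) \<subseteq> carrier G" for n
    using Cons.prems by (induction n) auto
  have ins: "set ?r \<subseteq> carrier G"
    using insert_words_in_lists[of y "carrier G" "\<lambda>t. replicate (x (Suc t)) a @ c (Suc t)"] Cons.prems ra(2)
    by (simp add: lists_eq_set)
  have "marks Q g (insert_words (s # y) ?d) = replicate (x 0) ((H #> g, a) \<in> Q) @ marks Q g (c 0) @ marks Q g (s # ?r)"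
    using marks_loop_append[of g "replicate (x 0) a" "c 0 @ s # ?r" Q] marks_loop_append[of g "c 0" "s # ?r" Q]
      Cons.prems ins ra by (simp add: marks_replicate o_def)
  then have "runs p (marks Q g (insert_words (s # y) ?d))
    \<le> (if 0 < x 0 then 1 else 0) + runs p (marks Q g (c 0) @ marks Q g (s # ?r))"
    using runs_replicate_le by simp
  also have "runs p (marks Q g (c 0) @ marks Q g (s # ?r)) \<le> length (c 0) + runs p (marks Q g (s # ?r))"
    using runs_append_le[of p "marks Q g (c 0)" "marks Q g (s # ?r)"] by (simp only: length_marks)
  also have "runs p (marks Q g (s # ?r)) \<le> runs p (marks Q g (s # y))
      + (\<Sum>t\<le>length y. (if 0 < x (Suc t) then 1 else 0) + length (c (Suc t)))"
    using Cons.IH[of "g \<otimes> s" "\<lambda>t. c (Suc t)" _ "\<lambda>t. x (Suc t)"] Cons.prems by simp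
  finally show ?case by (simp add: sum.atMost_Suc_shift del: sum.atMost_Suc)
qed

text \<open>As \<open>a\<close> is a loop, deleting it keeps the cosets of all later letters, so a
  single pass removes every occurrence over \<open>f\<close>.\<close>

lemma remove_letter:
  assumes S: "S \<subseteq> carrier G" and a: "a \<in> H" "a \<in> S" and w: "w \<in> lists S" "g \<in> carrier G"
  shows "\<exists>y m. y \<in> lists S \<and> inserted f [a] g w y m \<and> (f, a) \<notin> set (edges g y)"
  using w
proof (induction w arbitrary: g rule: list.induct)
  case Nil
  then show ?case by (intro exI[of _ "[]"] exI[of _ "\<lambda>_. 0"]) (simp add: inserted_none)
next
  case (Cons s w)
  then have s: "s \<in> S" "s \<in> carrier G" "w \<in> lists S" using S by auto
  show ?case
  proof (cases "s = a \<and> H #> g = f")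
    case True
    obtain y m where "y \<in> lists S" "inserted f [a] g w y m" "(f, a) \<notin> set (edges g y)"
      using Cons.IH[OF s(3) Cons.prems(2)] by (elim exE conjE)
    moreover from this(2) have "inserted f [a] g (s # w) y (m(0 := Suc (m 0)))"
      using True inserted_loop[of f "[a]" g w y m] Cons.prems(2) by simp
    ultimately show ?thesis by meson
  next
    case False
    obtain y m where ym: "y \<in> lists S" "inserted f [a] (g \<otimes> s) w y m" "(f, a) \<notin> set (edges (g \<otimes> s) y)"
      using Cons.IH[OF s(3) m_closed[OF Cons.prems(2) s(2)]] by (elim exE conjE)
    have "set y \<subseteq> carrier G" using ym(1) S by auto
    then show ?thesis using False ym s inserted_Cons[OF ym(2) Cons.prems(2) s(2)]
      by (intro exI[of _ "s # y"] exI[of _ "case_nat 0 m"]) auto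
  qed
qed

text \<open>The pairs of a coset and a letter are gathered one after the other. Each step deletes loops, which
  only merges the blocks gathered before, and makes boundedly many insertions.\<close>

lemma gather_letters:
  assumes S: "generating_set G S" and A: "A \<subseteq> S \<inter> H" and Q: "finite Q" "Q \<subseteq> (rcosets H) \<times> A"
  shows "\<exists>C. \<forall>w\<in>lists S. \<exists>w'\<in>lists S. word_eval G w' = word_eval G w \<and> length w' \<le> length w + C \<and>
    length (filter (\<lambda>s. s \<notin> A) w) \<le> length (filter (\<lambda>s. s \<notin> A) w') \<and> runs False (marks Q \<one> w') \<le> C"
  using Q
proof (induction Q)
  case empty
  have "runs False (marks {} g w) = 0" for g w by (induction w arbitrary: g) simp_all
  then show ?case by (intro exI[of _ 0] ballI) (metis add_0_right order_refl)
next
  case (insert z Q)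
  obtain f a where z: "z = (f, a)" by (cases z)
  have fa: "f \<in> rcosets H" "a \<in> A" "a \<in> S" "a \<in> H" using insert.prems z A by auto
  have SG: "S \<subseteq> carrier G" using S by (rule generating_set_subset)
  obtain C1 where C1: "\<forall>w\<in>lists S. \<exists>w'\<in>lists S. word_eval G w' = word_eval G w \<and> length w' \<le> length w + C1 \<and>
    length (filter (\<lambda>s. s \<notin> A) w) \<le> length (filter (\<lambda>s. s \<notin> A) w') \<and> runs False (marks Q \<one> w') \<le> C1"
    using insert.IH insert.prems by auto
  have aw: "[a] \<in> lists S" "word_eval G [a] \<in> H" using fa by simp_all
  obtain C where C: "\<forall>y m. y \<in> lists S \<longrightarrow> (\<forall>t\<le>length y. 0 < m t \<longrightarrow> H #> word_eval G (take t y) = f) \<longrightarrow>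
    (\<exists>x c. gathers S [a] C y m x c)"
    by (rule exE[OF gather_loops[OF S aw fa(1)]])
  have cr: "concat (replicate n [a]) = replicate n a" for n by (induction n) simp_all
  show ?case
  \<comment> \<open>The length grows by at most \<open>C\<close> through surplus copies and by
    \<open>C\<close> through corrections; the runs grow by at most \<open>C\<close> for the gathered
    powers and by \<open>C\<close> for the letters of the corrections.\<close>
  proof (intro exI[of _ "C1 + 2 * C"] ballI)
    fix w0 assume w0: "w0 \<in> lists S"
    obtain w where wS: "w \<in> lists S" and w: "word_eval G w = word_eval G w0" "length w \<le> length w0 + C1"
      "length (filter (\<lambda>s. s \<notin> A) w0) \<le> length (filter (\<lambda>s. s \<notin> A) w)" "runs False (marks Q \<one> w) \<le> C1"
      using bspec[OF C1 w0] by (elim bexE conjE)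
    obtain y m where y: "y \<in> lists S" "inserted f [a] \<one> w y m" "(f, a) \<notin> set (edges \<one> y)"
      using remove_letter[OF SG fa(4,3) wS one_closed, of f] by (elim exE conjE)
    have yc: "set y \<subseteq> carrier G" using y(1) SG by auto
    then have tk: "set (take t y) \<subseteq> carrier G" for t using set_take_subset by fast
    have over_f: "\<forall>t\<le>length y. 0 < m t \<longrightarrow> H #> word_eval G (take t y) = f"
      using y(2) tk by (simp add: inserted_def)
    have w_eq: "w = insert_words y (\<lambda>t. replicate (m t) a)" using y(2) unfolding inserted_def cr by (elim conjE)
    obtain x c where x0: "\<forall>t. 0 < x t \<longrightarrow> t \<le> length y \<and> 0 < m t" and x: "card {t. 0 < x t} \<le> C"
      "(\<Sum>t\<le>length y. x t) \<le> (\<Sum>t\<le>length y. m t) + C" "(\<Sum>t\<le>length y. m t) \<le> (\<Sum>t\<le>length y. x t) + C"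
      and c: "\<forall>t. c t \<in> lists S \<and> word_eval G (c t) \<in> H" "(\<Sum>t\<le>length y. length (c t)) \<le> C"
      and ev: "\<forall>v. (\<forall>t\<le>length y. v t \<in> lists S \<and> word_eval G (v t) = word_eval G [a] [^] (x t :: nat)) \<longrightarrow>
          word_eval G (insert_words y (\<lambda>t. v t @ c t)) = word_eval G (insert_words y (\<lambda>t. concat (replicate (m t) [a])))"
      using C[THEN spec, of y, THEN spec, of m, THEN mp, OF y(1), THEN mp, OF over_f]
      unfolding gathers_def by (elim exE conjE)
    define v where "v t = replicate (x t) a" for t
    let ?w = "insert_words y (\<lambda>t. v t @ c t)"
    have v: "v t \<in> lists S" "word_eval G (v t) = word_eval G [a] [^] x t" for t
      using fa word_eval_replicate[of "[a]" "x t"] by (auto simp: v_def cr)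
    have ra: "word_eval G (replicate n a) \<in> H" "set (replicate n a) \<subseteq> carrier G" for n
      using fa by (induction n) auto
    have cS: "set (c t) \<subseteq> carrier G" "word_eval G (c t) \<in> H" for t using c(1) SG by auto
    have 1: "word_eval G ?w = word_eval G w0"
      using ev[THEN spec, of v] v w(1) unfolding w_eq cr by simp
    have 2: "?w \<in> lists S" using y(1) v c(1) by (intro insert_words_in_lists) auto
    have "length ?w = length y + (\<Sum>t\<le>length y. x t) + (\<Sum>t\<le>length y. length (c t))"
      by (simp add: length_insert_words v_def sum.distrib)
    moreover have "length w = length y + (\<Sum>t\<le>length y. m t)" unfolding w_eq by (simp add: length_insert_words)
    ultimately have 3: "length ?w \<le> length w0 + (C1 + 2 * C)" using x(2) c(2) w(2) by linarith
    have "length (filter (\<lambda>s. s \<notin> A) w) = length (filter (\<lambda>s. s \<notin> A) y)"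
      unfolding w_eq length_filter_insert_words using fa(2) by simp
    also have "\<dots> \<le> length (filter (\<lambda>s. s \<notin> A) ?w)" unfolding length_filter_insert_words by simp
    finally have 4: "length (filter (\<lambda>s. s \<notin> A) w0) \<le> length (filter (\<lambda>s. s \<notin> A) ?w)" using w(3) by linarith
    \<comment> \<open>The edge \<open>(f, a)\<close> no longer occurs in \<open>y\<close>, so
      marking it has no effect until the powers are inserted again.\<close>
    have "marks (insert z Q) \<one> y = marks Q \<one> y" unfolding marks_def using y(3) z by auto
    then have "runs False (marks (insert z Q) \<one> ?w)
      \<le> runs False (marks Q \<one> y) + (\<Sum>t\<le>length y. (if 0 < x t then 1 else 0) + length (c t))"
      using runs_marks_insert_le[OF one_closed yc fa(4) cS, of False "insert z Q" x] by (simp add: v_def)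
    also have "(\<Sum>t\<le>length y. (if 0 < x t then 1 else 0) + length (c t)) = card {t. 0 < x t} + (\<Sum>t\<le>length y. length (c t))"
      unfolding sum.distrib using x0 by (simp add: sum_if_card)
    also have "runs False (marks Q \<one> y) \<le> runs False (marks Q \<one> w)"
      unfolding w_eq by (rule runs_marks_insert_ge[OF one_closed yc ra(2,1)])
    finally have 5: "runs False (marks (insert z Q) \<one> ?w) \<le> C1 + 2 * C" using x(1) c(2) w(4) by linarith
    show "\<exists>w'\<in>lists S. word_eval G w' = word_eval G w0 \<and> length w' \<le> length w0 + (C1 + 2 * C) \<and>
      length (filter (\<lambda>s. s \<notin> A) w0) \<le> length (filter (\<lambda>s. s \<notin> A) w') \<and> runs False (marks (insert z Q) \<one> w') \<le> C1 + 2 * C"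
      using 1 3 4 5 by (intro bexI[OF _ 2] conjI)
  qed
qed



text \<open>Pigeonhole: with \<open>q = card (rcosets H)\<close>, two of the \<open>q + 1\<close>
  prefixes of length at most \<open>q\<close> end in the same coset, and by normality the factor
  between them evaluates into \<open>H\<close>.\<close>

lemma short_loop_factor:
  assumes w: "set w \<subseteq> carrier G" "card (rcosets H) \<le> length w"
  shows "\<exists>x u z. w = x @ u @ z \<and> u \<noteq> [] \<and> length (x @ u) \<le> card (rcosets H) \<and> word_eval G u \<in> H"
proof -
  let ?q = "card (rcosets H)"
  let ?c = "\<lambda>i. H #> word_eval G (take i w)"
  have tk: "set (take i w) \<subseteq> carrier G" for i using w(1) set_take_subset by fast
  have "?c ` {..?q} \<subseteq> rcosets H"
    using tk subgroup.subset[OF H_subgroup] by (auto intro!: rcosetsI)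
  then have "card (?c ` {..?q}) \<le> ?q" by (rule card_mono[OF finite_cosets])
  then have "\<not> inj_on ?c {..?q}" using card_image[of ?c "{..?q}"] by auto
  then obtain i j where ij: "i < j" "j \<le> ?q" "?c i = ?c j"
    unfolding inj_on_def by (metis atMost_iff linorder_neqE_nat)
  define u where "u = take (j - i) (drop i w)"
  have tj: "take j w = take i w @ u" using ij(1) by (simp add: u_def take_add[symmetric])
  have uc: "set u \<subseteq> carrier G" unfolding u_def using w(1) set_take_subset set_drop_subset by fast
  define g where "g = word_eval G (take i w)"
  have g: "g \<in> carrier G" using tk by (simp add: g_def)
  have e: "word_eval G u \<in> carrier G" using uc by simp
  have "g \<otimes> word_eval G u \<in> H #> g"
  proof -
    have "word_eval G (take j w) = g \<otimes> word_eval G u" unfolding tj g_def using tk uc by simp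
    then show ?thesis using ij(3) rcos_self[OF _ H_subgroup, of "g \<otimes> word_eval G u"] g e by (simp add: g_def)
  qed
  then obtain h where h: "h \<in> H" "g \<otimes> word_eval G u = h \<otimes> g" by (auto simp: r_coset_def)
  then have "word_eval G u = inv g \<otimes> h \<otimes> g" using g e by (simp add: m_assoc inv_solve_left)
  then have "word_eval G u \<in> H" using H_conj'[OF g h(1)] by simp
  moreover have "w = take i w @ u @ drop j w" using tj by (metis append.assoc append_take_drop_id)
  moreover have "u \<noteq> []" using ij w(2) by (simp add: u_def)
  moreover have "length (take i w @ u) \<le> ?q" unfolding tj[symmetric] using ij(2) by simp
  ultimately show ?thesis by blast
qed

definition short_loops :: "'a set \<Rightarrow> 'a list set" where
  "short_loops T = {u \<in> lists T. u \<noteq> [] \<and> length u \<le> card (rcosets H) \<and> word_eval G u \<in> H}"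

lemma loop_set_short_loops:
  assumes "finite T" "T \<subseteq> S"
  shows "loop_set S (short_loops T)"
proof -
  have "short_loops T \<subseteq> {u. set u \<subseteq> T \<and> length u \<le> card (rcosets H)}" by (auto simp: short_loops_def)
  then have "finite (short_loops T)" using finite_lists_length_le[OF assms(1)] finite_subset by blast
  then show ?thesis using assms(2) by (auto simp: loop_set_def short_loops_def)
qed

text \<open>Read from the left. If the first \<open>q\<close> letters avoid \<open>A\<close>, they
  contain a short loop, and the word is cut behind it; otherwise fewer than \<open>q\<close> letters
  precede a block of letters from \<open>A\<close>, and the cut is made behind that block. Each cut
  passes at most \<open>q\<close> letters outside \<open>A\<close> and is paid for by a factor or by
  a run; the \<open>+ 1\<close> covers the tail.\<close>

lemma many_short_loops:
  assumes S: "S \<subseteq> carrier G" and w: "w \<in> lists S"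
  shows "\<exists>r. disjoint_factors (short_loops (S - A)) r w \<and>
    length (filter (\<lambda>s. s \<notin> A) w) \<le> card (rcosets H) * (r + runs False (map (\<lambda>s. s \<in> A) w) + 1)"
  using w
proof (induction "length w" arbitrary: w rule: less_induct)
  case less
  let ?q = "card (rcosets H)" and ?T = "\<lambda>w. length (filter (\<lambda>s. s \<notin> A) w)" and ?m = "map (\<lambda>s. s \<in> A)"
  have wS: "set w \<subseteq> S" using less.prems by auto
  show ?case
  proof (cases "?q \<le> length w \<and> set (take ?q w) \<inter> A = {}")
    case True
    obtain x u z where xuz: "w = x @ u @ z" "u \<noteq> []" "length (x @ u) \<le> ?q" "word_eval G u \<in> H"
      using short_loop_factor[of w] wS S True by blast
    have "x @ u = take (length (x @ u)) (take ?q w)" using xuz(1,3) by (simp add: min_def)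
    then have "set (x @ u) \<subseteq> set (take ?q w)" by (metis set_take_subset)
    then have "set u \<subseteq> S - A" using True wS xuz(1) by auto
    then have u: "u \<in> short_loops (S - A)" using xuz by (auto simp: short_loops_def)
    have "length z < length w" "z \<in> lists S" using xuz(1,2) less.prems by auto
    from less.hyps[OF this] obtain r where r: "disjoint_factors (short_loops (S - A)) r z"
      "?T z \<le> ?q * (r + runs False (?m z) + 1)" by (elim exE conjE)
    have "disjoint_factors (short_loops (S - A)) (Suc r) w"
      unfolding xuz(1) by (intro disjoint_factors_append disjoint_factors.factor u r(1))
    moreover have "?T (x @ u) \<le> ?q" using xuz(3) length_filter_le[of _ "x @ u"] order_trans by blast
    then have "?T w \<le> ?q + ?T z" by (simp add: xuz(1))
    moreover have "runs False (?m z) \<le> runs False (?m w)"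
      using runs_append_ge[of False "?m z" "?m (x @ u)"] by (simp add: xuz(1))
    then have "?q * (r + runs False (?m z) + 1) \<le> ?q * (r + runs False (?m w) + 1)" by (intro mult_le_mono2) simp
    moreover have "?q * (Suc r + runs False (?m w) + 1) = ?q + ?q * (r + runs False (?m w) + 1)" by simp
    ultimately have "disjoint_factors (short_loops (S - A)) (Suc r) w \<and> ?T w \<le> ?q * (Suc r + runs False (?m w) + 1)"
      using r(2) by linarith
    then show ?thesis by (rule exI)
  next
    case False
    define x where "x = takeWhile (\<lambda>s. s \<notin> A) w"
    define v where "v = dropWhile (\<lambda>s. s \<notin> A) w"
    have xv: "w = x @ v" by (simp add: x_def v_def)
    have xA: "set x \<inter> A = {}" using set_takeWhileD by (fastforce simp: x_def)
    have Tx: "?T x = length x" using xA by (intro arg_cong[where f = length] filter_True) auto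
    have lx: "length x < ?q"
    proof (rule ccontr)
      assume "\<not> length x < ?q"
      then have "take ?q w = take ?q x" "?q \<le> length w" by (simp_all add: xv)
      then show False using False xA set_take_subset[of ?q x] by auto
    qed
    show ?thesis
    proof (cases v)
      case Nil
      then show ?thesis using Tx lx xv by (intro exI[of _ 0]) (simp add: disjoint_factors.zero trans_le_add2)
    next
      case (Cons s v')
      have sA: "s \<in> A" using Cons hd_dropWhile[of "\<lambda>s. s \<notin> A" w] by (simp add: v_def[symmetric])
      define b where "b = takeWhile (\<lambda>s. s \<in> A) v"
      define z where "z = dropWhile (\<lambda>s. s \<in> A) v"
      have bz: "v = b @ z" by (simp add: b_def z_def)
      have b: "b \<noteq> []" "set b \<subseteq> A" using sA Cons set_takeWhileD by (fastforce simp: b_def)+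
      have z: "z = [] \<or> hd z \<notin> A" using hd_dropWhile[of "\<lambda>s. s \<in> A" v] by (auto simp: z_def)
      have "length z < length w" "z \<in> lists S" using b(1) bz xv less.prems by auto
      from less.hyps[OF this] obtain r where r: "disjoint_factors (short_loops (S - A)) r z"
        "?T z \<le> ?q * (r + runs False (?m z) + 1)" by (elim exE conjE)
      have "disjoint_factors (short_loops (S - A)) r w"
        unfolding xv bz by (intro disjoint_factors_append r(1))
      moreover have "filter (\<lambda>s. s \<notin> A) b = []" using b(2) by (auto simp: filter_empty_conv)
      then have "?T w \<le> ?q + ?T z" using Tx lx by (simp add: xv bz)
      moreover have "runs False (?m w) = Suc (runs False (?m z))"
      proof -
        have 1: "runs False (?m x @ bs) = runs False bs" for bs using xA by (induction x) auto
        have 2: "runs True (?m b' @ bs) = runs True bs" if "set b' \<subseteq> A" for b' bs using that by (induction b') auto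
        have "runs False (?m w) = runs False (?m b @ ?m z)" unfolding xv bz using 1 by simp
        also have "\<dots> = Suc (runs True (?m z))" using b 2[of "tl b"] by (cases b) auto
        also have "runs True (?m z) = runs False (?m z)" using z by (cases z) auto
        finally show ?thesis .
      qed
      ultimately show ?thesis using r(2) by (intro exI[of _ r]) (auto simp: algebra_simps)
    qed
  qed
qed

lemma marks_all: "g \<in> carrier G \<Longrightarrow> set w \<subseteq> carrier G \<Longrightarrow> marks ((rcosets H) \<times> A) g w = map (\<lambda>s. s \<in> A) w"
proof (induction w arbitrary: g)
  case (Cons s w)
  have "H #> g \<in> rcosets H" using Cons.prems subgroup.subset[OF H_subgroup] by (intro rcosetsI)
  then show ?case using Cons by simp
qed simp

text \<open>Gathering leaves boundedly many runs of letters from \<open>A\<close> and loses none of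
  the other letters. If these were numerous, the gathered word would contain many disjoint short
  loops outside \<open>A\<close>, although it exceeds a geodesic by at most \<open>C\<close>
  letters.\<close>

lemma few_other_letters:
  assumes S: "generating_set G S" and A: "A \<subseteq> S \<inter> H"
    and sh: "\<forall>u\<in>short_loops (S - A). shortens S u"
  shows "\<exists>K. \<forall>w. geodesic G S w \<longrightarrow> length (filter (\<lambda>s. s \<notin> A) w) \<le> K"
proof -
  have SG: "S \<subseteq> carrier G" and finS: "finite S" using S by (auto simp: generating_set_def)
  have "finite A" using A finS finite_subset by blast
  then have "finite ((rcosets H) \<times> A)" using finite_cosets by simp
  from gather_letters[OF S A this order_refl]
  obtain C where C: "\<forall>w\<in>lists S. \<exists>w'\<in>lists S. word_eval G w' = word_eval G w \<and> length w' \<le> length w + C \<and>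
    length (filter (\<lambda>s. s \<notin> A) w) \<le> length (filter (\<lambda>s. s \<notin> A) w') \<and> runs False (marks ((rcosets H) \<times> A) \<one> w') \<le> C"
    by (elim exE)
  have "loop_set S (short_loops (S - A))" using finS by (intro loop_set_short_loops) auto
  from disjoint_factors_bounded[OF S this sh, of C]
  obtain R where R: "\<forall>w r. w \<in> lists S \<longrightarrow> disjoint_factors (short_loops (S - A)) r w \<longrightarrow>
    length w \<le> word_norm G S (word_eval G w) + C \<longrightarrow> r \<le> R" by (elim exE)
  let ?q = "card (rcosets H)"
  show ?thesis
  proof (intro exI[of _ "?q * (R + C + 1)"] allI impI)
    fix w assume "geodesic G S w"
    then have w: "w \<in> lists S" "length w = word_norm G S (word_eval G w)" by (simp_all add: geodesic_def)
    obtain w' where w': "w' \<in> lists S" "word_eval G w' = word_eval G w" "length w' \<le> length w + C"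
      "length (filter (\<lambda>s. s \<notin> A) w) \<le> length (filter (\<lambda>s. s \<notin> A) w')" "runs False (marks ((rcosets H) \<times> A) \<one> w') \<le> C"
      using bspec[OF C w(1)] by (elim bexE conjE)
    obtain r where r: "disjoint_factors (short_loops (S - A)) r w'"
      "length (filter (\<lambda>s. s \<notin> A) w') \<le> ?q * (r + runs False (map (\<lambda>s. s \<in> A) w') + 1)"
      using many_short_loops[OF SG w'(1), of A] by (elim exE conjE)
    have "r \<le> R" using R w'(1,2,3) r(1) w(2) by simp
    moreover have "runs False (map (\<lambda>s. s \<in> A) w') \<le> C"
      using w'(1,5) SG marks_all[of \<one> w' A] by (metis in_lists_conv_set one_closed subset_iff)
    ultimately have "?q * (r + runs False (map (\<lambda>s. s \<in> A) w') + 1) \<le> ?q * (R + C + 1)"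
      by (intro mult_le_mono2) simp
    then show "length (filter (\<lambda>s. s \<notin> A) w) \<le> ?q * (R + C + 1)" using r(2) w'(4) by linarith
  qed
qed

text \<open>Two unequal neighbours at the front add at most two to the number of blocks. Either one
  of them is outside \<open>A\<close>, or they form a factor counted by \<open>r\<close>.\<close>

lemma switches_bound:
  "\<exists>r. disjoint_factors {[a, b] | a b. a \<in> A \<and> b \<in> A \<and> a \<noteq> b} r w \<and>
    length (remdups_adj w) \<le> 1 + 2 * length (filter (\<lambda>s. s \<notin> A) w) + 2 * r"
proof (induction "length w" arbitrary: w rule: less_induct)
  case less
  let ?U = "{[a, b] | a b. a \<in> A \<and> b \<in> A \<and> a \<noteq> b}"
  consider "w = []" | s where "w = [s]" | s w' where "w = s # s # w'" | s s' w' where "w = s # s' # w'" "s \<noteq> s'"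
    by (metis list.exhaust)
  then show ?case
  proof cases
    case (3 s w')
    obtain r where "disjoint_factors ?U r (s # w')"
      "length (remdups_adj (s # w')) \<le> 1 + 2 * length (filter (\<lambda>s. s \<notin> A) (s # w')) + 2 * r"
      using less.hyps[of "s # w'"] 3 by auto
    then show ?thesis unfolding 3 by (intro exI[of _ r]) (auto intro: disjoint_factors.skip)
  next
    case (4 s s' w')
    obtain r where r: "disjoint_factors ?U r w'"
      "length (remdups_adj w') \<le> 1 + 2 * length (filter (\<lambda>s. s \<notin> A) w') + 2 * r"
      using less.hyps[of w'] 4 by auto
    have l: "length (remdups_adj w) \<le> length (remdups_adj w') + 2"
      unfolding 4(1) by (rule length_remdups_adj_Cons_Cons)
    show ?thesis
    proof (cases "s \<in> A \<and> s' \<in> A")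
      case True
      then have "disjoint_factors ?U (Suc r) ([s, s'] @ w')" using 4(2) r(1) by (intro disjoint_factors.factor) auto
      then show ?thesis using l r(2) True by (intro exI[of _ "Suc r"]) (simp add: 4(1))
    next
      case False
      have "disjoint_factors ?U r w" unfolding 4(1) by (intro disjoint_factors.skip r(1))
      then show ?thesis using l r(2) False by (intro exI[of _ r]) (auto simp: 4(1))
    qed
  qed (auto intro: disjoint_factors.zero exI[of _ 0])
qed

end

section \<open>Generating sets of polynomial geodesic growth\<close>

definition expand :: "('a \<times> nat) list \<Rightarrow> 'a list" where
  "expand L = concat (map (\<lambda>(s, k). replicate k s) L)"

text \<open>The clause on the first letter serves the induction: it tells whether a new letter joins
  the first block.\<close>

lemma run_length_encoding:
  "\<exists>L. expand L = w \<and> set L \<subseteq> set w \<times> {..length w} \<and> length L = length (remdups_adj w) \<and>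
     (w \<noteq> [] \<longrightarrow> fst (hd L) = hd w)"
proof (induction w)
  case Nil
  show ?case by (intro exI[of _ "[]"]) (simp add: expand_def)
next
  case (Cons s w)
  obtain L where L: "expand L = w" "set L \<subseteq> set w \<times> {..length w}" "length L = length (remdups_adj w)"
    "w \<noteq> [] \<longrightarrow> fst (hd L) = hd w" using Cons.IH by (elim exE conjE)
  show ?case
  proof (cases w)
    case Nil
    then show ?thesis by (intro exI[of _ "[(s, 1)]"]) (simp add: expand_def)
  next
    case w: (Cons s' w')
    have "L \<noteq> []" using L(1) w by (auto simp: expand_def)
    then obtain k L' where Lk: "L = (s', k) # L'" using L(4) w by (cases L) auto
    show ?thesis
    proof (cases "s = s'")
      case True
      have "expand ((s, Suc k) # L') = s # w" using L(1) Lk True by (simp add: expand_def)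
      moreover have "set ((s, Suc k) # L') \<subseteq> set (s # w) \<times> {..length (s # w)}"
        using L(2) Lk by auto
      ultimately show ?thesis using L(3) Lk True w by (intro exI[of _ "(s, Suc k) # L'"]) simp
    next
      case False
      have "expand ((s, 1) # L) = s # w" using L(1) by (simp add: expand_def)
      moreover have "set ((s, 1) # L) \<subseteq> set (s # w) \<times> {..length (s # w)}"
        using L(2) by auto
      ultimately show ?thesis using L(3) False w by (intro exI[of _ "(s, 1) # L"]) simp
    qed
  qed
qed

text \<open>A geodesic with at most \<open>B\<close> blocks is given by at most \<open>B\<close>
  pairs of a letter and an exponent between \<open>0\<close> and \<open>n\<close>. There are
  \<open>c * (n + 1)\<close> such pairs, a number that \<open>[:real c, real c:]\<close> expresses
  as a polynomial in \<open>n\<close>.\<close>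

lemma (in group) polynomial_growth_if_few_runs:
  assumes S: "generating_set G S" and B: "\<And>w. geodesic G S w \<Longrightarrow> length (remdups_adj w) \<le> B"
  shows "polynomial_geodesic_growth G S"
proof -
  define c where "c = card S"
  define p :: "real poly" where "p = (\<Sum>i\<le>B. [:real c, real c:] ^ i)"
  have finS: "finite S" using S by (simp add: generating_set_def)
  have "real (geodesic_growth G S n) \<le> poly p (real n)" for n
  proof -
    let ?L = "{L. set L \<subseteq> S \<times> {..n} \<and> length L \<le> B}"
    have fin: "finite (S \<times> {..n})" using finS by simp
    have "{w. geodesic G S w \<and> length w \<le> n} \<subseteq> expand ` ?L"
    proof
      fix w assume w: "w \<in> {w. geodesic G S w \<and> length w \<le> n}"
      then have wS: "set w \<subseteq> S" "length w \<le> n" "length (remdups_adj w) \<le> B"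
        using B by (auto simp: geodesic_def)
      obtain L where L: "expand L = w" "set L \<subseteq> set w \<times> {..length w}" "length L = length (remdups_adj w)"
        using run_length_encoding[of w] by (elim exE conjE)
      have "set w \<times> {..length w} \<subseteq> S \<times> {..n}" using wS(1,2) by auto
      then have "L \<in> ?L" using L(2,3) wS(3) by auto
      then show "w \<in> expand ` ?L" using L(1) by blast
    qed
    then have "geodesic_growth G S n \<le> card (expand ` ?L)"
      unfolding geodesic_growth_def using finite_lists_length_le[OF fin] by (intro card_mono finite_imageI)
    also have "\<dots> \<le> card ?L" by (rule card_image_le[OF finite_lists_length_le[OF fin]])
    also have "\<dots> = (\<Sum>i\<le>B. (c * Suc n) ^ i)"
      unfolding card_lists_length_le[OF fin] by (simp add: c_def card_cartesian_product)
    finally have "real (geodesic_growth G S n) \<le> real (\<Sum>i\<le>B. (c * Suc n) ^ i)" by (simp only: of_nat_le_iff)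
    also have "\<dots> = poly p (real n)" by (simp add: p_def poly_sum algebra_simps)
    finally show ?thesis .
  qed
  then show ?thesis unfolding polynomial_geodesic_growth_def by blast
qed

context central_lattice_extension
begin

section \<open>The conjugation action on the lattice\<close>

lemma additive_derived:
  fixes \<psi> :: "'a \<Rightarrow> real ^ 'n"
  assumes add: "\<And>x y. x \<in> H \<Longrightarrow> y \<in> H \<Longrightarrow> \<psi> (x \<otimes> y) = \<psi> x + \<psi> y" and c: "c \<in> derived G H"
  shows "c \<in> H \<and> \<psi> c = 0"
proof -
  have one: "\<psi> \<one> = 0" using add[of \<one> \<one>] by simp
  have inv: "\<psi> (inv x) = - \<psi> x" if "x \<in> H" for x
    using add[of x "inv x"] that one by (simp add: eq_neg_iff_add_eq_0 add.commute)
  show ?thesis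
    using c unfolding derived_def
  proof (induction rule: generate.induct)
    case (incl h)
    then obtain x y where "x \<in> H" "y \<in> H" "h = x \<otimes> y \<otimes> inv x \<otimes> inv y" by auto
    then show ?case by (simp add: add inv)
  next
    case (inv h)
    then obtain x y where xy: "x \<in> H" "y \<in> H" "h = x \<otimes> y \<otimes> inv x \<otimes> inv y" by auto
    then have "h \<in> H" by simp
    then show ?case using xy \<open>\<And>x. x \<in> H \<Longrightarrow> \<psi> (inv x) = - \<psi> x\<close> by (simp add: add)
  qed (simp_all add: one add)
qed

text \<open>Conjugation followed by \<open>\<pi>\<close> is additive, hence zero on
  \<open>[H, H]\<close>; as its target is torsion-free, it is zero on every element with a power
  there. This makes the action on the lattice well defined.\<close>

lemma kernel_conj:
  assumes z: "z \<in> H" "\<pi> z = 0" and g: "g \<in> carrier G"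
  shows "\<pi> (g \<otimes> z \<otimes> inv g) = 0"
proof -
  let ?\<psi> = "\<lambda>h. \<pi> (g \<otimes> h \<otimes> inv g)"
  have add: "?\<psi> (x \<otimes> y) = ?\<psi> x + ?\<psi> y" if "x \<in> H" "y \<in> H" for x y
  proof -
    have "g \<otimes> (x \<otimes> y) \<otimes> inv g = (g \<otimes> x \<otimes> inv g) \<otimes> (g \<otimes> y \<otimes> inv g)"
      using that g by (simp add: m_assoc inv_cancel_left)
    then show ?thesis using that g by (simp add: \<pi>_mult H_conj)
  qed
  have pow: "?\<psi> (z [^] j) = real j *\<^sub>R ?\<psi> z" for j :: nat
  proof (induction j)
    case 0
    then show ?case using g by simp
  next
    case (Suc j)
    then show ?case using add[of "z [^] j" z] z by (simp add: algebra_simps)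
  qed
  obtain j :: nat where j: "j > 0" "z [^] j \<in> derived G H" using kernel_isolated[OF z] by blast
  have "?\<psi> (z [^] j) = 0" using additive_derived[OF add j(2)] by simp
  then show ?thesis using pow[of j] j(1) by simp
qed

definition conj_vec :: "'a \<Rightarrow> real ^ 'n \<Rightarrow> real ^ 'n" where
  "conj_vec g v = \<pi> (g \<otimes> lift v \<otimes> inv g)"

lemma conj_vec_\<pi>:
  assumes h: "h \<in> H" and g: "g \<in> carrier G"
  shows "conj_vec g (\<pi> h) = \<pi> (g \<otimes> h \<otimes> inv g)"
proof -
  define l where "l = lift (\<pi> h)"
  have l: "l \<in> H" "\<pi> l = \<pi> h" using lift[OF \<pi>_lattice[OF h]] by (auto simp: l_def)
  have z: "inv h \<otimes> l \<in> H" "\<pi> (inv h \<otimes> l) = 0" using l h by (simp_all add: \<pi>_mult \<pi>_inv)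
  have "g \<otimes> l \<otimes> inv g = (g \<otimes> h \<otimes> inv g) \<otimes> (g \<otimes> (inv h \<otimes> l) \<otimes> inv g)"
    using g h l by (simp add: m_assoc inv_cancel_left)
  then show ?thesis
    unfolding conj_vec_def l_def[symmetric] using kernel_conj[OF z g] g h z by (simp add: \<pi>_mult H_conj)
qed

lemma conj_vec_lattice: "g \<in> carrier G \<Longrightarrow> v \<in> int_lattice D \<Longrightarrow> conj_vec g v \<in> int_lattice D"
  using lift[of v] by (auto simp: conj_vec_def intro: \<pi>_lattice H_conj)

lemma conj_vec_add:
  assumes g: "g \<in> carrier G" and v: "v \<in> int_lattice D" "w \<in> int_lattice D"
  shows "conj_vec g (v + w) = conj_vec g v + conj_vec g w"
proof -
  define h k where "h = lift v" and "k = lift w"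
  have hk: "h \<in> H" "k \<in> H" "\<pi> h = v" "\<pi> k = w" using lift v by (auto simp: h_def k_def)
  have "g \<otimes> (h \<otimes> k) \<otimes> inv g = (g \<otimes> h \<otimes> inv g) \<otimes> (g \<otimes> k \<otimes> inv g)"
    using g hk by (simp add: m_assoc inv_cancel_left)
  then have "conj_vec g (\<pi> (h \<otimes> k)) = conj_vec g (\<pi> h) + conj_vec g (\<pi> k)"
    using g hk(1,2) by (simp only: conj_vec_\<pi> H_closed) (simp add: \<pi>_mult H_conj)
  then show ?thesis using hk by (simp add: \<pi>_mult)
qed

lemma conj_vec_0: "g \<in> carrier G \<Longrightarrow> conj_vec g 0 = 0"
  using conj_vec_\<pi>[of \<one> g] by simp

lemma conj_vec_scale_nat:
  assumes g: "g \<in> carrier G" and v: "v \<in> int_lattice D"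
  shows "conj_vec g (real n *\<^sub>R v) = real n *\<^sub>R conj_vec g v"
proof (induction n)
  case 0
  then show ?case using g by (simp add: conj_vec_0)
next
  case (Suc n)
  have "conj_vec g (real n *\<^sub>R v + v) = conj_vec g (real n *\<^sub>R v) + conj_vec g v"
    using int_lattice_scale[OF v, of "int n"] by (intro conj_vec_add g v) simp
  then show ?case using Suc by (simp add: algebra_simps)
qed

lemma conj_vec_diff:
  assumes g: "g \<in> carrier G" and v: "v \<in> int_lattice D" "w \<in> int_lattice D"
  shows "conj_vec g (v - w) = conj_vec g v - conj_vec g w"
  using conj_vec_add[OF g int_lattice_diff[OF v] v(2)] by simp

lemma conj_vec_sum:
  assumes g: "g \<in> carrier G" and X: "finite X" "X \<subseteq> int_lattice D"
  shows "conj_vec g (\<Sum>X) = (\<Sum>x\<in>X. conj_vec g x)"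
  using X
proof (induction X)
  case empty
  then show ?case using g by (simp add: conj_vec_0)
next
  case (insert x X)
  have "\<Sum>X \<in> int_lattice D" using insert.prems by (intro int_lattice_sum) auto
  then show ?case using insert g conj_vec_add[OF g, of x "\<Sum>X"] by simp
qed

lemma conj_vec_mult:
  assumes g: "g \<in> carrier G" "g' \<in> carrier G" and v: "v \<in> int_lattice D"
  shows "conj_vec g (conj_vec g' v) = conj_vec (g \<otimes> g') v"
proof -
  define h where "h = lift v"
  have h: "h \<in> H" "\<pi> h = v" using lift v by (auto simp: h_def)
  have "conj_vec g (conj_vec g' (\<pi> h)) = \<pi> (g \<otimes> (g' \<otimes> h \<otimes> inv g') \<otimes> inv g)"
    using g h(1) by (simp add: conj_vec_\<pi> H_conj)
  also have "g \<otimes> (g' \<otimes> h \<otimes> inv g') \<otimes> inv g = (g \<otimes> g') \<otimes> h \<otimes> inv (g \<otimes> g')"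
    using g h(1) by (simp add: m_assoc inv_mult_group)
  also have "\<pi> \<dots> = conj_vec (g \<otimes> g') (\<pi> h)" using g h(1) by (simp add: conj_vec_\<pi>)
  finally show ?thesis using h by simp
qed

lemma conj_vec_one: "v \<in> int_lattice D \<Longrightarrow> conj_vec \<one> v = v"
  using lift[of v] by (simp add: conj_vec_def)

definition conj_orbits :: "(real ^ 'n) set \<Rightarrow> (real ^ 'n) set" where
  "conj_orbits A = {conj_vec g a | g a. g \<in> carrier G \<and> a \<in> A}"

lemma conj_orbitsI: "g \<in> carrier G \<Longrightarrow> a \<in> A \<Longrightarrow> conj_vec g a \<in> conj_orbits A"
  unfolding conj_orbits_def by blast

lemma conj_orbits_superset:
  assumes "A \<subseteq> int_lattice D"
  shows "A \<subseteq> conj_orbits A"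
proof
  fix a assume "a \<in> A"
  then show "a \<in> conj_orbits A" using conj_orbitsI[of \<one> a A] conj_vec_one[of a] assms by (simp add: subset_iff)
qed

lemma conj_orbits_lattice: "A \<subseteq> int_lattice D \<Longrightarrow> conj_orbits A \<subseteq> int_lattice D"
  unfolding conj_orbits_def using conj_vec_lattice by blast

lemma conj_vec_loop:
  assumes "h \<in> H" "g \<in> carrier G" "v \<in> int_lattice D"
  shows "conj_vec (h \<otimes> g) v = conj_vec g v"
proof -
  define k where "k = lift v"
  have k: "k \<in> H" using lift assms(3) by (auto simp: k_def)
  have "(h \<otimes> g) \<otimes> k \<otimes> inv (h \<otimes> g) = h \<otimes> (g \<otimes> k \<otimes> inv g) \<otimes> inv h"
    using assms k by (simp add: m_assoc inv_mult_group)
  then show ?thesis unfolding conj_vec_def k_def[symmetric]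
    using assms k H_conj[of g k] by (simp add: \<pi>_mult \<pi>_inv)
qed

text \<open>Elements of \<open>H\<close> act trivially on the abelian quotient, so finitely many
  coset representatives produce all orbit points.\<close>

lemma finite_conj_orbits:
  assumes "finite A" "A \<subseteq> int_lattice D"
  shows "finite (conj_orbits A)"
proof -
  have "conj_orbits A \<subseteq> (\<lambda>(r, a). conj_vec r a) ` (coset_rep ` carrier G \<times> A)"
  proof
    fix x assume "x \<in> conj_orbits A"
    then obtain g a where g: "g \<in> carrier G" "a \<in> A" "x = conj_vec g a" by (auto simp: conj_orbits_def)
    have "conj_vec g a = conj_vec ((g \<otimes> inv (coset_rep g)) \<otimes> coset_rep g) a" using g by (simp add: m_assoc)
    also have "\<dots> = conj_vec (coset_rep g) a"
      using g assms(2) by (intro conj_vec_loop coset_rep_quotient) auto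
    finally have "x = (\<lambda>(r, a). conj_vec r a) (coset_rep g, a)" using g(3) by simp
    then show "x \<in> (\<lambda>(r, a). conj_vec r a) ` (coset_rep ` carrier G \<times> A)" using g by blast
  qed
  moreover have "finite ((\<lambda>(r, a). conj_vec r a) ` (coset_rep ` carrier G \<times> A))"
    by (intro finite_imageI finite_cartesian_product finite_coset_reps assms(1))
  ultimately show ?thesis by (rule finite_subset)
qed

text \<open>A power of the conjugate is the conjugate of the power, so conjugation costs a constant
  independent of the exponent. A new generator therefore makes the whole orbit of its displacement
  cheap.\<close>

lemma cheap_conj_vec:
  assumes S: "generating_set G S" and a: "a \<in> S" "a \<in> H" and g: "g \<in> carrier G"
  shows "cheap S (conj_vec g (\<pi> a))"
  unfolding cheap_def
proof (intro exI allI)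
  fix c :: nat
  define k where "k = g \<otimes> a \<otimes> inv g"
  have k: "k \<in> H" "\<pi> k = conj_vec g (\<pi> a)" using a g by (simp_all add: k_def H_conj conj_vec_\<pi>)
  have kc: "k [^] c = g \<otimes> a [^] c \<otimes> inv g" using conj_nat_pow[of "inv g" a c] a g by (simp add: k_def)
  have "word_norm G S a \<le> 1" using word_norm_le[of "[a]" S] a by simp
  then have ac: "word_norm G S (a [^] c) \<le> c"
    using word_norm_pow[OF S, of a c] a mult_le_mono2[of "word_norm G S a" 1 c] by (simp add: order_trans)
  have "word_norm G S (k [^] c) \<le> word_norm G S (g \<otimes> a [^] c) + word_norm G S (inv g)"
    unfolding kc using a g by (intro word_norm_mult[OF S]) auto
  also have "word_norm G S (g \<otimes> a [^] c) \<le> word_norm G S g + word_norm G S (a [^] c)"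
    using a g by (intro word_norm_mult[OF S]) auto
  finally have "word_norm G S (k [^] c) \<le> c + (word_norm G S g + word_norm G S (inv g))" using ac by simp
  then show "\<exists>g'\<in>H. \<pi> g' = real c *\<^sub>R conj_vec g (\<pi> a) \<and>
      word_norm G S g' \<le> c + (word_norm G S g + word_norm G S (inv g))"
    using k by (intro bexI[of _ "k [^] c"] conjI) (simp_all add: \<pi>_pow)
qed

text \<open>This is \<open>shorten_power\<close> for the cheap vectors
  \<open>real N *\<^sub>R x\<close>; the coefficients stay the same.\<close>

lemma shortens_if_interior:
  assumes S: "generating_set G S" and X: "finite X" "\<And>x. x \<in> X \<Longrightarrow> cheap S (real N *\<^sub>R x)" and N: "N > 0"
    and u: "u \<in> lists S" "word_eval G u \<in> H" "\<pi> (word_eval G u) = real N *\<^sub>R (\<Sum>x\<in>X. c x *\<^sub>R x)"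
      "\<And>x. x \<in> X \<Longrightarrow> 0 \<le> c x" "(\<Sum>x\<in>X. c x) < real (length u)"
  shows "shortens S u"
proof -
  define X' where "X' = (\<lambda>x. real N *\<^sub>R x) ` X"
  define c' where "c' x = c ((1 / real N) *\<^sub>R x)" for x
  have inj: "inj_on (\<lambda>x. real N *\<^sub>R x) X" using N by (auto simp: inj_on_def)
  have c': "c' (real N *\<^sub>R x) = c x" for x using N by (simp add: c'_def)
  have "\<exists>m>0. word_norm G S (word_eval G u [^] (m::nat)) < m * length u"
  proof (rule shorten_power[OF S, where X = X' and c = c'])
    show "finite X'" using X(1) by (simp add: X'_def)
    show "\<forall>x\<in>X'. cheap S x" using X(2) by (auto simp: X'_def)
    show "word_eval G u \<in> H" by (rule u(2))
    show "\<pi> (word_eval G u) = (\<Sum>x\<in>X'. c' x *\<^sub>R x)"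
      unfolding X'_def sum.reindex[OF inj] u(3) by (simp add: c' scaleR_right.sum mult.commute)
    show "0 \<le> c' x" if "x \<in> X'" for x using that u(4) c' by (auto simp: X'_def)
    show "(\<Sum>x\<in>X'. c' x) < real (length u)"
      unfolding X'_def sum.reindex[OF inj] using u(5) by (simp add: c')
  qed
  then show ?thesis by (simp add: shortens_def)
qed

text \<open>The generators are all of \<open>T\<close> together with lifts of the \<open>N\<close>-th multiples of the elements of \<open>B\<close>,
  with \<open>N\<close> so large that short loops in \<open>T\<close> are inefficient. The same holds for words \<open>[a, b]\<close> in
  two distinct new generators, as \<open>(a + b) / 2\<close> is an interior point.\<close>

lemma polynomial_growth_exists:
  assumes T: "generating_set G T" and B: "finite B" "B \<subseteq> int_lattice D" and X: "finite X" "X \<subseteq> conj_orbits B"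
    and inner: "\<And>v. v \<in> int_lattice D \<Longrightarrow> \<exists>c. (\<forall>x\<in>X. 0 \<le> c x) \<and> v = (\<Sum>x\<in>X. c x *\<^sub>R x) \<and> (\<Sum>x\<in>X. c x) \<le> \<kappa> * norm v"
    and mid: "\<And>a b. a \<in> B \<Longrightarrow> b \<in> B \<Longrightarrow> a \<noteq> b \<Longrightarrow>
      \<exists>c. (\<forall>x\<in>X. 0 \<le> c x) \<and> a + b = (\<Sum>x\<in>X. c x *\<^sub>R x) \<and> (\<Sum>x\<in>X. c x) < 2"
  shows "\<exists>S. generating_set G S \<and> polynomial_geodesic_growth G S"
proof -
  have finT: "finite T" and TG: "T \<subseteq> carrier G" using T by (auto simp: generating_set_def)
  have "finite (short_loops T)" using loop_set_short_loops[OF finT order_refl] by (simp add: loop_set_def)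
  \<comment> \<open>By \<open>inner\<close>, the displacement of a loop is a nonnegative combination
    of \<open>X\<close> of total weight at most \<open>\<kappa>\<close> times its norm, and
    \<open>M\<close> bounds this for all short loops at once. Over the vectors \<open>N x\<close>
    the weight falls below 1, hence below the length of the loop.\<close>
  define M where "M = (\<Sum>u\<in>short_loops T. \<bar>\<kappa>\<bar> * norm (\<pi> (word_eval G u)))"
  define N where "N = nat \<lceil>M\<rceil> + 1"
  have M: "\<kappa> * norm (\<pi> (word_eval G u)) < real N" if "u \<in> short_loops T" for u
  proof -
    have "\<kappa> * norm (\<pi> (word_eval G u)) \<le> \<bar>\<kappa>\<bar> * norm (\<pi> (word_eval G u))" by (intro mult_right_mono) auto
    also have "\<dots> \<le> M"
      unfolding M_def using \<open>finite (short_loops T)\<close> that by (intro member_le_sum) auto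
    also have "M < real N" unfolding N_def by linarith
    finally show ?thesis .
  qed
  have N: "N > 0" by (simp add: N_def)
  define l where "l a = lift (real N *\<^sub>R a)" for a
  have l: "l a \<in> H" "\<pi> (l a) = real N *\<^sub>R a" if "a \<in> B" for a
    using lift[of "real N *\<^sub>R a"] int_lattice_scale[of a "int N"] that B(2) by (auto simp: l_def)
  define A where "A = l ` B"
  define S where "S = T \<union> A"
  have AH: "A \<subseteq> H" using l by (auto simp: A_def)
  have SG: "S \<subseteq> carrier G" using TG AH by (auto simp: S_def)
  have S: "generating_set G S"
    unfolding generating_set_def
  proof (intro conjI)
    show "finite S" using finT B(1) by (simp add: S_def A_def)
    show "S \<subseteq> carrier G" by (rule SG)
    show "carrier G = word_eval G ` lists S"
    proof
      have "carrier G = word_eval G ` lists T" using T unfolding generating_set_def by (elim conjE)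
      also have "\<dots> \<subseteq> word_eval G ` lists S" unfolding S_def by (intro image_mono lists_mono) auto
      finally show "carrier G \<subseteq> word_eval G ` lists S" .
      show "word_eval G ` lists S \<subseteq> carrier G"
      proof (rule image_subsetI)
        fix w assume "w \<in> lists S"
        then have "set w \<subseteq> carrier G" using SG by auto
        then show "word_eval G w \<in> carrier G" by simp
      qed
    qed
  qed
  have cheapX: "cheap S (real N *\<^sub>R x)" if xX: "x \<in> X" for x
  proof -
    obtain g a where g: "g \<in> carrier G" "a \<in> B" "x = conj_vec g a"
      using subsetD[OF X(2) xX] unfolding conj_orbits_def by blast
    have "cheap S (conj_vec g (\<pi> (l a)))"
      using g l by (intro cheap_conj_vec[OF S]) (auto simp: S_def A_def)
    moreover have "conj_vec g (\<pi> (l a)) = real N *\<^sub>R x"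
      using l(2)[OF g(2)] g B(2) by (simp add: conj_vec_scale_nat subset_iff)
    ultimately show ?thesis by simp
  qed
  have sT: "shortens S u" if "u \<in> short_loops (S - A)" for u
  proof -
    have u: "u \<in> lists T" "u \<noteq> []" "word_eval G u \<in> H" "u \<in> short_loops T"
      using that by (auto simp: short_loops_def S_def)
    obtain c where c: "\<forall>x\<in>X. 0 \<le> c x" "\<pi> (word_eval G u) = (\<Sum>x\<in>X. c x *\<^sub>R x)"
      "(\<Sum>x\<in>X. c x) \<le> \<kappa> * norm (\<pi> (word_eval G u))" using inner[OF \<pi>_lattice[OF u(3)]] by (elim exE conjE)
    show ?thesis
    proof (rule shortens_if_interior[OF S X(1) cheapX N, where c = "\<lambda>x. c x / real N"])
      show "u \<in> lists S" using u(1) by (auto simp: S_def)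
      show "\<pi> (word_eval G u) = real N *\<^sub>R (\<Sum>x\<in>X. (c x / real N) *\<^sub>R x)"
        using N c(2) by (simp add: scaleR_right.sum)
      have "(\<Sum>x\<in>X. c x / real N) = (\<Sum>x\<in>X. c x) / real N" by (simp add: sum_divide_distrib)
      also have "\<dots> < 1" using c(3) M[OF u(4)] N by simp
      also have "1 \<le> real (length u)" using u(2) by (cases u) auto
      finally show "(\<Sum>x\<in>X. c x / real N) < real (length u)" .
    qed (use u(3) c(1) in auto)
  qed
  let ?U = "{[a, b] | a b. a \<in> A \<and> b \<in> A \<and> a \<noteq> b}"
  have "?U \<subseteq> (\<lambda>(a, b). [a, b]) ` (A \<times> A)" by auto
  moreover have "finite A" using B(1) by (simp add: A_def)
  ultimately have finU: "finite ?U" by (meson finite_SigmaI finite_imageI finite_subset)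
  have U: "loop_set S ?U"
    unfolding loop_set_def
  proof (intro conjI ballI finU)
    fix u assume "u \<in> ?U"
    then obtain a b where u: "u = [a, b]" and ab: "a \<in> A" "b \<in> A" by blast
    show "u \<in> lists S" using ab by (simp add: u S_def)
    show "word_eval G u \<in> H" using subsetD[OF AH ab(1)] subsetD[OF AH ab(2)] by (simp add: u)
  qed
  have sU: "\<forall>u\<in>?U. shortens S u"
  proof
    fix u assume "u \<in> ?U"
    then obtain a b where ab: "a \<in> B" "b \<in> B" "l a \<noteq> l b" "u = [l a, l b]" unfolding A_def by blast
    have "a \<noteq> b" using ab(3) by metis
    from mid[OF ab(1,2) this] obtain c where c: "\<forall>x\<in>X. 0 \<le> c x" "a + b = (\<Sum>x\<in>X. c x *\<^sub>R x)"
      "(\<Sum>x\<in>X. c x) < 2" by (elim exE conjE)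
    show "shortens S u"
    proof (rule shortens_if_interior[OF S X(1) cheapX N, where c = c])
      show "u \<in> lists S" using ab by (auto simp: S_def A_def)
      show "word_eval G u \<in> H" using ab l by simp
      show "\<pi> (word_eval G u) = real N *\<^sub>R (\<Sum>x\<in>X. c x *\<^sub>R x)"
        using ab l c(2)[symmetric] by (simp add: \<pi>_mult scaleR_add_right)
      show "(\<Sum>x\<in>X. c x) < real (length u)" using c(3) ab(4) by simp
    qed (use c(1) in auto)
  qed
  have AS: "A \<subseteq> S \<inter> H" using AH by (simp add: S_def)
  have "\<forall>u\<in>short_loops (S - A). shortens S u" using sT by (rule ballI)
  from few_other_letters[OF S AS this]
  obtain K where K: "\<forall>w. geodesic G S w \<longrightarrow> length (filter (\<lambda>s. s \<notin> A) w) \<le> K" by (elim exE)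
  obtain R where R: "\<forall>w r. w \<in> lists S \<longrightarrow> disjoint_factors ?U r w \<longrightarrow> length w \<le> word_norm G S (word_eval G w) + 0 \<longrightarrow> r \<le> R"
    by (rule exE[OF disjoint_factors_bounded[OF S U sU]])
  \<comment> \<open>Blocks beyond the first are charged to the at most \<open>K\<close> letters
    outside \<open>A\<close> and to at most \<open>R\<close> inefficient factors
    \<open>[a, b]\<close>.\<close>
  have "length (remdups_adj w) \<le> 1 + 2 * K + 2 * R" if w: "geodesic G S w" for w
  proof -
    obtain r where r: "disjoint_factors ?U r w"
      "length (remdups_adj w) \<le> 1 + 2 * length (filter (\<lambda>s. s \<notin> A) w) + 2 * r"
      using switches_bound[of A w] by (elim exE conjE)
    have "w \<in> lists S" "length w \<le> word_norm G S (word_eval G w) + 0" using w by (simp_all add: geodesic_def)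
    then have "r \<le> R" using R[THEN spec, of w, THEN spec, of r] r(1) by blast
    moreover have "length (filter (\<lambda>s. s \<notin> A) w) \<le> K" using K w by blast
    ultimately show ?thesis using r(2) by linarith
  qed
  then have "polynomial_geodesic_growth G S" by (rule polynomial_growth_if_few_runs[OF S])
  with S show ?thesis by blast
qed

end

section \<open>From polynomial growth to facets\<close>

lemma power_over_exponential_tendsto_0: "(\<lambda>k. real k ^ i / 2 ^ k) \<longlonglongrightarrow> 0"
proof -
  have "filterlim (\<lambda>k. ln 2 * real k) at_top sequentially"
    by (intro filterlim_tendsto_pos_mult_at_top[OF tendsto_const] filterlim_real_sequentially) simp
  from filterlim_compose[OF tendsto_power_div_exp_0[of i] this]
  have "(\<lambda>k. (ln 2 * real k) ^ i / exp (ln 2 * real k)) \<longlonglongrightarrow> 0" .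
  moreover have "exp (ln 2 * real k) = 2 ^ k" for k
    by (simp add: mult.commute exp_of_nat_mult)
  ultimately have "(\<lambda>k. (1 / ln 2 ^ i) * ((ln 2 * real k) ^ i / 2 ^ k)) \<longlonglongrightarrow> (1 / ln 2 ^ i) * 0"
    by (intro tendsto_mult tendsto_const) simp
  then show ?thesis by (simp add: power_mult_distrib)
qed

lemma exponential_exceeds_polynomial:
  fixes p :: "real poly"
  shows "\<exists>k::nat. poly p (real (k * n)) < 2 ^ k"
proof -
  define q where "q = pcompose p [:0, real n:]"
  have q: "poly q (real k) = poly p (real (k * n))" for k by (simp add: q_def poly_pcompose)
  have "(\<lambda>k. \<Sum>i\<le>degree q. coeff q i * (real k ^ i / 2 ^ k)) \<longlonglongrightarrow> (\<Sum>i\<le>degree q. coeff q i * 0)"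
    by (intro tendsto_sum tendsto_mult tendsto_const power_over_exponential_tendsto_0)
  then have "(\<lambda>k. poly q (real k) / 2 ^ k) \<longlonglongrightarrow> 0"
    by (simp add: poly_altdef sum_divide_distrib)
  then have "eventually (\<lambda>k. poly q (real k) / 2 ^ k < 1) sequentially" by (rule order_tendstoD) simp
  then obtain k where "poly q (real k) / 2 ^ k < 1" using eventually_happens by force
  then show ?thesis using q by (intro exI[of _ k]) simp
qed

lemma span_coordinates: "{x :: real ^ 'n::finite. \<forall>i. i \<notin> D \<longrightarrow> x $ i = 0} \<subseteq> span ((\<lambda>i. axis i 1) ` D)"
proof
  fix x :: "real ^ 'n" assume x: "x \<in> {x. \<forall>i. i \<notin> D \<longrightarrow> x $ i = 0}"
  have "x = (\<Sum>i\<in>D. x $ i *\<^sub>R axis i 1)"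
    using x by (auto simp: vec_eq_iff axis_def if_distrib cong: if_cong)
  also have "\<dots> \<in> span ((\<lambda>i. axis i 1) ` D)" by (intro span_sum span_scale span_base imageI)
  finally show "x \<in> span ((\<lambda>i. axis i 1) ` D)" .
qed

lemma dim_coordinates: "dim {x :: real ^ 'n::finite. \<forall>i. i \<notin> D \<longrightarrow> x $ i = 0} = card D"
proof -
  let ?B = "(\<lambda>i. axis i 1 :: real ^ 'n) ` D"
  have "{x :: real ^ 'n. \<forall>i. i \<notin> D \<longrightarrow> x $ i = 0} = {x. \<forall>b\<in>Basis. b \<notin> ?B \<longrightarrow> x \<bullet> b = 0}"
    by (auto simp: Basis_vec_def inner_axis axis_eq_axis)
  moreover have "dim {x. \<forall>b\<in>Basis. b \<notin> ?B \<longrightarrow> x \<bullet> b = 0} = card ?B"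
    by (rule dim_substandard) (auto simp: Basis_vec_def)
  moreover have "card ?B = card D" by (rule card_image) (simp add: inj_on_def axis_eq_axis)
  ultimately show ?thesis by simp
qed

context central_lattice_extension
begin

lemma word_eval_concat_loops:
  assumes "set ws \<subseteq> {w. set w \<subseteq> carrier G \<and> word_eval G w \<in> H}"
  shows "word_eval G (concat ws) \<in> H \<and> \<pi> (word_eval G (concat ws)) = (\<Sum>w\<leftarrow>ws. \<pi> (word_eval G w))"
  using assms
proof (induction ws)
  case (Cons w ws)
  have "set (concat ws) \<subseteq> carrier G" using Cons.prems by auto
  then show ?case using Cons by (simp add: \<pi>_mult)
qed simp

text \<open>The length of every short loop divides the factorial, so displacements per letter become
  lattice vectors after multiplication by \<open>scale\<close>.\<close>

definition scale :: nat where "scale = fact (card (rcosets H))"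

lemma scale_dvd: "0 < l \<Longrightarrow> l \<le> card (rcosets H) \<Longrightarrow> real scale / real l = real (scale div l)"
  unfolding scale_def by (rule real_of_nat_div[symmetric]) (rule dvd_fact, auto)

lemma scale_pos: "0 < scale" by (simp add: scale_def)

text \<open>The origin is added so that the polytope contains it in any case. It does no harm, for
  it will turn out to lie on no facet.\<close>

definition directions :: "'a set \<Rightarrow> (real ^ 'n) set" where
  "directions S = insert 0 ((\<lambda>u. (real scale / real (length u)) *\<^sub>R \<pi> (word_eval G u)) ` short_loops S)"

lemma directions_lattice: "directions S \<subseteq> int_lattice D"
proof -
  have "(real scale / real (length u)) *\<^sub>R \<pi> (word_eval G u) \<in> int_lattice D" if "u \<in> short_loops S" for u
  proof -
    have "0 < length u" "length u \<le> card (rcosets H)" "word_eval G u \<in> H" using that by (auto simp: short_loops_def)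
    then show ?thesis using int_lattice_scale[OF \<pi>_lattice, of "word_eval G u" "int (scale div length u)"]
      by (simp add: scale_dvd)
  qed
  then show ?thesis unfolding directions_def using int_lattice_0 by blast
qed

text \<open>Cutting out a short loop \<open>u\<close> writes the displacement of \<open>w\<close> as
  that of a conjugate of \<open>u\<close> plus that of a shorter loop. Per letter this is a convex
  combination with weights proportional to the lengths. The conjugation by the prefix is the reason
  for taking whole orbits.\<close>

lemma loop_direction_in_hull:
  assumes S: "S \<subseteq> carrier G" and w: "w \<in> lists S" "w \<noteq> []" "word_eval G w \<in> H"
  shows "(real scale / real (length w)) *\<^sub>R \<pi> (word_eval G w) \<in> convex hull (conj_orbits (directions S))"
  using w
proof (induction "length w" arbitrary: w rule: less_induct)
  case less
  let ?P = "convex hull (conj_orbits (directions S))"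
  have dir: "u \<in> short_loops S \<Longrightarrow> (real scale / real (length u)) *\<^sub>R \<pi> (word_eval G u) \<in> directions S" for u
    unfolding directions_def by blast
  have wc: "set w \<subseteq> carrier G" using less.prems S by auto
  show ?case
  proof (cases "length w \<le> card (rcosets H)")
    case True
    then have "w \<in> short_loops S" using less.prems by (simp add: short_loops_def)
    then show ?thesis using dir conj_orbits_superset[OF directions_lattice] by (intro hull_inc) blast
  next
    case False
    obtain x u z where xuz: "w = x @ u @ z" "u \<noteq> []" "length (x @ u) \<le> card (rcosets H)" "word_eval G u \<in> H"
      using short_loop_factor[OF wc] False by (meson nat_le_linear)
    have c: "set x \<subseteq> carrier G" "set u \<subseteq> carrier G" "set z \<subseteq> carrier G" using wc xuz(1) by auto
    define X where "X = word_eval G x"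
    have X: "X \<in> carrier G" using c by (simp add: X_def)
    define k where "k = X \<otimes> word_eval G u \<otimes> inv X"
    have k: "k \<in> H" unfolding k_def by (rule H_conj[OF X xuz(4)])
    have ev: "word_eval G w = k \<otimes> word_eval G (x @ z)"
      using c X xuz(4) by (simp add: xuz(1) k_def X_def m_assoc inv_cancel_left)
    have "word_eval G (x @ z) = inv k \<otimes> word_eval G w"
      unfolding ev using k c by (simp add: inv_cancel_left)
    then have xz: "word_eval G (x @ z) \<in> H" using k less.prems(3) by simp
    have xzS: "x @ z \<in> lists S" "x @ z \<noteq> []" "length (x @ z) < length w"
      using less.prems(1) xuz False by auto
    let ?b = "(real scale / real (length (x @ z))) *\<^sub>R \<pi> (word_eval G (x @ z))"
    have b: "?b \<in> ?P" by (rule less.hyps[OF xzS(3,1,2) xz])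
    have lu: "0 < length u" "length u \<le> card (rcosets H)" using xuz by auto
    have "u \<in> lists S" using less.prems(1) xuz(1) by simp
    then have "u \<in> short_loops S" using xuz lu by (simp add: short_loops_def)
    from conj_orbitsI[OF X dir[OF this]]
    have "conj_vec X ((real scale / real (length u)) *\<^sub>R \<pi> (word_eval G u)) \<in> ?P" by (rule hull_inc)
    also have "conj_vec X ((real scale / real (length u)) *\<^sub>R \<pi> (word_eval G u)) = (real scale / real (length u)) *\<^sub>R \<pi> k"
      unfolding scale_dvd[OF lu] conj_vec_scale_nat[OF X \<pi>_lattice[OF xuz(4)]] conj_vec_\<pi>[OF xuz(4) X] k_def ..
    finally have a: "(real scale / real (length u)) *\<^sub>R \<pi> k \<in> ?P" .
    define s t where "s = real (length u) / real (length w)" and "t = real (length (x @ z)) / real (length w)"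
    have lw: "real (length w) = real (length u) + real (length (x @ z))" "real (length w) > 0"
      using xuz(1,2) by (simp_all add: add_pos_nonneg add_nonneg_pos)
    have st: "0 \<le> s" "0 \<le> t" "s + t = 1" using lw by (simp_all add: s_def t_def add_divide_distrib[symmetric])
    have "(real scale / real (length w)) *\<^sub>R \<pi> (word_eval G w)
        = (real scale / real (length w)) *\<^sub>R \<pi> k + (real scale / real (length w)) *\<^sub>R \<pi> (word_eval G (x @ z))"
      unfolding ev \<pi>_mult[OF k xz] by (rule scaleR_add_right)
    also have "(real scale / real (length w)) *\<^sub>R \<pi> k = s *\<^sub>R ((real scale / real (length u)) *\<^sub>R \<pi> k)"
      using lu by (simp add: s_def)
    also have "(real scale / real (length w)) *\<^sub>R \<pi> (word_eval G (x @ z)) = t *\<^sub>R ?b"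
    proof -
      have "t * (real scale / real (length (x @ z))) = real scale / real (length w)"
        using xzS(2) unfolding t_def by (simp add: divide_simps del: length_append)
      then show ?thesis by (simp only: scaleR_scaleR)
    qed
    finally show ?thesis using convexD[OF convex_convex_hull a b st] by simp
  qed
qed

lemma facets_if_polynomial_growth:
  assumes S: "generating_set G S" and growth: "polynomial_geodesic_growth G S"
  defines "A \<equiv> directions S"
  defines "P \<equiv> convex hull (conj_orbits A)"
  shows "finite A" "A \<subseteq> int_lattice D" "polytope P" "aff_dim P = int (card D)"
    "\<not> (\<exists>a\<in>A. \<exists>b\<in>A. a \<noteq> b \<and> (\<exists>K. K facet_of P \<and> a \<in> K \<and> b \<in> K))"
proof -
  have SG: "S \<subseteq> carrier G" and finS: "finite S" using S by (auto simp: generating_set_def)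
  have "finite (short_loops S)" using loop_set_short_loops[OF finS order_refl] by (simp add: loop_set_def)
  then show finA: "finite A" by (simp add: A_def directions_def)
  show AL: "A \<subseteq> int_lattice D" unfolding A_def by (rule directions_lattice)
  have finX: "finite (conj_orbits A)" by (rule finite_conj_orbits[OF finA AL])
  then show poly: "polytope P" unfolding P_def by (rule polytope_convex_hull)
  let ?V = "{x :: real ^ 'n. \<forall>i. i \<notin> D \<longrightarrow> x $ i = 0}"
  have subV: "subspace ?V" by (auto simp: subspace_def)
  have "conj_orbits A \<subseteq> ?V" using conj_orbits_lattice[OF AL] by (auto simp: int_lattice_def)
  then have PV: "P \<subseteq> ?V" unfolding P_def by (intro hull_minimal subspace_imp_convex[OF subV])
  have "0 \<in> A" by (simp add: A_def directions_def)
  then have P0: "0 \<in> P" unfolding P_def using conj_orbits_superset[OF AL] by (intro hull_inc) blast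
  have hull: "(real scale / real (length w)) *\<^sub>R \<pi> (word_eval G w) \<in> P"
    if "w \<in> lists S" "w \<noteq> []" "word_eval G w \<in> H" for w
    unfolding P_def A_def using loop_direction_in_hull[OF SG that] .
  \<comment> \<open>Both signs of every axis vector are displacements of nonempty loops, so
    \<open>P\<close> contains positive multiples of them. This gives full dimension, and later that
    no facet contains the origin.\<close>
  have axisP: "\<exists>r>0. r *\<^sub>R (\<epsilon> *\<^sub>R axis i 1) \<in> P" if i: "i \<in> D" and \<epsilon>: "\<epsilon> = 1 \<or> \<epsilon> = - 1" for i and \<epsilon> :: real
  proof -
    have "\<epsilon> *\<^sub>R axis i 1 \<in> int_lattice D" using i \<epsilon> by (auto simp: int_lattice_def axis_def)
    then obtain h where h: "h \<in> H" "\<pi> h = \<epsilon> *\<^sub>R axis i 1" using lift by blast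
    obtain w where w: "w \<in> lists S" "word_eval G w = h" using word_norm_word[OF S, of h] h(1) by auto
    have "w \<noteq> []" using w h \<epsilon> by (auto simp: axis_eq_0_iff)
    then show ?thesis using hull[OF w(1)] w h scale_pos by (intro exI[of _ "real scale / real (length w)"]) auto
  qed
  show "aff_dim P = int (card D)"
  proof -
    have "aff_dim P = int (dim P)" using P0 by (intro aff_dim_zero hull_inc)
    moreover have "dim P \<le> dim ?V" using PV by (rule dim_subset)
    moreover have "dim ?V \<le> dim P"
    proof (rule dim_mono)
      have "axis i 1 \<in> span P" if i: "i \<in> D" for i
      proof -
        obtain r where r: "r > 0" "r *\<^sub>R (1 *\<^sub>R axis i 1) \<in> P" using axisP[OF i, of 1] by auto
        then have "(1 / r) *\<^sub>R (r *\<^sub>R (1 *\<^sub>R axis i 1)) \<in> span P" by (intro span_scale span_base)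
        then show ?thesis using r(1) by simp
      qed
      then have "span ((\<lambda>i. axis i 1) ` D) \<subseteq> span P" by (intro span_minimal) auto
      then show "?V \<subseteq> span P" using span_coordinates[of D] by (rule order_trans[rotated])
    qed
    moreover have "dim ?V = card D" by (rule dim_coordinates)
    ultimately show ?thesis by simp
  qed
  show "\<not> (\<exists>a\<in>A. \<exists>b\<in>A. a \<noteq> b \<and> (\<exists>K. K facet_of P \<and> a \<in> K \<and> b \<in> K))"
  proof (intro notI, elim bexE conjE exE)
    fix a b K assume ab: "a \<in> A" "b \<in> A" "a \<noteq> b" and K: "K facet_of P" and aK: "a \<in> K" and bK: "b \<in> K"
    have "K exposed_face_of P"
      using K exposed_face_of_polyhedron[OF polytope_imp_polyhedron[OF poly]] by (simp add: facet_of_def)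
    then obtain f c where fc: "P \<subseteq> {x. f \<bullet> x \<le> c}" "K = P \<inter> {x. f \<bullet> x = c}"
      unfolding exposed_face_of_def by (elim conjE exE)
    have KP: "K \<noteq> P" using K by (auto simp: facet_of_def)
    \<comment> \<open>For \<open>c = 0\<close> the functional would be at most zero in both
      directions of every axis. It would then vanish on \<open>P\<close>, and the facet would be all
      of \<open>P\<close>.\<close>
    have c0: "c > 0"
    proof (rule ccontr)
      assume "\<not> c > 0"
      then have c: "c = 0" using fc(1) P0 by auto
      have "f \<bullet> axis i 1 = 0" if i: "i \<in> D" for i
      proof -
        obtain r where r: "r > 0" "r *\<^sub>R (1 *\<^sub>R axis i 1) \<in> P" using axisP[OF i, of 1] by auto
        obtain r' where r': "r' > 0" "r' *\<^sub>R ((- 1) *\<^sub>R axis i 1) \<in> P" using axisP[OF i, of "- 1"] by auto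
        have "r * (f \<bullet> axis i 1) \<le> 0" "0 \<le> r' * (f \<bullet> axis i 1)" using fc(1) r(2) r'(2) c by auto
        then show ?thesis using r(1) r'(1) by (simp add: mult_le_0_iff zero_le_mult_iff)
      qed
      then have "span ((\<lambda>i. axis i 1) ` D) \<subseteq> {x. f \<bullet> x = 0}"
        by (intro span_minimal subspace_hyperplane) auto
      then have "P \<subseteq> {x. f \<bullet> x = 0}" using PV span_coordinates[of D] by blast
      then show False using KP fc(2) c by blast
    qed
    have loop: "\<exists>u. u \<in> lists S \<and> u \<noteq> [] \<and> word_eval G u \<in> H \<and> v = (real scale / real (length u)) *\<^sub>R \<pi> (word_eval G u)"
      if "v \<in> A" "v \<in> K" for v
    proof -
      have "v \<noteq> 0" using that(2) fc(2) c0 by auto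
      then show ?thesis using that(1) by (auto simp: A_def directions_def short_loops_def)
    qed
    obtain u1 where u1: "u1 \<in> lists S" "u1 \<noteq> []" "word_eval G u1 \<in> H" "a = (real scale / real (length u1)) *\<^sub>R \<pi> (word_eval G u1)"
      using loop[OF ab(1) aK] by (elim exE conjE)
    obtain u2 where u2: "u2 \<in> lists S" "u2 \<noteq> []" "word_eval G u2 \<in> H" "b = (real scale / real (length u2)) *\<^sub>R \<pi> (word_eval G u2)"
      using loop[OF ab(2) bK] by (elim exE conjE)
    \<comment> \<open>Repeating each loop as often as the other is long gives two words of the same
      length \<open>n\<close> whose displacements per letter are unchanged.\<close>
    define n where "n = length u1 * length u2"
    have n: "n > 0" using u1(2) u2(2) by (simp add: n_def)
    define v1 where "v1 = concat (replicate (length u2) u1)"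
    define v2 where "v2 = concat (replicate (length u1) u2)"
    have u12c: "set u1 \<subseteq> carrier G" "set u2 \<subseteq> carrier G" using u1(1) u2(1) SG by auto
    have vS: "v1 \<in> lists S" "v2 \<in> lists S" using u1(1) u2(1) by (auto simp: v1_def v2_def)
    have vl: "length v1 = n" "length v2 = n"
      by (simp_all add: v1_def v2_def n_def length_concat sum_list_replicate mult.commute)
    have vH: "word_eval G v1 \<in> H" "word_eval G v2 \<in> H"
      unfolding v1_def v2_def using u12c u1(3) u2(3) by (simp_all add: word_eval_replicate)
    have v\<pi>: "\<pi> (word_eval G v1) = (real n / real scale) *\<^sub>R a" "\<pi> (word_eval G v2) = (real n / real scale) *\<^sub>R b"
      unfolding v1_def v2_def u1(4) u2(4) n_def using u12c u1(2,3) u2(2,3) scale_pos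
      by (simp_all add: word_eval_replicate \<pi>_pow)
    have vne: "v1 \<noteq> v2" using v\<pi> ab(3) n scale_pos by auto
    have fv: "f \<bullet> \<pi> (word_eval G v) = real n * (c / real scale)" if "v \<in> {v1, v2}" for v
      using that v\<pi> aK bK fc(2) by auto
    \<comment> \<open>The functional bounds the displacement of every loop linearly in its length.
      Products of \<open>v1\<close> and \<open>v2\<close> attain this bound, so no shorter word has
      the same value.\<close>
    have upper: "f \<bullet> \<pi> (word_eval G w) \<le> real (length w) * (c / real scale)" if w: "w \<in> lists S" "word_eval G w \<in> H" for w
    proof (cases "w = []")
      case False
      have "f \<bullet> ((real scale / real (length w)) *\<^sub>R \<pi> (word_eval G w)) \<le> c" using hull[OF w(1) False w(2)] fc(1) by blast
      then show ?thesis using False scale_pos by (simp add: field_simps)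
    qed simp
    have geo: "geodesic G S (concat ws)" if ws: "set ws \<subseteq> {v1, v2}" for ws
    proof -
      have wsS: "concat ws \<in> lists S" using ws vS by (auto simp: in_lists_conv_set)
      have len: "length (concat ws) = length ws * n" using ws vl by (induction ws) auto
      have "set v1 \<subseteq> carrier G" "set v2 \<subseteq> carrier G" using vS SG by auto
      then have "set ws \<subseteq> {w. set w \<subseteq> carrier G \<and> word_eval G w \<in> H}" using ws vH by auto
      from word_eval_concat_loops[OF this]
      have wsH: "word_eval G (concat ws) \<in> H" and ws\<pi>: "\<pi> (word_eval G (concat ws)) = (\<Sum>w\<leftarrow>ws. \<pi> (word_eval G w))" by auto
      have "f \<bullet> (\<Sum>w\<leftarrow>ws. \<pi> (word_eval G w)) = real (length ws * n) * (c / real scale)"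
        using ws fv by (induction ws) (auto simp: inner_add_right algebra_simps)
      then have fw: "f \<bullet> \<pi> (word_eval G (concat ws)) = real (length ws * n) * (c / real scale)" unfolding ws\<pi> .
      obtain w where w: "w \<in> lists S" "word_eval G w = word_eval G (concat ws)" "length w = word_norm G S (word_eval G (concat ws))"
        using word_norm_word[OF S, of "word_eval G (concat ws)"] wsH by auto
      have "real (length ws * n) * (c / real scale) \<le> real (length w) * (c / real scale)"
        using upper[OF w(1)] wsH fw unfolding w(2) by simp
      then have "length ws * n \<le> length w" using c0 scale_pos by (simp add: divide_le_cancel del: of_nat_mult)
      then show ?thesis unfolding geodesic_def using wsS word_norm_le[OF wsS] w(3) len by simp
    qed
    \<comment> \<open>Blocks of equal length can be read off from their concatenation, so the
      \<open>2 ^ k\<close> sequences of blocks yield distinct geodesics.\<close>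
    have lower: "2 ^ k \<le> geodesic_growth G S (k * n)" for k
    proof -
      let ?L = "{ws. set ws \<subseteq> {v1, v2} \<and> length ws = k}"
      have "inj_on concat ?L"
      proof (rule inj_onI)
        fix ws ws' assume "ws \<in> ?L" "ws' \<in> ?L" and e: "concat ws = concat ws'"
        then have l: "set ws \<subseteq> {v1, v2}" "set ws' \<subseteq> {v1, v2}" "length ws = length ws'" by auto
        show "ws = ws'"
        proof (rule concat_injective[OF e l(3)])
          show "\<forall>(x, y) \<in> set (zip ws ws'). length x = length y"
          proof (clarify)
            fix x y assume "(x, y) \<in> set (zip ws ws')"
            then have "x \<in> {v1, v2}" "y \<in> {v1, v2}" using l(1,2) set_zip_leftD set_zip_rightD by fast+
            then show "length x = length y" using vl by auto
          qed
        qed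
      qed
      then have "card (concat ` ?L) = card ?L" by (rule card_image)
      also have "\<dots> = 2 ^ k" using card_lists_length_eq[of "{v1, v2}" k] vne by (simp add: numeral_2_eq_2)
      finally have "2 ^ k = card (concat ` ?L)" by simp
      also have "\<dots> \<le> geodesic_growth G S (k * n)"
        unfolding geodesic_growth_def
      proof (rule card_mono)
        have "{w. geodesic G S w \<and> length w \<le> k * n} \<subseteq> {w. set w \<subseteq> S \<and> length w \<le> k * n}"
          by (auto simp: geodesic_def)
        then show "finite {w. geodesic G S w \<and> length w \<le> k * n}"
          using finite_lists_length_le[OF finS] finite_subset by blast
        show "concat ` ?L \<subseteq> {w. geodesic G S w \<and> length w \<le> k * n}"
        proof (rule image_subsetI)
          fix ws assume ws: "ws \<in> ?L"
          then have "set ws \<subseteq> {v1, v2}" by simp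
          then have "length (concat ws) = length ws * n" using vl by (induction ws) auto
          then show "concat ws \<in> {w. geodesic G S w \<and> length w \<le> k * n}" using ws geo by simp
        qed
      qed
      finally show ?thesis .
    qed
    obtain p :: "real poly" where p: "\<And>m. real (geodesic_growth G S m) \<le> poly p (real m)"
      using growth unfolding polynomial_geodesic_growth_def by blast
    obtain k :: nat where "poly p (real (k * n)) < 2 ^ k" using exponential_exceeds_polynomial by blast
    then have "real (geodesic_growth G S (k * n)) < 2 ^ k" using p[of "k * n"] by linarith
    moreover have "real (2 ^ k) \<le> real (geodesic_growth G S (k * n))" using lower[of k] by (simp only: of_nat_le_iff)
    ultimately show False by simp
  qed
qed

end

section \<open>From facets to polynomial growth\<close>

context central_lattice_extension
begin

text \<open>The action permutes the orbit points, so their sum is fixed. Translating the barycentre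
  to the origin is therefore compatible with the action.\<close>

lemma conj_vec_sum_conj_orbits:
  assumes A: "finite A" "A \<subseteq> int_lattice D" and g: "g \<in> carrier G"
  shows "conj_vec g (\<Sum>(conj_orbits A)) = \<Sum>(conj_orbits A)"
proof -
  let ?X = "conj_orbits A"
  have X: "finite ?X" "?X \<subseteq> int_lattice D" using finite_conj_orbits[OF A] conj_orbits_lattice[OF A(2)] .
  have maps: "conj_vec g' x \<in> ?X" if "x \<in> ?X" "g' \<in> carrier G" for g' x
  proof -
    obtain g1 a where g1: "g1 \<in> carrier G" "a \<in> A" "x = conj_vec g1 a" using \<open>x \<in> ?X\<close> unfolding conj_orbits_def by blast
    then have "conj_vec g' x = conj_vec (g' \<otimes> g1) a" using that(2) A(2) by (simp add: conj_vec_mult subset_iff)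
    then show ?thesis using g1 that(2) by (simp add: conj_orbitsI)
  qed
  have inv: "conj_vec (inv g') (conj_vec g' x) = x" if "x \<in> ?X" "g' \<in> carrier G" for g' x
    using that X(2) by (simp add: conj_vec_mult conj_vec_one subset_iff)
  have "inj_on (conj_vec g) ?X" by (rule inj_on_inverseI[of _ "conj_vec (inv g)"]) (rule inv[OF _ g])
  moreover have "conj_vec g ` ?X = ?X"
  proof
    show "conj_vec g ` ?X \<subseteq> ?X" using maps[OF _ g] by (intro image_subsetI)
    show "?X \<subseteq> conj_vec g ` ?X"
    proof
      fix x assume x: "x \<in> ?X"
      then have "x = conj_vec g (conj_vec (inv g) x)" using inv[OF x, of "inv g"] g by simp
      then show "x \<in> conj_vec g ` ?X" using maps[OF x, of "inv g"] g by (intro image_eqI) simp_all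
    qed
  qed
  ultimately have "(\<Sum>x\<in>?X. conj_vec g x) = \<Sum>?X" using sum.reindex[of "conj_vec g" ?X "\<lambda>x. x"] by simp
  then show ?thesis using conj_vec_sum[OF g X] by simp
qed

text \<open>\<open>P\<close> need not contain the origin; we first translate the barycentre of the orbit points there,
  after multiplying by their number to stay in the lattice.\<close>

lemma polynomial_growth_if_facets:
  assumes T: "generating_set G T" and A: "finite A" "A \<subseteq> int_lattice D"
  defines "P \<equiv> convex hull (conj_orbits A)"
  assumes dimP: "aff_dim P = int (card D)"
    and facets: "\<not> (\<exists>a\<in>A. \<exists>b\<in>A. a \<noteq> b \<and> (\<exists>K. K facet_of P \<and> a \<in> K \<and> b \<in> K))"
  shows "\<exists>S. generating_set G S \<and> polynomial_geodesic_growth G S"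
proof -
  define X where "X = conj_orbits A"
  have X: "finite X" "X \<subseteq> int_lattice D" unfolding X_def using finite_conj_orbits[OF A] conj_orbits_lattice[OF A(2)] .
  have P: "P = convex hull X" by (simp add: P_def X_def)
  have "X \<noteq> {}" using dimP by (auto simp: P)
  define M where "M = card X"
  have M: "real M > 0" using X(1) \<open>X \<noteq> {}\<close> by (simp add: M_def card_gt_0_iff)
  define s where "s = \<Sum>X"
  have sl: "s \<in> int_lattice D" unfolding s_def using X(2) by (intro int_lattice_sum) auto
  define g where "g = (1 / real M) *\<^sub>R s"
  define tr where "tr x = real M *\<^sub>R x - s" for x
  have trg: "tr x = real M *\<^sub>R (x - g)" for x using M by (simp add: tr_def g_def algebra_simps)
  have inj: "inj_on tr Y" for Y using M by (auto simp: inj_on_def tr_def)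
  have tr_lattice: "tr x \<in> int_lattice D" if "x \<in> int_lattice D" for x
    unfolding tr_def using int_lattice_scale[OF that, of "int M"] sl by (intro int_lattice_diff) simp_all
  define V where "V = {x :: real ^ 'n. \<forall>i. i \<notin> D \<longrightarrow> x $ i = 0}"
  have subV: "subspace V" by (auto simp: V_def subspace_def)
  have LV: "int_lattice D \<subseteq> V" by (auto simp: int_lattice_def V_def)
  have XV: "X \<subseteq> V" using X(2) LV by (rule order_trans)
  have gV: "g \<in> V" unfolding g_def s_def using XV by (intro subspace_scale[OF subV] subspace_sum[OF subV]) auto
  have hullV: "affine hull P = V"
  proof (rule affine_dim_equal)
    show "affine V" using subV by (rule subspace_imp_affine)
    show "affine hull P \<noteq> {}" using \<open>X \<noteq> {}\<close> by (simp add: P)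
    have "P \<subseteq> V" unfolding P using XV subspace_imp_convex[OF subV] by (rule hull_minimal)
    then show "affine hull P \<subseteq> V" using subspace_imp_affine[OF subV] by (rule hull_minimal)
    have "aff_dim V = int (dim V)" by (rule aff_dim_subspace[OF subV])
    also have "dim V = card D" unfolding V_def by (rule dim_coordinates)
    finally show "aff_dim (affine hull P) = aff_dim V" using dimP by simp
  qed (rule affine_affine_hull)
  \<comment> \<open>Seen from \<open>g\<close>, a point of \<open>P\<close> scaled by
    \<open>r\<close> is a combination of the vectors \<open>tr x\<close> of total weight
    \<open>r / M\<close>; this weight is what has to be compared with word length.\<close>
  have comb: "\<exists>c. (\<forall>x\<in>tr ` X. 0 \<le> c x) \<and> r *\<^sub>R (y - g) = (\<Sum>x\<in>tr ` X. c x *\<^sub>R x) \<and> (\<Sum>x\<in>tr ` X. c x) = r / real M"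
    if yP: "y \<in> P" and r: "r \<ge> 0" for y r
  proof -
    obtain u where u: "\<forall>x\<in>X. 0 \<le> u x" "sum u X = 1" "(\<Sum>x\<in>X. u x *\<^sub>R x) = y"
      using yP unfolding P convex_hull_finite[OF X(1)] by blast
    define c where "c x = r / real M * u ((1 / real M) *\<^sub>R (x + s))" for x
    have ctr: "c (tr x) = r / real M * u x" for x using M by (simp add: c_def tr_def)
    have "(\<Sum>x\<in>tr ` X. c x *\<^sub>R x) = (\<Sum>x\<in>X. (r * u x) *\<^sub>R (x - g))"
      unfolding sum.reindex[OF inj] using M by (simp add: ctr) (simp add: trg)
    also have "\<dots> = r *\<^sub>R (\<Sum>x\<in>X. u x *\<^sub>R (x - g))" by (simp add: scaleR_right.sum)
    also have "(\<Sum>x\<in>X. u x *\<^sub>R (x - g)) = y - g"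
      using u by (simp add: scaleR_diff_right sum_subtractf scaleR_left.sum[symmetric])
    finally have 1: "r *\<^sub>R (y - g) = (\<Sum>x\<in>tr ` X. c x *\<^sub>R x)" by simp
    have "(\<Sum>x\<in>X. r / real M * u x) = r / real M"
      by (simp only: sum_distrib_left[symmetric] u(2) mult_1_right)
    then have 2: "(\<Sum>x\<in>tr ` X. c x) = r / real M"
      unfolding sum.reindex[OF inj] by (simp only: o_def ctr)
    have "\<forall>x\<in>tr ` X. 0 \<le> c x" using u(1) r by (simp add: ctr)
    with 1 2 show ?thesis by blast
  qed
  have gP: "g \<in> rel_interior P"
  proof -
    have "\<forall>x\<in>X. 0 < 1 / real M" "(\<Sum>x\<in>X. 1 / real M) = 1" "(\<Sum>x\<in>X. (1 / real M) *\<^sub>R x) = g"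
      using M by (simp_all add: g_def s_def scaleR_right.sum) (simp add: M_def)
    then have "g \<in> {y. \<exists>u. (\<forall>x\<in>X. 0 < u x) \<and> sum u X = 1 \<and> (\<Sum>x\<in>X. u x *\<^sub>R x) = y}"
      by (intro CollectI exI[of _ "\<lambda>_. 1 / real M"] conjI)
    then show ?thesis
      unfolding P by (rule subsetD[OF explicit_subset_rel_interior_convex_hull_minimal[OF X(1)]])
  qed
  obtain e where e: "e > 0" "ball g e \<inter> V \<subseteq> P" using gP unfolding mem_rel_interior_ball hullV by blast
  \<comment> \<open>Within \<open>V\<close>, the ball of radius \<open>e\<close> about
    \<open>g\<close> lies in \<open>P\<close>. A lattice vector is scaled to half that radius, hence
    \<open>r = 2 * norm v / e\<close> and the total weight \<open>r / M\<close>.\<close>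
  define \<kappa> where "\<kappa> = 2 / (e * real M)"
  have inner: "\<exists>c. (\<forall>x\<in>tr ` X. 0 \<le> c x) \<and> v = (\<Sum>x\<in>tr ` X. c x *\<^sub>R x) \<and> (\<Sum>x\<in>tr ` X. c x) \<le> \<kappa> * norm v"
    if v: "v \<in> int_lattice D" for v
  proof (cases "v = 0")
    case True
    then show ?thesis by (intro exI[of _ "\<lambda>_. 0"]) simp
  next
    case False
    define r where "r = 2 * norm v / e"
    have r: "r > 0" using False e(1) by (simp add: r_def)
    define y where "y = g + (1 / r) *\<^sub>R v"
    have "v \<in> V" using v LV by blast
    then have "y \<in> V" unfolding y_def by (intro subspace_add[OF subV] subspace_scale[OF subV] gV)
    moreover have "dist g y = norm v / r" using r by (simp add: y_def dist_norm)
    then have "dist g y = e / 2" using False e(1) by (simp add: r_def)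
    then have "y \<in> ball g e" using e(1) by simp
    ultimately have "y \<in> P" using e(2) by blast
    from comb[OF this, of r] r obtain c where c: "\<forall>x\<in>tr ` X. 0 \<le> c x" "r *\<^sub>R (y - g) = (\<Sum>x\<in>tr ` X. c x *\<^sub>R x)"
      "(\<Sum>x\<in>tr ` X. c x) = r / real M" by auto
    have "r *\<^sub>R (y - g) = v" using r by (simp add: y_def)
    moreover have "r / real M = \<kappa> * norm v" using e(1) M by (simp add: r_def \<kappa>_def)
    ultimately show ?thesis using c by (intro exI[of _ c]) simp
  qed
  have "polytope P" unfolding P using X(1) by (rule polytope_convex_hull)
  then have poly: "polyhedron P" by (rule polytope_imp_polyhedron)
  have AP: "A \<subseteq> P" unfolding P_def using conj_orbits_superset[OF A(2)] hull_subset[of "conj_orbits A" convex] by (rule order_trans)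
  have mid: "\<exists>c. (\<forall>x\<in>tr ` X. 0 \<le> c x) \<and> a' + b' = (\<Sum>x\<in>tr ` X. c x *\<^sub>R x) \<and> (\<Sum>x\<in>tr ` X. c x) < 2"
    if a': "a' \<in> tr ` A" and b': "b' \<in> tr ` A" and ne: "a' \<noteq> b'" for a' b'
  proof -
    obtain a where a: "a \<in> A" "a' = tr a" using a' by blast
    obtain b where b: "b \<in> A" "b' = tr b" using b' by blast
    have "a \<noteq> b" using ne a(2) b(2) by blast
    have abP: "a \<in> P" "b \<in> P" using AP a(1) b(1) by blast+
    define z where "z = midpoint a b"
    have "z \<in> P" unfolding z_def using abP convex_convex_hull[of X]
      by (metis P closed_segment_subset midpoint_in_closed_segment subset_iff)
    \<comment> \<open>A point of \<open>P\<close> outside the relative interior lies on a facet, and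
      a face through the midpoint contains both ends, against the hypothesis on
      \<open>A\<close>.\<close>
    have zP: "z \<in> rel_interior P"
    proof (rule ccontr)
      assume "z \<notin> rel_interior P"
      then have "z \<in> \<Union>{F. F facet_of P}" using \<open>z \<in> P\<close> rel_boundary_of_polyhedron[OF poly] by blast
      then obtain K where K: "K facet_of P" "z \<in> K" by blast
      have "K face_of P" using K(1) by (simp add: facet_of_def)
      moreover have "z \<in> open_segment a b" unfolding z_def using \<open>a \<noteq> b\<close> by simp
      ultimately have "a \<in> K \<and> b \<in> K" using face_ofD[of K P z a b] abP K(2) by blast
      then show False using facets a(1) b(1) \<open>a \<noteq> b\<close> K(1) by blast
    qed
    \<comment> \<open>The segment from \<open>g\<close> to \<open>z\<close> can be prolonged inside
      \<open>P\<close> by a factor \<open>t > 1\<close>, so the weight of \<open>a' + b'\<close>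
      drops from \<open>2\<close> to \<open>2 / t\<close>.\<close>
    have "\<forall>x\<in>P. \<exists>e. e > 1 \<and> (1 - e) *\<^sub>R x + e *\<^sub>R z \<in> P"
      using zP convex_rel_interior_iff[of P z] \<open>X \<noteq> {}\<close> by (simp add: P)
    moreover have "g \<in> P" using gP rel_interior_subset by blast
    ultimately obtain t where t: "t > 1" "(1 - t) *\<^sub>R g + t *\<^sub>R z \<in> P" by blast
    from comb[OF t(2), of "2 * real M / t"] t(1) obtain c where c: "\<forall>x\<in>tr ` X. 0 \<le> c x"
      "(2 * real M / t) *\<^sub>R ((1 - t) *\<^sub>R g + t *\<^sub>R z - g) = (\<Sum>x\<in>tr ` X. c x *\<^sub>R x)"
      "(\<Sum>x\<in>tr ` X. c x) = (2 * real M / t) / real M" by auto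
    have "(1 - t) *\<^sub>R g + t *\<^sub>R z - g = t *\<^sub>R (z - g)" by (simp add: algebra_simps)
    then have "(2 * real M / t) *\<^sub>R ((1 - t) *\<^sub>R g + t *\<^sub>R z - g) = (2 * real M) *\<^sub>R (z - g)" using t(1) by simp
    also have "\<dots> = real M *\<^sub>R (2 *\<^sub>R z - 2 *\<^sub>R g)" by (simp add: algebra_simps)
    also have "2 *\<^sub>R z = a + b" by (simp add: z_def midpoint_def)
    also have "real M *\<^sub>R (a + b - 2 *\<^sub>R g) = a' + b'" by (simp add: a(2) b(2) trg algebra_simps scaleR_2)
    finally have "a' + b' = (\<Sum>x\<in>tr ` X. c x *\<^sub>R x)" using c(2) by simp
    moreover have "(2 * real M / t) / real M < 2" using M t(1) by (simp add: field_simps)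
    ultimately show ?thesis using c(1,3) by (intro exI[of _ c]) simp
  qed
  have "tr ` X \<subseteq> conj_orbits (tr ` A)"
  proof (rule image_subsetI)
    fix x assume "x \<in> X"
    then obtain k a where k: "k \<in> carrier G" "a \<in> A" "x = conj_vec k a" unfolding X_def conj_orbits_def by blast
    have al: "a \<in> int_lattice D" using k(2) A(2) by blast
    have "conj_vec k (tr a) = conj_vec k (real M *\<^sub>R a) - conj_vec k s"
      unfolding tr_def using int_lattice_scale[OF al, of "int M"] sl by (intro conj_vec_diff k(1)) simp_all
    also have "\<dots> = tr x"
      using conj_vec_scale_nat[OF k(1) al] conj_vec_sum_conj_orbits[OF A k(1)] by (simp add: tr_def k(3) s_def X_def)
    finally have "tr x = conj_vec k (tr a)" by simp
    then show "tr x \<in> conj_orbits (tr ` A)" using conj_orbitsI[OF k(1), of "tr a" "tr ` A"] k(2) by simp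
  qed
  moreover have "tr ` A \<subseteq> int_lattice D" using tr_lattice A(2) by blast
  ultimately show ?thesis
    using polynomial_growth_exists[OF T finite_imageI[OF A(1), of tr] _ finite_imageI[OF X(1), of tr], of \<kappa>] inner mid by blast
qed

end

section \<open>The isolator in a torsion-free group of class two, and the passage to the
  locale\<close>

context group
begin

text \<open>The commutator \<open>d\<close> of \<open>h\<close> and \<open>x\<close> is central, so
  moving \<open>h [^] n\<close> past \<open>x\<close> costs \<open>d [^] n\<close>. If
  \<open>h [^] n\<close> commutes with \<open>x\<close>, this power is trivial, and so is
  \<open>d\<close>, as \<open>H\<close> has no torsion.\<close>

lemma commutes_if_power_commutes:
  assumes H: "subgroup H G" and tf: "torsion_free G H" and cc: "\<And>a b z. a \<in> H \<Longrightarrow> b \<in> H \<Longrightarrow> z \<in> H \<Longrightarrow>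
      (a \<otimes> b \<otimes> inv a \<otimes> inv b) \<otimes> z = z \<otimes> (a \<otimes> b \<otimes> inv a \<otimes> inv b)"
    and h: "h \<in> H" and x: "x \<in> H" and n: "0 < n" "h [^] (n::nat) \<otimes> x = x \<otimes> h [^] n"
  shows "h \<otimes> x = x \<otimes> h"
proof -
  have c[simp]: "y \<in> carrier G" if "y \<in> H" for y using that subgroup.mem_carrier[OF H] by blast
  define d where "d = h \<otimes> x \<otimes> inv h \<otimes> inv x"
  have dH: "d \<in> H" unfolding d_def using h x H by (meson subgroup.m_closed subgroup.m_inv_closed)
  have dc: "d \<otimes> z = z \<otimes> d" if "z \<in> H" for z unfolding d_def using cc[OF h x that] .
  have hx: "h \<otimes> x = d \<otimes> x \<otimes> h" unfolding d_def using h x by (simp add: m_assoc)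
  have hpow: "h [^] k \<in> H" "d [^] k \<in> H" for k :: nat
    using h dH by (induction k) (auto simp: subgroup.one_closed[OF H] subgroup.m_closed[OF H])
  have pw: "h [^] k \<otimes> x = d [^] k \<otimes> x \<otimes> h [^] k" for k :: nat
  proof (induction k)
    case 0
    then show ?case using x by simp
  next
    case (Suc k)
    have "h [^] Suc k \<otimes> x = h [^] k \<otimes> (d \<otimes> x \<otimes> h)" using h x by (simp add: m_assoc hx[symmetric])
    also have "\<dots> = (h [^] k \<otimes> d) \<otimes> x \<otimes> h" using h x dH hpow by (simp add: m_assoc)
    also have "h [^] k \<otimes> d = d \<otimes> h [^] k" using dc[OF hpow(1)] by simp
    also have "d \<otimes> h [^] k \<otimes> x \<otimes> h = d \<otimes> (h [^] k \<otimes> x) \<otimes> h" using h x dH hpow by (simp add: m_assoc)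
    also have "\<dots> = (d \<otimes> d [^] k) \<otimes> x \<otimes> (h [^] k \<otimes> h)" unfolding Suc using h x dH hpow by (simp add: m_assoc)
    also have "d \<otimes> d [^] k = d [^] Suc k" using dc[OF hpow(2)[of k]] by simp
    finally show ?case by simp
  qed
  have "d [^] n \<otimes> (x \<otimes> h [^] n) = \<one> \<otimes> (x \<otimes> h [^] n)"
    using pw[of n] n(2) h x dH hpow by (simp add: m_assoc)
  then have "d [^] n = \<one>" using h x dH hpow by (subst (asm) right_cancel) auto
  then have "d = \<one>" using tf dH n(1) unfolding torsion_free_def by blast
  then show ?thesis using hx x h by simp
qed

text \<open>Some power of \<open>h\<close> lies in \<open>[H, H]\<close>, which is central by class
  two; centrality then descends from the power to \<open>h\<close>.\<close>

lemma isolator_central: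
  assumes H: "subgroup H G" and tf: "torsion_free G H" and nil: "step_nilpotent 2 G H"
    and h: "h \<in> isolator G H" and x: "x \<in> H"
  shows "h \<otimes> x = x \<otimes> h"
proof -
  have c[simp]: "y \<in> carrier G" if "y \<in> H" for y using that subgroup.mem_carrier[OF H] by blast
  have lc1: "lower_central G H (Suc 0) = derived G H"
    by (simp add: commutator_subgroup_def derived_def)
  have lc2: "lower_central G H 2 = commutator_subgroup G (derived G H) H"
    using lc1 by (simp add: numeral_2_eq_2)
  have dH: "derived G H \<subseteq> H" using derived_incl[OF order_refl H] .
  have dcent: "d \<otimes> z = z \<otimes> d" if "d \<in> derived G H" "z \<in> H" for d z
  proof -
    have "d \<in> H" using dH that(1) by blast
    have "d \<otimes> z \<otimes> inv d \<otimes> inv z \<in> commutator_subgroup G (derived G H) H"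
      unfolding commutator_subgroup_def using that by (intro generate.incl) blast
    then have "d \<otimes> z \<otimes> inv d \<otimes> inv z = \<one>" using nil lc2 by (simp add: step_nilpotent_def)
    then have "d \<otimes> z \<otimes> inv d \<otimes> inv z \<otimes> z \<otimes> d = z \<otimes> d" using \<open>d \<in> H\<close> that(2) by simp
    then show ?thesis using \<open>d \<in> H\<close> that(2) by (simp add: m_assoc)
  qed
  obtain n :: nat where n: "n > 0" "h [^] n \<in> derived G H" and hH: "h \<in> H"
    using h unfolding isolator_def by blast
  have der: "a \<otimes> b \<otimes> inv a \<otimes> inv b \<in> derived G H" if "a \<in> H" "b \<in> H" for a b
    unfolding derived_def using that by (intro generate.incl) blast
  show ?thesis
    by (rule commutes_if_power_commutes[OF H tf _ hH x n(1)]) (use dcent der n(2) x in blast)+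
qed

text \<open>Products stay in the isolator because its elements are central in \<open>H\<close>: the
  \<open>n * m\<close>-th power of a product splits into powers of the factors, both in
  \<open>[H, H]\<close>.\<close>

lemma isolator_normal:
  assumes H: "H \<lhd> G" and tf: "torsion_free G H" and nil: "step_nilpotent 2 G H"
  shows "isolator G H \<lhd> G"
proof (rule normal_invI)
  have sH: "subgroup H G" using H by (rule normal_imp_subgroup)
  have c[simp]: "y \<in> carrier G" if "y \<in> H" for y using that subgroup.mem_carrier[OF sH] by blast
  have sd: "subgroup (derived G H) G" by (rule derived_is_subgroup[OF subgroup.subset[OF sH]])
  have dpow: "d [^] k \<in> derived G H" if "d \<in> derived G H" for d and k :: nat
    using that by (induction k) (auto simp: subgroup.one_closed[OF sd] subgroup.m_closed[OF sd])
  show "subgroup (isolator G H) G"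
  proof (rule subgroupI)
    show "isolator G H \<subseteq> carrier G" by (auto simp: isolator_def)
    have "\<one> \<in> isolator G H"
      unfolding isolator_def using subgroup.one_closed[OF sH] subgroup.one_closed[OF sd] by (auto intro!: exI[of _ 1])
    then show "isolator G H \<noteq> {}" by blast
    fix a assume a: "a \<in> isolator G H"
    then obtain n :: nat where n: "n > 0" "a [^] n \<in> derived G H" and aH: "a \<in> H" unfolding isolator_def by blast
    have "inv a [^] n \<in> derived G H" using subgroup.m_inv_closed[OF sd n(2)] aH by (simp add: nat_pow_inv)
    then show "inv a \<in> isolator G H" unfolding isolator_def using n(1) subgroup.m_inv_closed[OF sH aH] by blast
    fix b assume b: "b \<in> isolator G H"
    then obtain m :: nat where m: "m > 0" "b [^] m \<in> derived G H" and bH: "b \<in> H" unfolding isolator_def by blast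
    have "(a \<otimes> b) [^] (n * m) = a [^] (n * m) \<otimes> b [^] (n * m)"
      using isolator_central[OF sH tf nil a bH] aH bH by (intro pow_mult_distrib) auto
    also have "\<dots> = (a [^] n) [^] m \<otimes> (b [^] m) [^] n" using aH bH by (simp add: nat_pow_pow mult.commute)
    also have "\<dots> \<in> derived G H" using dpow n(2) m(2) by (intro subgroup.m_closed[OF sd])
    finally have "(a \<otimes> b) [^] (n * m) \<in> derived G H" .
    moreover have "n * m > 0" using n(1) m(1) by simp
    ultimately show "a \<otimes> b \<in> isolator G H" unfolding isolator_def using subgroup.m_closed[OF sH aH bH] by blast
  qed
  fix x h assume x: "x \<in> carrier G" and h: "h \<in> isolator G H"
  obtain n :: nat where n: "n > 0" "h [^] n \<in> derived G H" and hH: "h \<in> H" using h unfolding isolator_def by blast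
  have "(x \<otimes> h \<otimes> inv x) [^] n = x \<otimes> h [^] n \<otimes> inv x" using conj_nat_pow[of "inv x" h n] x hH by simp
  also have "\<dots> \<in> derived G H" using normal.inv_op_closed2[OF derived_is_normal[OF H] x n(2)] .
  finally show "x \<otimes> h \<otimes> inv x \<in> isolator G H"
    unfolding isolator_def using n(1) normal.inv_op_closed2[OF H x hH] by blast
qed

text \<open>Injectivity of \<open>\<phi>\<close> makes the isolator the kernel of the map to the
  lattice, so the kernel axioms of the locale are statements about the isolator.\<close>

lemma central_lattice_extension_abelianization:
  fixes \<phi> :: "'a set \<Rightarrow> real ^ 'n::finite"
  assumes H: "H \<lhd> G" and fi: "finite_index G H" and tf: "torsion_free G H" and nil: "step_nilpotent 2 G H"
    and \<phi>: "\<phi> \<in> iso (abelianization_mod_torsion G H) (int_lattice_group D)"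
  shows "central_lattice_extension G H (\<lambda>h. \<phi> (isolator G H #> h)) D"
proof -
  let ?I = "isolator G H" and ?K = "G\<lparr>carrier := H\<rparr>"
  have sH: "subgroup H G" using H by (rule normal_imp_subgroup)
  interpret I: normal "isolator G H" G by (rule isolator_normal[OF H tf nil])
  have IH: "?I \<subseteq> H" by (auto simp: isolator_def)
  have c: "y \<in> carrier G" if "y \<in> H" for y using that subgroup.mem_carrier[OF sH] by blast
  have mem: "?I #> h \<in> carrier (abelianization_mod_torsion G H)" if "h \<in> H" for h
    using that by (auto simp: FactGroup_def RCOSETS_def r_coset_def)
  have bij: "bij_betw \<phi> (carrier (abelianization_mod_torsion G H)) (int_lattice D)"
    and hom: "\<phi> \<in> hom (abelianization_mod_torsion G H) (int_lattice_group D)"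
    using \<phi> by (simp_all add: iso_def int_lattice_group_def)
  have mult: "\<phi> (?I #> (x \<otimes> y)) = \<phi> (?I #> x) + \<phi> (?I #> y)" if "x \<in> H" "y \<in> H" for x y
  proof -
    have "\<phi> ((?I #> x) <#>\<^bsub>?K\<^esub> (?I #> y)) = \<phi> (?I #> x) + \<phi> (?I #> y)"
      using hom_mult[OF hom mem[OF that(1)] mem[OF that(2)]] by (simp add: FactGroup_def int_lattice_group_def)
    moreover have "(?I #> x) <#>\<^bsub>?K\<^esub> (?I #> y) = (?I #> x) <#> (?I #> y)" by (simp add: set_mult_def)
    moreover have "(?I #> x) <#> (?I #> y) = ?I #> (x \<otimes> y)" using that c by (intro I.rcos_sum)
    ultimately show ?thesis by simp
  qed
  have oneH: "\<one> \<in> H" by (rule subgroup.one_closed[OF sH])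
  have zero: "\<phi> (?I #> \<one>) = 0" using mult[OF oneH oneH] by simp
  have kernel: "x \<in> ?I" if "x \<in> H" "\<phi> (?I #> x) = 0" for x
  proof -
    have "?I #> x = ?I #> \<one>"
      using bij_betw_imp_inj_on[OF bij] mem[OF that(1)] mem[OF oneH] that(2) zero by (simp add: inj_on_def)
    moreover have "x \<in> ?I #> x" using rcos_self[OF c[OF that(1)] I.is_subgroup] .
    ultimately show ?thesis using I.subset by (simp add: coset_mult_one)
  qed
  show ?thesis
  proof (intro central_lattice_extension.intro central_lattice_extension_axioms.intro)
    show "group G" by (rule group_axioms)
    show "H \<lhd> G" by (rule H)
    show "finite (rcosets H)" using fi by (simp add: finite_index_def)
    show "\<phi> (?I #> (x \<otimes> y)) = \<phi> (?I #> x) + \<phi> (?I #> y)" if "x \<in> H" "y \<in> H" for x y by (rule mult[OF that])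
    show "x \<otimes> y = y \<otimes> x" if "x \<in> H" "\<phi> (?I #> x) = 0" "y \<in> H" for x y
      using isolator_central[OF sH tf nil kernel[OF that(1,2)] that(3)] .
    show "\<exists>j>0. x [^] (j::nat) \<in> derived G H" if "x \<in> H" "\<phi> (?I #> x) = 0" for x
      using kernel[OF that] by (auto simp: isolator_def)
    have "carrier (abelianization_mod_torsion G H) = (\<lambda>h. ?I #> h) ` H"
      by (auto simp: FactGroup_def RCOSETS_def r_coset_def)
    then show "(\<lambda>h. \<phi> (?I #> h)) ` H = int_lattice D"
      using bij_betw_imp_surj_on[OF bij] by (simp add: image_image)
  qed
qed

text \<open>By \<open>conj_action_coset\<close>, a coset \<open>H #> g\<close> acts on the image of
  \<open>h\<close> by conjugating \<open>h\<close> with \<open>g\<close>, which is how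
  \<open>conj_vec g\<close> is defined on a lift.\<close>

lemma orbit_union_eq:
  fixes \<phi> :: "'a set \<Rightarrow> real ^ 'n::finite"
  assumes H: "H \<lhd> G" and fi: "finite_index G H" and tf: "torsion_free G H" and nil: "step_nilpotent 2 G H"
    and \<phi>: "\<phi> \<in> iso (abelianization_mod_torsion G H) (int_lattice_group D)" and A: "A \<subseteq> int_lattice D"
  shows "orbit_union G H \<phi> A = central_lattice_extension.conj_orbits G H (\<lambda>h. \<phi> (isolator G H #> h)) A"
proof -
  interpret E: central_lattice_extension G H "\<lambda>h. \<phi> (isolator G H #> h)" D
    by (rule central_lattice_extension_abelianization[OF H fi tf nil \<phi>])
  have inj: "inj_on \<phi> (carrier (abelianization_mod_torsion G H))"
    using \<phi> by (simp add: iso_def bij_betw_def)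
  have act: "conj_action G H \<phi> (H #> g) a = E.conj_vec g a" if "g \<in> carrier G" "a \<in> A" for g a
  proof -
    have l: "E.lift a \<in> H" "\<phi> (isolator G H #> E.lift a) = a" using E.lift A that(2) by blast+
    show ?thesis
      using conj_action_coset[OF H isolator_normal[OF H tf nil] inj that(1) l(1)] l(2)
      by (simp add: E.conj_vec_def)
  qed
  have carr: "carrier (G Mod H) = (\<lambda>g. H #> g) ` carrier G" by (auto simp: FactGroup_def RCOSETS_def)
  have orb: "orbit (G Mod H) (conj_action G H \<phi>) a = {E.conj_vec g a | g. g \<in> carrier G}" if "a \<in> A" for a
  proof -
    have "orbit (G Mod H) (conj_action G H \<phi>) a = (\<lambda>g. conj_action G H \<phi> (H #> g) a) ` carrier G"
      by (simp only: orbit_def setcompr_eq_image Collect_mem_eq carr image_image)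
    also have "\<dots> = (\<lambda>g. E.conj_vec g a) ` carrier G" using act[OF _ that] by (intro image_cong refl)
    finally show ?thesis by (simp only: setcompr_eq_image Collect_mem_eq)
  qed
  have "orbit_union G H \<phi> A = (\<Union>a\<in>A. {E.conj_vec g a | g. g \<in> carrier G})"
    unfolding orbit_union_def using orb by (intro SUP_cong) auto
  also have "\<dots> = E.conj_orbits A" unfolding E.conj_orbits_def by blast
  finally show ?thesis .
qed

end

theorem corollary2:
  fixes G :: "('a, 'b) monoid_scheme"
    and H :: "'a set"
    and D :: "'n::finite set"
    and \<phi> :: "'a set \<Rightarrow> real ^ 'n"
  assumes "group G"
    and "finitely_generated_group G"
    and "virtually_step_nilpotent 2 G"
    and "H \<lhd> G"
    and "finite_index G H"
    and "torsion_free G H"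
    and "step_nilpotent 2 G H"
    and "\<phi> \<in> iso (abelianization_mod_torsion G H) (int_lattice_group D)"
  shows "(\<exists>S. generating_set G S \<and> polynomial_geodesic_growth G S) \<longleftrightarrow>
         (\<exists>A. finite A \<and> A \<subseteq> int_lattice D \<and>
            (let P = convex hull (orbit_union G H \<phi> A)
             in polytope P \<and> aff_dim P = int (card D) \<and>
                \<not> (\<exists>a\<in>A. \<exists>b\<in>A. a \<noteq> b \<and> (\<exists>K. K facet_of P \<and> a \<in> K \<and> b \<in> K))))"
proof -
  interpret group G by fact
  interpret E: central_lattice_extension G H "\<lambda>h. \<phi> (isolator G H #>\<^bsub>G\<^esub> h)" D
    by (rule central_lattice_extension_abelianization) fact+
  have orb: "orbit_union G H \<phi> A = E.conj_orbits A" if "A \<subseteq> int_lattice D" for A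
    by (rule orbit_union_eq) fact+
  show ?thesis
  proof
    assume "\<exists>S. generating_set G S \<and> polynomial_geodesic_growth G S"
    then obtain S where "generating_set G S" "polynomial_geodesic_growth G S" by blast
    note F = E.facets_if_polynomial_growth[OF this]
    show "\<exists>A. finite A \<and> A \<subseteq> int_lattice D \<and>
            (let P = convex hull (orbit_union G H \<phi> A)
             in polytope P \<and> aff_dim P = int (card D) \<and>
                \<not> (\<exists>a\<in>A. \<exists>b\<in>A. a \<noteq> b \<and> (\<exists>K. K facet_of P \<and> a \<in> K \<and> b \<in> K)))"
      unfolding Let_def
      by (rule exI[of _ "E.directions S"], unfold orb[OF F(2)], intro conjI) (rule F)+
  next
    assume "\<exists>A. finite A \<and> A \<subseteq> int_lattice D \<and>
            (let P = convex hull (orbit_union G H \<phi> A)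
             in polytope P \<and> aff_dim P = int (card D) \<and>
                \<not> (\<exists>a\<in>A. \<exists>b\<in>A. a \<noteq> b \<and> (\<exists>K. K facet_of P \<and> a \<in> K \<and> b \<in> K)))"
    then obtain A where A: "finite A" "A \<subseteq> int_lattice D"
      and P: "aff_dim (convex hull (orbit_union G H \<phi> A)) = int (card D)"
        "\<not> (\<exists>a\<in>A. \<exists>b\<in>A. a \<noteq> b \<and> (\<exists>K. K facet_of convex hull (orbit_union G H \<phi> A) \<and> a \<in> K \<and> b \<in> K))"
      unfolding Let_def by blast
    obtain T where T: "generating_set G T" using assms(2) unfolding finitely_generated_group_def by blast
    show "\<exists>S. generating_set G S \<and> polynomial_geodesic_growth G S"
      using E.polynomial_growth_if_facets[OF T A] P unfolding orb[OF A(2)] by blast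
  qed
qed

end
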